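(* Let $P$ be the weakening-and-projection monad on $[\mathcal H^{\mathrm{op}},\mathbf{Set}]$, i.e. the monad induced by the free-forgetful adjunction $\{w,p\}\text{-}\mathbf{GAT}\leftrightarrows[\mathcal H^{\mathrm{op}},\mathbf{Set}]$, with $PX$ described by heaps as in the context. For each $X\in[\mathcal H^{\mathrm{op}},\mathbf{Set}]$, the multiplication $\mu^P_X\colon P^2X\to PX$ agrees with that of the weakening monad $W$ on type-elements, i.e. $(\psi,(\phi,h))\mapsto(\psi\star\phi,\psi\star h)$, and on term-elements is defined at $(\psi,(\phi,h))\in P^2X(n)$ to be the mapping $\mathrm{Tm}_{P^2X}(\psi,(\phi,h))\to\mathrm{Tm}_{PX}(\psi\star\phi,\psi\star h)$ given by $$a\mapsto\begin{cases}a&\text{if }a\in\mathrm{Tm}_X(h_n(\#n));\\ \pi_i&\text{if }a=\pi_i(\psi,(\phi,h));\\ \pi_{\psi^{\#n-i}(n)}&\text{if }a=\pi_i(\phi_n,h_n).\end{cases}$$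
   Context: \textbf{Expressions and judgements.} Fix a denumerable set $\mathrm{Var}$ of variables. Given an alphabet $\Xi$, the expressions over $\Xi$ are generated as follows: each $x\in\mathrm{Var}$ is an expression; if $n\geq 0$, $e_1,\dots,e_n$ are expressions and $w\in\Xi$, then $w(e_1,\dots,e_n)$ is an expression (written $w$ when $n=0$). $\mathsf{fv}$ denotes free variables and $e'[e/x]$ substitution of $e$ for $x$ in $e'$. A context is a (possibly empty) list $x_1:T_1,\dots,x_n:T_n$ of distinct variables $x_i$ and expressions $T_i$; $\mathsf{fv}(\Gamma)$ is the set of variables occurring in $\Gamma$. A judgement is a string $\Gamma\vdash T\ \mathsf{type}$ (type judgement), $\Gamma\vdash t:T$ (term judgement), $\Gamma\vdash T=T'\ \mathsf{type}$ (type equality) or $\Gamma\vdash t=t':T$ (term equality), with $\Gamma$ a context and $t,t',T,T'$ expressions; its degree is one more than the length of $\Gamma$. The boundary of a judgement is a list of judgements: $\partial(\vdash T\ \mathsf{type})=()$; $\partial(\Gamma,x:T\vdash T'\ \mathsf{type})=(\Gamma\vdash T\ \mathsf{type})$; $\partial(\Gamma\vdash t:T)=(\Gamma\vdash T\ \mathsf{type})$; $\partial(\Gamma\vdash T=T'\ \mathsf{type})=(\Gamma\vdash T\ \mathsf{type},\ \Gamma\vdash T'\ \mathsf{type})$; $\partial(\Gamma\vdash t=t':T)=(\Gamma\vdash t:T,\ \Gamma\vdash t':T)$. \textbf{Deduction rules} (premises $\Longrightarrow$ conclusion; $\mathcal J$ stands for the right-hand side of any of the four judgement forms). \emph{Equality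 and $\alpha$ rules}: $\Gamma\vdash t:T\Longrightarrow\Gamma\vdash t=t:T$; $\Gamma\vdash t_1=t_2:T\Longrightarrow\Gamma\vdash t_2=t_1:T$; $\Gamma\vdash t_1=t_2:T$ and $\Gamma\vdash t_2=t_3:T\Longrightarrow\Gamma\vdash t_1=t_3:T$; $\Gamma\vdash T\ \mathsf{type}\Longrightarrow\Gamma\vdash T=T\ \mathsf{type}$; $\Gamma\vdash T_1=T_2\ \mathsf{type}\Longrightarrow\Gamma\vdash T_2=T_1\ \mathsf{type}$; $\Gamma\vdash T_1=T_2\ \mathsf{type}$ and $\Gamma\vdash T_2=T_3\ \mathsf{type}\Longrightarrow\Gamma\vdash T_1=T_3\ \mathsf{type}$; $\Gamma\vdash T_1=T_2\ \mathsf{type}$ and $\Gamma\vdash t:T_1\Longrightarrow\Gamma\vdash t:T_2$; $\Gamma\vdash T_1=T_2\ \mathsf{type}$ and $\Gamma\vdash t_1=t_2:T_1\Longrightarrow\Gamma\vdash t_1=t_2:T_2$; $\Gamma\vdash\mathcal J\Longrightarrow\sigma\cdot\Gamma\vdash\sigma\cdot\mathcal J$ for any permutation $\sigma\in\mathrm{Sym}(\mathrm{Var})$ acting on variables. \emph{Weakening} ($w$): $\Gamma\vdash T\ \mathsf{type}$ and $\Gamma,\Delta\vdash\mathcal J\Longrightarrow\Gamma,y:T,\Delta\vdash\mathcal J$, for $y\notin\mathsf{fv}(\Gamma)\cup\mathsf{fv}(\Delta)$. \emph{Projection} ($p$): $\Gamma\vdash T\ \mathsf{type}\Longrightarrow\Gamma,y:T\vdash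 y:T$, for $y\notin\mathsf{fv}(\Gamma)$. \textbf{$\{w,p\}$-GATs.} A $\{w,p\}$-GAT $\mathbb T$ consists of a collection $\Omega$ of type-constants, a collection $\Sigma$ of term-constants and a collection $\Lambda$ of basic judgements over $\Omega\amalg\Sigma$ such that: for each $A\in\Omega$ there is a unique judgement in $\Lambda$ of the form $x_1:T_1,\dots,x_{n-1}:T_{n-1}\vdash A(x_1,\dots,x_{n-1})\ \mathsf{type}$; for each $f\in\Sigma$ there is a unique judgement in $\Lambda$ of the form $x_1:T_1,\dots,x_{n-1}:T_{n-1}\vdash f(x_1,\dots,x_{n-1}):T$; all other elements of $\Lambda$ are type or term equality judgements; each element of $\Lambda$ lies in $\mathbb T^*$. Here $\mathbb T^*$, the collection of derived judgements, is the smallest collection closed under all the rules listed above and containing $\mathcal J\in\Lambda$ whenever it contains each judgement in $\partial(\mathcal J)$. An interpretation $\phi\colon\mathbb T\to\mathbb U$ is a function $\phi\colon\mathbb T^*\to\mathbb U^*$ preserving boundaries and preserving deduction: viewing each rule with $n$ premises (for each choice of parameters such as $y$ or $\sigma$) as an $n$-ary partial function $r$ on judgements, $\phi(r(\mathcal J_1,\dots,\mathcal J_n))=r(\phi(\mathcal J_1),\dots,\phi(\mathcal J_n))$ whenever both sides are defined. On derived type judgements, $(x_1:S_1,\dots,x_{n-1}:S_{n-1}\vdash S_n\ \mathsf{type})\equiv(y_1:T_1,\dots,y_{m-1}:T_{m-1}\vdash T_m\ \mathsf{type})$ iff $n=m$ and for $1\le i\le n$ the judgement $x_1:S_1,\dots,x_{i-1}:S_{i-1}\vdash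 S_i=T_i[x_1/y_1,\dots,x_{i-1}/y_{i-1}]\ \mathsf{type}$ is derived. On derived term judgements, $(x_1:S_1,\dots,x_{n-1}:S_{n-1}\vdash s:S_n)\equiv(y_1:T_1,\dots,y_{m-1}:T_{m-1}\vdash t:T_m)$ iff their boundaries are $\equiv$ and $x_1:S_1,\dots,x_{n-1}:S_{n-1}\vdash s=t[x_1/y_1,\dots,x_{n-1}/y_{n-1}]:S_n$ is derived. $\{w,p\}\text{-}\mathbf{GAT}$ has $\{w,p\}$-GATs as objects and, as morphisms, interpretations modulo: $\phi\sim\phi'$ iff $\phi(\mathcal J)\equiv\phi'(\mathcal J)$ for each derived type or term judgement $\mathcal J$. (The weakening monad $W$ is defined in the same way using $\{w\}$-GATs, in which the projection rule is omitted.) \textbf{Type-and-term structures and the monad.} $[a,b]=\{a,\dots,b\}\subset\mathbb N$ and $[n]=[1,n]$. $\mathcal H$ is the category freely generated by the graph with objects $n$ and $n_t$ ($n\ge1$) and arrows $n\to n+1$ and $n\to n_t$. For $X\in[\mathcal H^{\mathrm{op}},\mathbf{Set}]$ the maps $X(n+1)\to X(n)$, $X(n_t)\to X(n)$ are written $\partial$; elements of $X(n)$ are type-elements, elements of $X(n_t)$ term-elements; for $A\in X(n)$, $\mathrm{Tm}_X(A)=\{a\in X(n_t):\partial a=A\}$. The forgetful functor $V\colon\{w,p\}\text{-}\mathbf{GAT}\to[\mathcal H^{\mathrm{op}},\mathbf{Set}]$ has $V\mathbb T(n)$ (resp. $V\mathbb T(n_t)$) the set of derived type (resp. term) judgements of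 degree $n$ modulo $\equiv$, boundaries induced by $\partial$, and $V\phi([\mathcal J])=[\phi(\mathcal J)]$. Its left adjoint $G$ sends $X$ to the free $\{w,p\}$-GAT $GX$ whose type- and term-constants are the type- and term-elements of $X$ and whose basic judgements are $\mathcal J_A=(x_1:A_1,x_2:A_2(x_1),\dots,x_{n-1}:A_{n-1}(x_1,\dots,x_{n-2})\vdash A(x_1,\dots,x_{n-1})\ \mathsf{type})$ for $A\in X(n)$, where $A_i=\partial^{n-i}A$, and, in the same context, $\mathcal J_a=(\dots\vdash a(x_1,\dots,x_{n-1}):A(x_1,\dots,x_{n-1}))$ for $a\in\mathrm{Tm}_X(A)$. The adjunction unit is $A\mapsto[\mathcal J_A]$, $a\mapsto[\mathcal J_a]$; the counit $\epsilon_{\mathbb T}\colon GV\mathbb T\to\mathbb T$ is given on basic judgements by $\mathcal J_{[\mathcal J]}\mapsto\mathcal J$. The monad is $P=VG$ with multiplication $\mu^P=V\epsilon G$. \textbf{Heaps and description of $PX$.} A min-heap of size $n$ is a function $\phi\colon[0,n]\to[0,n]$ with $\phi(0)=0$ and $\phi(i)<i$ for $i\in[n]$; $\mathrm{Hp}(n)$ is the set of these. For $\phi\in\mathrm{Hp}(n+1)$, $\partial\phi\in\mathrm{Hp}(n)$ is its restriction to $[0,n]$. For $i\in[n]$, $\mathsf{dp}_\phi(i)=|\{\phi(i),\phi^2(i),\dots\}|$. The presheaf $[\phi]$ has $[\phi](m)=\{i\in[n]:\mathsf{dp}_\phi(i)=m\}$, $[\phi](m_t)=\emptyset$, and $\partial(i)=\phi(i)$.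 For $h\colon[\phi]\to X$, $\partial h$ is its restriction to $[\partial\phi]$. One has $PX(n)=WX(n)=\sum_{\phi\in\mathrm{Hp}(n)}[\mathcal H^{\mathrm{op}},\mathbf{Set}]([\phi],X)$ with $\partial(\phi,h)=(\partial\phi,\partial h)$ and $\mathrm{Tm}_{PX}(\phi,h)=\mathrm{Tm}_X(h(n))+\{\pi_i:i\in[n-1],\phi(n)=\phi(i),h(n)=h(i)\}$. Here $(\phi,h)$ is identified with the class of the judgement $x_1:T_1,\dots,x_{n-1}:T_{n-1}\vdash T_n\ \mathsf{type}$ of $GX$ with $T_i=h(i)(x_{j_1},\dots,x_{j_{k-1}})$, $k=\mathsf{dp}_\phi(i)$, $j_\ell=\phi^{k-\ell}(i)$; $a\in\mathrm{Tm}_X(h(n))$ with the class of $x_1:T_1,\dots,x_{n-1}:T_{n-1}\vdash a(x_{j_1},\dots,x_{j_{k-1}}):T_n$ (indices for $i=n$); and $\pi_i$ with the class of $x_1:T_1,\dots,x_{n-1}:T_{n-1}\vdash x_i:T_i$. \textbf{Elements of $P^2X$ and the operation $\star$.} An element of $P^2X(n)=W^2X(n)$ is a pair $(\psi,(\phi,h))$ with $\psi\in\mathrm{Hp}(n)$ and, for each $i\in[n]$, a heap $\phi_i\in\mathrm{Hp}(\#i)$ and a map $h_i\colon[\phi_i]\to X$, where $\#i=\mathsf{dp}_\psi(i)$, such that $(\partial\phi_i,\partial h_i)=(\phi_j,h_j)$ whenever $\psi(i)=j>0$. The set $\mathrm{Tm}_{P^2X}(\psi,(\phi,h))$ is $$\mathrm{Tm}_{PX}(\phi_n,h_n)+\{\pi_i(\psi,(\phi,h)):i\in[n-1],\psi(n)=\psi(i),\phi_n=\phi_i,h_n=h_i\},$$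 and $\mathrm{Tm}_{PX}(\phi_n,h_n)$ is in turn $$\mathrm{Tm}_X(h_n(\#n))+\{\pi_i(\phi_n,h_n):i\in[\#n-1],\phi_n(\#n)=\phi_n(i),h_n(\#n)=h_n(i)\},$$ the projections being annotated to distinguish the two kinds. The heap $\psi\star\phi\in\mathrm{Hp}(n)$ is $(\psi\star\phi)(i)=\psi^{\#i-\phi_i(\#i)}(i)$ for $i\in[n]$ (and $0\mapsto0$), and $\psi\star h\colon[\psi\star\phi]\to X$ is $(\psi\star h)(i)=h_i(\#i)$. *)

theory Defs
  imports "HOL-Library.FuncSet"
begin

section \<open>Expressions and judgements\<close>

text \<open>The denumerable set of variables is the type of natural numbers; the variable \<open>x\<^sub>i\<close>
  is the number \<open>i\<close>. The type parameter \<open>'w\<close> is the alphabet.\<close>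

type_synonym var = nat

datatype 'w expr = Var var | App 'w "'w expr list"

primrec fv :: "'w expr \<Rightarrow> var set" where
  "fv (Var x) = {x}"
| "fv (App w es) = \<Union> (set (map fv es))"

primrec subst :: "(var \<Rightarrow> 'w expr) \<Rightarrow> 'w expr \<Rightarrow> 'w expr" where
  "subst s (Var x) = s x"
| "subst s (App w es) = App w (map (subst s) es)"

type_synonym 'w ctx = "(var \<times> 'w expr) list"

datatype 'e rhs =
    Type 'e           \<comment> \<open>\<open>T type\<close>\<close>
  | Term 'e 'e        \<comment> \<open>\<open>t : T\<close>\<close>
  | TypeEq 'e 'e      \<comment> \<open>\<open>T = T' type\<close>\<close>
  | TermEq 'e 'e 'e   \<comment> \<open>\<open>t = t' : T\<close>\<close>

datatype 'w judgement = Judgement (jctx: "'w ctx") (jrhs: "'w expr rhs")  (infix "\<turnstile>" 55)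

definition vars :: "'w ctx \<Rightarrow> var list" where
  "vars \<Gamma> = map fst \<Gamma>"

definition fv_ctx :: "'w ctx \<Rightarrow> var set" where
  "fv_ctx \<Gamma> = set (vars \<Gamma>) \<union> (\<Union>T\<in>snd ` set \<Gamma>. fv T)"

definition degree :: "'w judgement \<Rightarrow> nat" where
  "degree J = length (jctx J) + 1"

definition judgement_over :: "'w set \<Rightarrow> 'w judgement \<Rightarrow> bool" where
  "judgement_over W J \<longleftrightarrow> distinct (vars (jctx J)) \<and>
     (\<forall>e \<in> snd ` set (jctx J) \<union> set_rhs (jrhs J). set_expr e \<subseteq> W)"

fun boundary :: "'w judgement \<Rightarrow> 'w judgement list" where
  "boundary (\<Gamma> \<turnstile> Type T) =
     (if \<Gamma> = [] then [] else [butlast \<Gamma> \<turnstile> Type (snd (last \<Gamma>))])"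
| "boundary (\<Gamma> \<turnstile> Term t T) = [\<Gamma> \<turnstile> Type T]"
| "boundary (\<Gamma> \<turnstile> TypeEq T T') = [\<Gamma> \<turnstile> Type T, \<Gamma> \<turnstile> Type T']"
| "boundary (\<Gamma> \<turnstile> TermEq t t' T) = [\<Gamma> \<turnstile> Term t T, \<Gamma> \<turnstile> Term t' T]"

definition permute_expr :: "(var \<Rightarrow> var) \<Rightarrow> 'w expr \<Rightarrow> 'w expr" where
  "permute_expr \<sigma> = subst (\<lambda>x. Var (\<sigma> x))"

definition permute :: "(var \<Rightarrow> var) \<Rightarrow> 'w judgement \<Rightarrow> 'w judgement" where
  "permute \<sigma> J =
     map (map_prod \<sigma> (permute_expr \<sigma>)) (jctx J) \<turnstile> map_rhs (permute_expr \<sigma>) (jrhs J)"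


section \<open>Deduction rules\<close>

datatype rule =
    TmRefl | TmSym | TmTrans | TyRefl | TySym | TyTrans | TmConv | TmEqConv
  | Perm "var \<Rightarrow> var" | Weaken var | Project var

text \<open>\<open>infers r Js J\<close> says that the partial function \<open>r\<close> is defined at the premises \<open>Js\<close>,
  with value \<open>J\<close>.\<close>

inductive infers :: "rule \<Rightarrow> 'w judgement list \<Rightarrow> 'w judgement \<Rightarrow> bool" where
  "infers TmRefl [\<Gamma> \<turnstile> Term t T] (\<Gamma> \<turnstile> TermEq t t T)"
| "infers TmSym [\<Gamma> \<turnstile> TermEq t1 t2 T] (\<Gamma> \<turnstile> TermEq t2 t1 T)"
| "infers TmTrans [\<Gamma> \<turnstile> TermEq t1 t2 T, \<Gamma> \<turnstile> TermEq t2 t3 T] (\<Gamma> \<turnstile> TermEq t1 t3 T)"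
| "infers TyRefl [\<Gamma> \<turnstile> Type T] (\<Gamma> \<turnstile> TypeEq T T)"
| "infers TySym [\<Gamma> \<turnstile> TypeEq T1 T2] (\<Gamma> \<turnstile> TypeEq T2 T1)"
| "infers TyTrans [\<Gamma> \<turnstile> TypeEq T1 T2, \<Gamma> \<turnstile> TypeEq T2 T3] (\<Gamma> \<turnstile> TypeEq T1 T3)"
| "infers TmConv [\<Gamma> \<turnstile> TypeEq T1 T2, \<Gamma> \<turnstile> Term t T1] (\<Gamma> \<turnstile> Term t T2)"
| "infers TmEqConv [\<Gamma> \<turnstile> TypeEq T1 T2, \<Gamma> \<turnstile> TermEq t1 t2 T1] (\<Gamma> \<turnstile> TermEq t1 t2 T2)"
| "bij \<sigma> \<Longrightarrow> infers (Perm \<sigma>) [J] (permute \<sigma> J)"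
| "y \<notin> fv_ctx \<Gamma> \<union> fv_ctx \<Delta> \<Longrightarrow>
     infers (Weaken y) [\<Gamma> \<turnstile> Type T, \<Gamma> @ \<Delta> \<turnstile> \<J>] (\<Gamma> @ (y, T) # \<Delta> \<turnstile> \<J>)"
| "y \<notin> fv_ctx \<Gamma> \<Longrightarrow> infers (Project y) [\<Gamma> \<turnstile> Type T] (\<Gamma> @ [(y, T)] \<turnstile> Term (Var y) T)"

text \<open>Everything below is parametrised by the set \<open>R\<close> of available rules, so that the
  weakening monad and the weakening-and-projection monad are instances of one definition.\<close>

definition wp_rules :: "rule set" where
  "wp_rules = UNIV"

definition w_rules :: "rule set" where
  "w_rules = UNIV - range Project"


section \<open>Generalised algebraic theories\<close>

record ('o, 's) gat =
  tyconsts :: "'o set"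
  tmconsts :: "'s set"
  basics :: "('o + 's) judgement set"

inductive_set derived :: "rule set \<Rightarrow> ('o, 's) gat \<Rightarrow> ('o + 's) judgement set"
  for R :: "rule set" and T :: "('o, 's) gat" where
  basic: "J \<in> basics T \<Longrightarrow> (\<And>K. K \<in> set (boundary J) \<Longrightarrow> K \<in> derived R T) \<Longrightarrow> J \<in> derived R T"
| rule: "r \<in> R \<Longrightarrow> infers r Js J \<Longrightarrow> (\<And>K. K \<in> set Js \<Longrightarrow> K \<in> derived R T) \<Longrightarrow> J \<in> derived R T"

definition introduces_type :: "'o \<Rightarrow> ('o + 's) judgement \<Rightarrow> bool" where
  "introduces_type A J \<longleftrightarrow> (\<exists>\<Gamma>. J = (\<Gamma> \<turnstile> Type (App (Inl A) (map Var (vars \<Gamma>)))))"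

definition introduces_term :: "'s \<Rightarrow> ('o + 's) judgement \<Rightarrow> bool" where
  "introduces_term f J \<longleftrightarrow> (\<exists>\<Gamma> T. J = (\<Gamma> \<turnstile> Term (App (Inr f) (map Var (vars \<Gamma>))) T))"

definition is_equality :: "'w judgement \<Rightarrow> bool" where
  "is_equality J \<longleftrightarrow> (\<exists>\<Gamma> T T'. J = (\<Gamma> \<turnstile> TypeEq T T')) \<or> (\<exists>\<Gamma> t t' T. J = (\<Gamma> \<turnstile> TermEq t t' T))"

definition is_gat :: "rule set \<Rightarrow> ('o, 's) gat \<Rightarrow> bool" where
  "is_gat R T \<longleftrightarrow>
     (\<forall>J\<in>basics T. judgement_over (tyconsts T <+> tmconsts T) J) \<and>
     (\<forall>A\<in>tyconsts T. \<exists>!J. J \<in> basics T \<and> introduces_type A J) \<and>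
     (\<forall>f\<in>tmconsts T. \<exists>!J. J \<in> basics T \<and> introduces_term f J) \<and>
     (\<forall>J\<in>basics T. (\<exists>A\<in>tyconsts T. introduces_type A J) \<or>
        (\<exists>f\<in>tmconsts T. introduces_term f J) \<or> is_equality J) \<and>
     basics T \<subseteq> derived R T"

text \<open>An interpretation is only relevant on derived judgements; its values elsewhere are
  arbitrary.\<close>

definition is_interp :: "rule set \<Rightarrow> ('o, 's) gat \<Rightarrow> ('p, 'q) gat \<Rightarrow>
    (('o + 's) judgement \<Rightarrow> ('p + 'q) judgement) \<Rightarrow> bool" where
  "is_interp R T U \<phi> \<longleftrightarrow>
     is_gat R T \<and> is_gat R U \<and>
     \<phi> \<in> derived R T \<rightarrow> derived R U \<and>
     (\<forall>J\<in>derived R T. boundary (\<phi> J) = map \<phi> (boundary J)) \<and>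
     (\<forall>r\<in>R. \<forall>Js J K. set Js \<subseteq> derived R T \<longrightarrow> infers r Js J \<longrightarrow> infers r (map \<phi> Js) K \<longrightarrow> \<phi> J = K)"

definition type_judgements :: "rule set \<Rightarrow> ('o, 's) gat \<Rightarrow> ('o + 's) judgement set" where
  "type_judgements R T = {J \<in> derived R T. \<exists>\<Gamma> S. J = (\<Gamma> \<turnstile> Type S)}"

definition term_judgements :: "rule set \<Rightarrow> ('o, 's) gat \<Rightarrow> ('o + 's) judgement set" where
  "term_judgements R T = {J \<in> derived R T. \<exists>\<Gamma> s S. J = (\<Gamma> \<turnstile> Term s S)}"

text \<open>\<open>replace [y\<^sub>1, \<dots>] [x\<^sub>1, \<dots>] e\<close> is the simultaneous substitution \<open>e[x\<^sub>1/y\<^sub>1, \<dots>]\<close>.\<close>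

definition replace :: "var list \<Rightarrow> var list \<Rightarrow> 'w expr \<Rightarrow> 'w expr" where
  "replace ys xs = subst (\<lambda>v. case map_of (zip ys xs) v of Some x \<Rightarrow> Var x | None \<Rightarrow> Var v)"

definition type_equiv :: "rule set \<Rightarrow> ('o, 's) gat \<Rightarrow> ('o + 's) ctx \<Rightarrow> ('o + 's) expr \<Rightarrow>
    ('o + 's) ctx \<Rightarrow> ('o + 's) expr \<Rightarrow> bool" where
  "type_equiv R T \<Gamma> S \<Delta> S' \<longleftrightarrow> length \<Gamma> = length \<Delta> \<and>
     (\<forall>i\<le>length \<Gamma>.
        (take i \<Gamma> \<turnstile> TypeEq ((map snd \<Gamma> @ [S]) ! i)
           (replace (take i (vars \<Delta>)) (take i (vars \<Gamma>)) ((map snd \<Delta> @ [S']) ! i))) \<in> derived R T)"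

fun equiv_judgements :: "rule set \<Rightarrow> ('o, 's) gat \<Rightarrow> ('o + 's) judgement \<Rightarrow> ('o + 's) judgement \<Rightarrow> bool"
  where
  "equiv_judgements R T (\<Gamma> \<turnstile> Type S) (\<Delta> \<turnstile> Type S') = type_equiv R T \<Gamma> S \<Delta> S'"
| "equiv_judgements R T (\<Gamma> \<turnstile> Term s S) (\<Delta> \<turnstile> Term t S') =
     (type_equiv R T \<Gamma> S \<Delta> S' \<and>
      (\<Gamma> \<turnstile> TermEq s (replace (vars \<Delta>) (vars \<Gamma>) t) S) \<in> derived R T)"
| "equiv_judgements R T _ _ = False"

definition jrel :: "rule set \<Rightarrow> ('o, 's) gat \<Rightarrow> (('o + 's) judgement \<times> ('o + 's) judgement) set" where
  "jrel R T = {(J, K). J \<in> derived R T \<and> K \<in> derived R T \<and> equiv_judgements R T J K}"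

definition jclass :: "rule set \<Rightarrow> ('o, 's) gat \<Rightarrow> ('o + 's) judgement \<Rightarrow> ('o + 's) judgement set" where
  "jclass R T J = jrel R T `` {J}"

definition interp_rel :: "rule set \<Rightarrow> ('o, 's) gat \<Rightarrow> ('p, 'q) gat \<Rightarrow>
    ((('o + 's) judgement \<Rightarrow> ('p + 'q) judgement) \<times>
     (('o + 's) judgement \<Rightarrow> ('p + 'q) judgement)) set" where
  "interp_rel R T U = {(\<phi>, \<phi>'). is_interp R T U \<phi> \<and> is_interp R T U \<phi>' \<and>
     (\<forall>J \<in> type_judgements R T \<union> term_judgements R T. (\<phi> J, \<phi>' J) \<in> jrel R U)}"

text \<open>The morphisms of the category of GATs.\<close>

definition gat_hom :: "rule set \<Rightarrow> ('o, 's) gat \<Rightarrow> ('p, 'q) gat \<Rightarrow>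
    (('o + 's) judgement \<Rightarrow> ('p + 'q) judgement) set set" where
  "gat_hom R T U = {\<phi>. is_interp R T U \<phi>} // interp_rel R T U"


section \<open>Type-and-term structures\<close>

text \<open>A presheaf on the free category \<open>\<H>\<close> amounts to its values at the objects \<open>n\<close> and \<open>n\<^sub>t\<close>
  and its action on the generating arrows: \<open>tyel X n\<close> is \<open>X(n)\<close>, \<open>tmel X n\<close> is \<open>X(n\<^sub>t)\<close>,
  \<open>bdty X n\<close> is the map from \<open>X(n+1)\<close> to \<open>X(n)\<close> and \<open>bdtm X n\<close> the map from \<open>X(n\<^sub>t)\<close> to \<open>X(n)\<close>.
  Only \<open>n \<ge> 1\<close> is meaningful. The sets \<open>X(n)\<close> need not be disjoint for different \<open>n\<close>, so
  a type-element is a pair of \<open>n\<close> and an element of \<open>X(n)\<close>; likewise for term-elements.\<close>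

record ('a, 'b) presheaf =
  tyel :: "nat \<Rightarrow> 'a set"
  tmel :: "nat \<Rightarrow> 'b set"
  bdty :: "nat \<Rightarrow> 'a \<Rightarrow> 'a"
  bdtm :: "nat \<Rightarrow> 'b \<Rightarrow> 'a"

definition is_presheaf :: "('a, 'b) presheaf \<Rightarrow> bool" where
  "is_presheaf X \<longleftrightarrow>
     (\<forall>n\<ge>1. bdty X n \<in> tyel X (n + 1) \<rightarrow> tyel X n \<and> bdtm X n \<in> tmel X n \<rightarrow> tyel X n)"

definition Tm :: "('a, 'b) presheaf \<Rightarrow> nat \<Rightarrow> 'a \<Rightarrow> 'b set" where
  "Tm X n A = {a \<in> tmel X n. bdtm X n a = A}"

text \<open>\<open>bdpow X m k\<close> is \<open>\<partial>\<^sup>k\<close> from \<open>X(m+k)\<close> to \<open>X(m)\<close>.\<close>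

primrec bdpow :: "('a, 'b) presheaf \<Rightarrow> nat \<Rightarrow> nat \<Rightarrow> 'a \<Rightarrow> 'a" where
  "bdpow X m 0 A = A"
| "bdpow X m (Suc k) A = bdpow X m k (bdty X (m + k) A)"


section \<open>The free-forgetful adjunction and its monad\<close>

definition class_boundary ::
    "rule set \<Rightarrow> ('o, 's) gat \<Rightarrow> ('o + 's) judgement set \<Rightarrow> ('o + 's) judgement set" where
  "class_boundary R T c = (\<Union>J\<in>c. \<Union>K\<in>set (boundary J). jclass R T K)"

definition forget ::
    "rule set \<Rightarrow> ('o, 's) gat \<Rightarrow> (('o + 's) judgement set, ('o + 's) judgement set) presheaf" where
  "forget R T =
     \<lparr> tyel = (\<lambda>n. {J \<in> type_judgements R T. degree J = n} // jrel R T),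
       tmel = (\<lambda>n. {J \<in> term_judgements R T. degree J = n} // jrel R T),
       bdty = (\<lambda>n. class_boundary R T),
       bdtm = (\<lambda>n. class_boundary R T) \<rparr>"

text \<open>The forgetful functor on a morphism \<open>\<Phi>\<close> with codomain \<open>U\<close>: it sends \<open>[J]\<close> to \<open>[\<phi> J]\<close>,
  for any \<open>\<phi>\<close> in the class \<open>\<Phi>\<close>.\<close>

definition forget_map :: "rule set \<Rightarrow> ('p, 'q) gat \<Rightarrow>
    (('o + 's) judgement \<Rightarrow> ('p + 'q) judgement) set \<Rightarrow>
    ('o + 's) judgement set \<Rightarrow> ('p + 'q) judgement set" where
  "forget_map R U \<Phi> c = (\<Union>\<phi>\<in>\<Phi>. \<Union>J\<in>c. jclass R U (\<phi> J))"

definition basic_ctx :: "('a, 'b) presheaf \<Rightarrow> nat \<Rightarrow> 'a \<Rightarrow> (nat \<times> 'a + nat \<times> 'b) ctx" where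
  "basic_ctx X n A =
     map (\<lambda>i. (i, App (Inl (i, bdpow X i (n - i) A)) (map Var [1..<i]))) [1..<n]"

definition basic_type :: "('a, 'b) presheaf \<Rightarrow> nat \<Rightarrow> 'a \<Rightarrow> (nat \<times> 'a + nat \<times> 'b) judgement" where
  "basic_type X n A = (basic_ctx X n A \<turnstile> Type (App (Inl (n, A)) (map Var [1..<n])))"

definition basic_term :: "('a, 'b) presheaf \<Rightarrow> nat \<Rightarrow> 'b \<Rightarrow> (nat \<times> 'a + nat \<times> 'b) judgement" where
  "basic_term X n a =
     (basic_ctx X n (bdtm X n a) \<turnstile>
        Term (App (Inr (n, a)) (map Var [1..<n])) (App (Inl (n, bdtm X n a)) (map Var [1..<n])))"

definition free :: "('a, 'b) presheaf \<Rightarrow> (nat \<times> 'a, nat \<times> 'b) gat" where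
  "free X =
     \<lparr> tyconsts = {(n, A). n \<ge> 1 \<and> A \<in> tyel X n},
       tmconsts = {(n, a). n \<ge> 1 \<and> a \<in> tmel X n},
       basics = {basic_type X n A |n A. n \<ge> 1 \<and> A \<in> tyel X n} \<union>
                {basic_term X n a |n a. n \<ge> 1 \<and> a \<in> tmel X n} \<rparr>"

text \<open>The counit is the morphism given on basic judgements by \<open>\<J>\<^bsub>[J]\<^esub> \<mapsto> J\<close>; since interpretations
  are taken modulo equivalence of their values, this is an equation up to equivalence.\<close>

definition is_counit :: "rule set \<Rightarrow> ('o, 's) gat \<Rightarrow>
    ((nat \<times> ('o + 's) judgement set + nat \<times> ('o + 's) judgement set) judgement \<Rightarrow>
      ('o + 's) judgement) set \<Rightarrow> bool" where
  "is_counit R T \<Phi> \<longleftrightarrow> \<Phi> \<in> gat_hom R (free (forget R T)) T \<and>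
     (\<forall>\<epsilon>\<in>\<Phi>.
        (\<forall>J\<in>type_judgements R T.
           (\<epsilon> (basic_type (forget R T) (degree J) (jclass R T J)), J) \<in> jrel R T) \<and>
        (\<forall>J\<in>term_judgements R T.
           (\<epsilon> (basic_term (forget R T) (degree J) (jclass R T J)), J) \<in> jrel R T))"

definition counit :: "rule set \<Rightarrow> ('o, 's) gat \<Rightarrow>
    ((nat \<times> ('o + 's) judgement set + nat \<times> ('o + 's) judgement set) judgement \<Rightarrow>
      ('o + 's) judgement) set" where
  "counit R T = (THE \<Phi>. is_counit R T \<Phi>)"

definition monad :: "rule set \<Rightarrow> ('a, 'b) presheaf \<Rightarrow>
    ((nat \<times> 'a + nat \<times> 'b) judgement set, (nat \<times> 'a + nat \<times> 'b) judgement set) presheaf" where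
  "monad R X = forget R (free X)"

text \<open>The multiplication \<open>\<mu>\<^sub>X = V \<epsilon>\<^bsub>G X\<^esub>\<close>, on type-elements and term-elements alike.\<close>

definition mult :: "rule set \<Rightarrow> ('a, 'b) presheaf \<Rightarrow>
    (nat \<times> (nat \<times> 'a + nat \<times> 'b) judgement set +
     nat \<times> (nat \<times> 'a + nat \<times> 'b) judgement set) judgement set \<Rightarrow>
    (nat \<times> 'a + nat \<times> 'b) judgement set" where
  "mult R X = forget_map R (free X) (counit R (free X))"


section \<open>Heaps\<close>

text \<open>Functions on \<open>[0,n]\<close> and \<open>[n]\<close> are extensional, so that equality of heaps and of
  presheaf maps out of them is equality in HOL.\<close>

definition Hp :: "nat \<Rightarrow> (nat \<Rightarrow> nat) set" where
  "Hp n = {\<phi> \<in> {0..n} \<rightarrow>\<^sub>E {0..n}. \<phi> 0 = 0 \<and> (\<forall>i\<in>{1..n}. \<phi> i < i)}"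

definition dp :: "(nat \<Rightarrow> nat) \<Rightarrow> nat \<Rightarrow> nat" where
  "dp \<phi> i = card {(\<phi> ^^ k) i |k. k \<ge> 1}"

text \<open>The presheaf maps from \<open>[\<phi>]\<close> to \<open>X\<close>: as \<open>[\<phi>]\<close> has no term-elements, they are the
  functions on \<open>[n]\<close> that take \<open>i\<close> into \<open>X(dp \<phi> i)\<close> and commute with \<open>\<partial>\<close>.\<close>

definition heap_maps :: "('a, 'b) presheaf \<Rightarrow> nat \<Rightarrow> (nat \<Rightarrow> nat) \<Rightarrow> (nat \<Rightarrow> 'a) set" where
  "heap_maps X n \<phi> =
     {h \<in> (\<Pi>\<^sub>E i\<in>{1..n}. tyel X (dp \<phi> i)).
        \<forall>i\<in>{1..n}. \<phi> i > 0 \<longrightarrow> h (\<phi> i) = bdty X (dp \<phi> (\<phi> i)) (h i)}"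

text \<open>The summands of \<open>Tm\<^bsub>PX\<^esub>(\<phi>,h)\<close>: elements of \<open>Tm\<^bsub>X\<^esub>(h(n))\<close> and projections \<open>\<pi>\<^sub>i\<close>.\<close>

datatype 'b pterm = Old 'b | Proj nat

type_synonym 'a ptype = "(nat \<Rightarrow> nat) \<times> (nat \<Rightarrow> 'a)"

text \<open>The description of \<open>PX\<close> by heaps. A term-element is stored together with its
  boundary \<open>(\<phi>, h)\<close>.\<close>

definition heapP :: "('a, 'b) presheaf \<Rightarrow> ('a ptype, 'a ptype \<times> 'b pterm) presheaf" where
  "heapP X =
     \<lparr> tyel = (\<lambda>n. {(\<phi>, h). \<phi> \<in> Hp n \<and> h \<in> heap_maps X n \<phi>}),
       tmel = (\<lambda>n. {((\<phi>, h), t). \<phi> \<in> Hp n \<and> h \<in> heap_maps X n \<phi> \<and>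
                t \<in> Old ` Tm X (dp \<phi> n) (h n) \<union>
                    Proj ` {i \<in> {1..n - 1}. \<phi> n = \<phi> i \<and> h n = h i}}),
       bdty = (\<lambda>n (\<phi>, h). (restrict \<phi> {0..n}, restrict h {1..n})),
       bdtm = (\<lambda>n. fst) \<rparr>"

definition heap_args :: "(nat \<Rightarrow> nat) \<Rightarrow> nat \<Rightarrow> 'w expr list" where
  "heap_args \<phi> i = map (\<lambda>l. Var ((\<phi> ^^ (dp \<phi> i - l)) i)) [1..<dp \<phi> i]"

definition heap_type :: "'a ptype \<Rightarrow> nat \<Rightarrow> (nat \<times> 'a + nat \<times> 'b) expr" where
  "heap_type = (\<lambda>(\<phi>, h) i. App (Inl (dp \<phi> i, h i)) (heap_args \<phi> i))"

definition heap_ctx :: "'a ptype \<Rightarrow> nat \<Rightarrow> (nat \<times> 'a + nat \<times> 'b) ctx" where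
  "heap_ctx p n = map (\<lambda>i. (i, heap_type p i)) [1..<n]"

text \<open>The identification of \<open>heapP X\<close> with \<open>monad R X\<close> (for the weakening monad it is only
  used on type-elements).\<close>

definition ident_ty :: "rule set \<Rightarrow> ('a, 'b) presheaf \<Rightarrow> nat \<Rightarrow> 'a ptype \<Rightarrow>
    (nat \<times> 'a + nat \<times> 'b) judgement set" where
  "ident_ty R X n p = jclass R (free X) (heap_ctx p n \<turnstile> Type (heap_type p n))"

fun ident_tm :: "rule set \<Rightarrow> ('a, 'b) presheaf \<Rightarrow> nat \<Rightarrow> 'a ptype \<times> 'b pterm \<Rightarrow>
    (nat \<times> 'a + nat \<times> 'b) judgement set" where
  "ident_tm R X n (p, Old a) =
     jclass R (free X)
       (heap_ctx p n \<turnstile> Term (App (Inr (dp (fst p) n, a)) (heap_args (fst p) n)) (heap_type p n))"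
| "ident_tm R X n (p, Proj i) =
     jclass R (free X) (heap_ctx p n \<turnstile> Term (Var i) (heap_type p i))"

text \<open>The identification of \<open>heapP (heapP X)\<close> with \<open>monad R (monad R X)\<close>: apply the
  identification for \<open>X\<close> to all entries, then the one for \<open>monad R X\<close>.\<close>

definition ident_entries ::
    "rule set \<Rightarrow> ('a, 'b) presheaf \<Rightarrow> nat \<Rightarrow> 'a ptype ptype \<Rightarrow>
     (nat \<times> 'a + nat \<times> 'b) judgement set ptype" where
  "ident_entries R X n = (\<lambda>(\<psi>, g). (\<psi>, \<lambda>i\<in>{1..n}. ident_ty R X (dp \<psi> i) (g i)))"

definition ident2_ty :: "rule set \<Rightarrow> ('a, 'b) presheaf \<Rightarrow> nat \<Rightarrow> 'a ptype ptype \<Rightarrow>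
    (nat \<times> (nat \<times> 'a + nat \<times> 'b) judgement set +
     nat \<times> (nat \<times> 'a + nat \<times> 'b) judgement set) judgement set" where
  "ident2_ty R X n q = ident_ty R (monad R X) n (ident_entries R X n q)"

definition ident2_tm :: "rule set \<Rightarrow> ('a, 'b) presheaf \<Rightarrow> nat \<Rightarrow>
    'a ptype ptype \<times> ('a ptype \<times> 'b pterm) pterm \<Rightarrow>
    (nat \<times> (nat \<times> 'a + nat \<times> 'b) judgement set +
     nat \<times> (nat \<times> 'a + nat \<times> 'b) judgement set) judgement set" where
  "ident2_tm R X n = (\<lambda>(q, t). ident_tm R (monad R X) n
     (ident_entries R X n q, map_pterm (ident_tm R X (dp (fst q) n)) t))"

text \<open>For \<open>(\<psi>, g)\<close> with \<open>g i = (\<phi>\<^sub>i, h\<^sub>i)\<close>, the heap \<open>\<psi> \<star> \<phi>\<close> and the map \<open>\<psi> \<star> h\<close>.\<close>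

definition star_heap :: "nat \<Rightarrow> (nat \<Rightarrow> nat) \<Rightarrow> (nat \<Rightarrow> 'a ptype) \<Rightarrow> nat \<Rightarrow> nat" where
  "star_heap n \<psi> g =
     (\<lambda>i\<in>{0..n}. if i = 0 then 0 else (\<psi> ^^ (dp \<psi> i - fst (g i) (dp \<psi> i))) i)"

definition star_map :: "nat \<Rightarrow> (nat \<Rightarrow> nat) \<Rightarrow> (nat \<Rightarrow> 'a ptype) \<Rightarrow> nat \<Rightarrow> 'a" where
  "star_map n \<psi> g = (\<lambda>i\<in>{1..n}. snd (g i) (dp \<psi> i))"

definition star :: "nat \<Rightarrow> 'a ptype ptype \<Rightarrow> 'a ptype" where
  "star n = (\<lambda>(\<psi>, g). (star_heap n \<psi> g, star_map n \<psi> g))"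

text \<open>The claimed multiplication on term-elements. The projections \<open>\<pi>\<^sub>i(\<psi>,(\<phi>,h))\<close> are the \<open>Proj i\<close>,
  and the projections \<open>\<pi>\<^sub>i(\<phi>\<^sub>n,h\<^sub>n)\<close> are the \<open>Old (g n, Proj i)\<close>.\<close>

fun star_term :: "nat \<Rightarrow> (nat \<Rightarrow> nat) \<Rightarrow> ('a ptype \<times> 'b pterm) pterm \<Rightarrow> 'b pterm" where
  "star_term n \<psi> (Old (_, Old a)) = Old a"
| "star_term n \<psi> (Proj i) = Proj i"
| "star_term n \<psi> (Old (_, Proj i)) = Proj ((\<psi> ^^ (dp \<psi> n - i)) n)"

end

theory Submission
  imports Defs
begin

text \<open>The multiplication is \<open>V \<epsilon>\<close>, and the point of the proof is that the counit \<open>\<epsilon>\<close> of a free theory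
  can be written down: it unfolds definitions. A constant of \<open>G V G X\<close> is a class of derived
  judgements of \<open>G X\<close>, and \<open>\<epsilon>\<close> replaces the constant, applied to variables \<open>x\<^sub>1, \<dots>, x\<^sub>k\<close>, by the
  type or term that a representative judgement in the variables \<open>1, \<dots>, k\<close> asserts, with \<open>x\<^sub>i\<close> put
  for \<open>i\<close>. Here this is the function \<open>translate\<close>.

  Three facts make this work. A free theory has no equality axioms, so \<open>derived_iff_wf\<close> describes
  its derived judgements explicitly: every type is a constant applied to a list of variables,
  which must be declared with the successive boundaries of that constant as their types, and
  every derivable equation has equal sides. Hence \<open>\<equiv>\<close> is renaming of variables (\<open>jrel_free\<close>), and a
  class has a canonical representative, its normal form, in which the variables are numbered by
  their positions. Finally, the translation acts on each expression of a judgement separately, so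
  it commutes with boundaries and with all rules on the nose; that it maps derived judgements to
  derived ones need only be checked on basic judgements, and \<open>translate\<close> sends the basic judgement
  of a class to the normal form of that class (\<open>translate_basic_type\<close>, \<open>translate_basic_term\<close>).

  The counit is also determined by its values on basic judgements. Since the set of variables is
  infinite and interpretations commute with permutations, an interpretation cannot introduce
  variables (\<open>fv_judgement_interp\<close>). Together with the preservation of boundaries this shows that it
  preserves the kind of a judgement and that a representative of the counit keeps the variables of a basic judgement in
  their places; an induction on derivations then shows that such a representative equals
  \<open>translate\<close> on every type and term judgement (\<open>eq_translate\<close>). So the multiplication
  is \<open>[J] \<mapsto> [translate J]\<close> (\<open>mult_jclass\<close>).

  It remains to compute the translation of the judgement of \<open>(\<psi>, (\<phi>, h))\<close>. In terms of the ancestor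
  of \<open>i\<close> at depth \<open>l\<close>, written \<open>anc \<psi> i l\<close>, the \<open>i\<close>-th type is \<open>[(\<phi>\<^sub>i, h\<^sub>i)]\<close> applied to
  \<open>anc \<psi> i 1, anc \<psi> i 2, \<dots>\<close>, and unfolding renames \<open>l\<close> to \<open>anc \<psi> i l\<close> in the judgement of
  \<open>(\<phi>\<^sub>i, h\<^sub>i)\<close>. The result is the judgement of \<open>(\<psi> \<star> \<phi>, \<psi> \<star> h)\<close> because ancestors compose:
  \<open>anc (\<psi> \<star> \<phi>) i l = anc \<psi> i (anc \<phi>\<^sub>i #i l)\<close> (\<open>anc_star\<close>). The three cases for terms are the three
  ways in which a term is unfolded: a term constant stays a constant, an outer variable \<open>x\<^sub>i\<close> is
  left alone, and an inner variable \<open>x\<^sub>i\<close> is renamed to \<open>anc \<psi> n i = \<psi>\<^bsup>#n-i\<^esup>(n)\<close>.\<close>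

section \<open>Renaming of variables\<close>

definition fv_judgement :: "'w judgement \<Rightarrow> var set" where
  "fv_judgement J = fv_ctx (jctx J) \<union> (\<Union>e\<in>set_rhs (jrhs J). fv e)"

definition closed :: "'w judgement \<Rightarrow> bool" where
  "closed J \<longleftrightarrow> distinct (vars (jctx J)) \<and> fv_judgement J \<subseteq> set (vars (jctx J))"

lemma permute_expr_simps [simp]:
  "permute_expr f (Var x) = Var (f x)"
  "permute_expr f (App w es) = App w (map (permute_expr f) es)"
  by (simp_all add: permute_expr_def)

lemma permute_expr_cong: "(\<And>x. x \<in> fv e \<Longrightarrow> f x = g x) \<Longrightarrow> permute_expr f e = permute_expr g e"
  by (induction e) auto

lemma permute_expr_comp: "permute_expr f (permute_expr g e) = permute_expr (f \<circ> g) e"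
  by (induction e) auto

lemma permute_expr_id: "(\<And>x. x \<in> fv e \<Longrightarrow> f x = x) \<Longrightarrow> permute_expr f e = e"
  by (induction e) (auto intro!: map_idI)

lemma fv_permute_expr [simp]: "fv (permute_expr f e) = f ` fv e"
  by (induction e) auto

lemma subst_cong: "(\<And>x. x \<in> fv e \<Longrightarrow> s x = s' x) \<Longrightarrow> subst s e = subst s' e"
  by (induction e) auto

lemma jctx_permute [simp]: "jctx (permute f J) = map (map_prod f (permute_expr f)) (jctx J)"
  and jrhs_permute [simp]: "jrhs (permute f J) = map_rhs (permute_expr f) (jrhs J)"
  by (simp_all add: permute_def)

lemma vars_simps [simp]:
  "vars [] = []" "vars (p # \<Gamma>) = fst p # vars \<Gamma>" "vars (\<Gamma> @ \<Delta>) = vars \<Gamma> @ vars \<Delta>"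
  "length (vars \<Gamma>) = length \<Gamma>" "vars (map (map_prod f h) \<Gamma>) = map f (vars \<Gamma>)"
  by (simp_all add: vars_def)

lemma vars_take: "vars (take i \<Gamma>) = take i (vars \<Gamma>)"
  by (simp add: vars_def take_map)

lemma vars_subset_fv_judgement: "set (vars (jctx J)) \<subseteq> fv_judgement J"
  by (auto simp: fv_judgement_def fv_ctx_def)

lemma fv_judgement_eq:
  "fv_judgement J = (\<Union>p\<in>set (jctx J). insert (fst p) (fv (snd p))) \<union> (\<Union>e\<in>set_rhs (jrhs J). fv e)"
  by (auto simp: fv_judgement_def fv_ctx_def vars_def)

lemma permute_cong:
  assumes "\<And>x. x \<in> fv_judgement J \<Longrightarrow> f x = g x"
  shows "permute f J = permute g J"
proof -
  have "map_prod f (permute_expr f) p = map_prod g (permute_expr g) p" if "p \<in> set (jctx J)" for p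
  proof -
    have "f (fst p) = g (fst p)" "\<And>x. x \<in> fv (snd p) \<Longrightarrow> f x = g x"
      using that assms unfolding fv_judgement_eq by blast+
    then show ?thesis by (cases p) (auto intro: permute_expr_cong)
  qed
  moreover have "map_rhs (permute_expr f) (jrhs J) = map_rhs (permute_expr g) (jrhs J)"
    using assms by (intro rhs.map_cong refl permute_expr_cong) (auto simp: fv_judgement_eq)
  ultimately show ?thesis by (simp add: permute_def)
qed

lemma permute_comp: "permute f (permute g J) = permute (f \<circ> g) J"
proof -
  have "permute_expr f \<circ> permute_expr g = (permute_expr (f \<circ> g) :: 'a expr \<Rightarrow> _)"
    by (intro ext) (simp add: permute_expr_comp)
  then show ?thesis by (simp add: permute_def rhs.map_comp map_prod.comp)
qed

lemma permute_id:
  assumes "\<And>x. x \<in> fv_judgement J \<Longrightarrow> f x = x"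
  shows "permute f J = J"
proof -
  have "permute f J = permute id J" using assms by (intro permute_cong) simp
  also have "permute_expr id = (id :: 'a expr \<Rightarrow> _)" by (intro ext) (simp add: permute_expr_id)
  then have "permute id J = J"
    by (cases J) (simp add: permute_def prod.map_id0 rhs.map_id0)
  finally show ?thesis .
qed

lemma fv_judgement_permute [simp]: "fv_judgement (permute f J) = f ` fv_judgement J"
  by (simp add: fv_judgement_eq rhs.set_map image_Un image_UN)

lemma finite_fv [simp]: "finite (fv e)"
  by (induction e) auto

lemma finite_fv_judgement [simp]: "finite (fv_judgement J)"
  by (cases "jrhs J") (auto simp: fv_judgement_eq)

lemma closed_permute: "closed J \<Longrightarrow> inj_on f (set (vars (jctx J))) \<Longrightarrow> closed (permute f J)"
  by (auto simp: closed_def distinct_map)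

text \<open>Only permutations of all variables act on judgements, but the action on one judgement
  depends on finitely many values.\<close>

lemma finite_inj_extends_to_bij:
  fixes f :: "nat \<Rightarrow> nat"
  assumes "finite A" "inj_on f A"
  obtains \<sigma> where "bij \<sigma>" "\<And>x. x \<in> A \<Longrightarrow> \<sigma> x = f x"
proof -
  define B where "B = A \<union> f ` A"
  have fin: "finite B" using assms by (simp add: B_def)
  have "card (B - A) = card (B - f ` A)"
    using assms by (simp add: B_def card_Diff_subset card_image)
  then obtain h where h: "bij_betw h (B - A) (B - f ` A)"
    using fin finite_same_card_bij[of "B - A" "B - f ` A"] by auto
  have f: "bij_betw f A (f ` A)" using assms by (simp add: inj_on_imp_bij_betw)
  define k where "k x = (if x \<in> A then f x else h x)" for x
  have "bij_betw k (A \<union> (B - A)) (f ` A \<union> (B - f ` A))"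
    unfolding k_def using f h by (intro bij_betw_disjoint_Un) auto
  then have k: "bij_betw k B B" by (simp add: B_def Un_absorb1)
  define \<sigma> where "\<sigma> x = (if x \<in> B then k x else id x)" for x
  have "bij_betw \<sigma> (B \<union> - B) (B \<union> - B)"
    unfolding \<sigma>_def using k by (intro bij_betw_disjoint_Un bij_betw_id) auto
  then have "bij \<sigma>" by simp
  moreover have "\<sigma> x = f x" if "x \<in> A" for x using that by (simp add: \<sigma>_def k_def B_def)
  ultimately show ?thesis using that by blast
qed


section \<open>Normal forms of judgements\<close>

text \<open>Positions are counted from 1, so that the normal form of a judgement of degree \<open>n\<close> has the context
  variables \<open>1, \<dots>, n-1\<close> that the basic judgements of a free theory use.\<close>

definition pos :: "var list \<Rightarrow> var \<Rightarrow> nat" where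
  "pos xs x = Suc (length (takeWhile (\<lambda>y. y \<noteq> x) xs))"

definition normal_form :: "'w judgement \<Rightarrow> 'w judgement" where
  "normal_form J = permute (pos (vars (jctx J))) J"

lemma pos_nth: "distinct xs \<Longrightarrow> i < length xs \<Longrightarrow> pos xs (xs ! i) = Suc i"
proof (induction xs arbitrary: i)
  case (Cons x xs)
  then show ?case by (cases i) (auto simp: pos_def)
qed simp

lemma pos_append: "x \<in> set xs \<Longrightarrow> pos (xs @ ys) x = pos xs x"
  by (simp add: pos_def)

lemma nth_pos: "x \<in> set xs \<Longrightarrow> xs ! (pos xs x - Suc 0) = x"
  by (induction xs) (auto simp: pos_def)

lemma pos_le: "x \<in> set xs \<Longrightarrow> pos xs x \<le> length xs"
  by (induction xs) (auto simp: pos_def)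

lemma pos_ge_1 [simp]: "Suc 0 \<le> pos xs x" "pos xs x > 0"
  by (simp_all add: pos_def)

lemma inj_on_pos: "inj_on (pos xs) (set xs)"
  by (rule inj_on_inverseI[of _ "\<lambda>i. xs ! (i - 1)"]) (simp add: nth_pos)

lemma pos_map: "inj_on f (set xs) \<Longrightarrow> x \<in> set xs \<Longrightarrow> pos (map f xs) (f x) = pos xs x"
  by (induction xs) (auto simp: pos_def)

lemma map_pos: "distinct xs \<Longrightarrow> map (pos xs) xs = [1..<Suc (length xs)]"
  by (intro nth_equalityI) (simp_all add: pos_nth del: upt_Suc)

lemma jctx_normal_form: "jctx (normal_form J) = map (map_prod (pos (vars (jctx J))) (permute_expr (pos (vars (jctx J))))) (jctx J)"
  and jrhs_normal_form: "jrhs (normal_form J) = map_rhs (permute_expr (pos (vars (jctx J)))) (jrhs J)"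
  by (simp_all add: normal_form_def)

lemma vars_normal_form: "closed J \<Longrightarrow> vars (jctx (normal_form J)) = [1..<Suc (length (jctx J))]"
  by (simp add: jctx_normal_form closed_def map_pos del: upt_Suc)

lemma length_normal_form [simp]: "length (jctx (normal_form J)) = length (jctx J)"
  by (simp add: jctx_normal_form)

lemma normal_form_permute:
  assumes "closed J" "inj_on f (set (vars (jctx J)))"
  shows "normal_form (permute f J) = normal_form J"
  unfolding normal_form_def permute_comp
  using assms by (intro permute_cong) (auto simp: closed_def pos_map)

text \<open>Putting the context variables back for their positions; two judgements with the same normal form
  therefore differ by a renaming.\<close>

lemma from_normal_form:
  assumes "closed J"
  shows "permute (\<lambda>i. vars (jctx J) ! (i - 1)) (normal_form J) = J"
  unfolding normal_form_def permute_comp using assms by (intro permute_id) (auto simp: closed_def nth_pos)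

lemma normal_form_inj:
  assumes "closed J" "closed K" "normal_form J = normal_form K" "vars (jctx J) = vars (jctx K)"
  shows "J = K"
  using from_normal_form[of J] from_normal_form[of K] assms by simp

lemma closed_normal_form: "closed J \<Longrightarrow> closed (normal_form J)"
  unfolding normal_form_def by (intro closed_permute inj_on_pos) auto

lemma normal_form_id:
  assumes "closed J" "vars (jctx J) = [1..<Suc (length (jctx J))]"
  shows "normal_form J = J"
proof (rule normal_form_inj)
  show "closed (normal_form J)" "closed J" using assms by (simp_all add: closed_normal_form)
  show "normal_form (normal_form J) = normal_form J"
    using normal_form_permute[OF assms(1) inj_on_pos] by (simp only: normal_form_def)
  show "vars (jctx (normal_form J)) = vars (jctx J)" using assms by (simp add: vars_normal_form)
qed

text \<open>The substitution in the definition of \<open>\<equiv>\<close> only replaces variables by variables, so it is a renaming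
  by position.\<close>

lemma replace_eq_permute:
  assumes "length xs = length ys" "fv e \<subseteq> set ys"
  shows "replace ys xs e = permute_expr (\<lambda>v. xs ! (pos ys v - 1)) e"
proof -
  have *: "map_of (zip ys xs) v = Some (xs ! (pos ys v - 1))" if "v \<in> set ys" for v
    using assms(1) that
  proof (induction ys arbitrary: xs)
    case (Cons y ys)
    then obtain x xs' where "xs = x # xs'" by (cases xs) auto
    then show ?case using Cons by (auto simp: pos_def)
  qed simp
  show ?thesis
    unfolding replace_def permute_expr_def using assms(2) by (intro subst_cong) (auto simp: *)
qed

section \<open>The derived judgements of a free theory\<close>

text \<open>The condition under which a constant \<open>A\<close> of degree \<open>k\<close> may be applied to the variables \<open>ys\<close>. The
  \<open>i\<close>-th argument has the boundary of \<open>A\<close> in degree \<open>i\<close> as its type, applied to the earlier arguments;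
  as no equation identifies different types, the declaration must literally occur in the context.\<close>

definition spine :: "('a, 'b) presheaf \<Rightarrow> (nat \<times> 'a + nat \<times> 'b) ctx \<Rightarrow> nat \<Rightarrow> 'a \<Rightarrow> var list \<Rightarrow> bool" where
  "spine X \<Gamma> k A ys \<longleftrightarrow> k \<ge> 1 \<and> A \<in> tyel X k \<and> length ys = k - 1 \<and>
     (\<forall>i<k - 1. (ys ! i, App (Inl (Suc i, bdpow X (Suc i) (k - Suc i) A)) (map Var (take i ys))) \<in> set \<Gamma>)"

inductive wf_type :: "('a, 'b) presheaf \<Rightarrow> (nat \<times> 'a + nat \<times> 'b) ctx \<Rightarrow> (nat \<times> 'a + nat \<times> 'b) expr \<Rightarrow> bool"
  for X \<Gamma> where
  const: "spine X \<Gamma> k A ys \<Longrightarrow> wf_type X \<Gamma> (App (Inl (k, A)) (map Var ys))"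

text \<open>A variable is a term only by projection; this guard is the one place where the two sets of rules
  differ.\<close>

inductive wf_term :: "rule set \<Rightarrow> ('a, 'b) presheaf \<Rightarrow> (nat \<times> 'a + nat \<times> 'b) ctx \<Rightarrow>
    (nat \<times> 'a + nat \<times> 'b) expr \<Rightarrow> (nat \<times> 'a + nat \<times> 'b) expr \<Rightarrow> bool"
  for R X \<Gamma> where
  const: "a \<in> tmel X k \<Longrightarrow> spine X \<Gamma> k (bdtm X k a) ys \<Longrightarrow>
     wf_term R X \<Gamma> (App (Inr (k, a)) (map Var ys)) (App (Inl (k, bdtm X k a)) (map Var ys))"
| var: "range Project \<subseteq> R \<Longrightarrow> (x, T) \<in> set \<Gamma> \<Longrightarrow> wf_term R X \<Gamma> (Var x) T"

definition wf_ctx :: "('a, 'b) presheaf \<Rightarrow> (nat \<times> 'a + nat \<times> 'b) ctx \<Rightarrow> bool" where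
  "wf_ctx X \<Gamma> \<longleftrightarrow> distinct (vars \<Gamma>) \<and> (\<forall>i<length \<Gamma>. wf_type X (take i \<Gamma>) (snd (\<Gamma> ! i)))"

text \<open>With no equality axioms, only reflexivity can produce an equation.\<close>

fun wf_rhs :: "rule set \<Rightarrow> ('a, 'b) presheaf \<Rightarrow> (nat \<times> 'a + nat \<times> 'b) ctx \<Rightarrow>
    (nat \<times> 'a + nat \<times> 'b) expr rhs \<Rightarrow> bool" where
  "wf_rhs R X \<Gamma> (Type T) \<longleftrightarrow> wf_type X \<Gamma> T"
| "wf_rhs R X \<Gamma> (Term t T) \<longleftrightarrow> wf_term R X \<Gamma> t T"
| "wf_rhs R X \<Gamma> (TypeEq T T') \<longleftrightarrow> T = T' \<and> wf_type X \<Gamma> T"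
| "wf_rhs R X \<Gamma> (TermEq t t' T) \<longleftrightarrow> t = t' \<and> wf_term R X \<Gamma> t T"

definition wf :: "rule set \<Rightarrow> ('a, 'b) presheaf \<Rightarrow> (nat \<times> 'a + nat \<times> 'b) judgement \<Rightarrow> bool" where
  "wf R X J \<longleftrightarrow> wf_ctx X (jctx J) \<and> wf_rhs R X (jctx J) (jrhs J)"

lemma wf_ctx_Nil [simp]: "wf_ctx X []"
  by (simp add: wf_ctx_def)

lemma wf_ctx_snoc:
  "wf_ctx X (\<Gamma> @ [(y, T)]) \<longleftrightarrow> wf_ctx X \<Gamma> \<and> y \<notin> set (vars \<Gamma>) \<and> wf_type X \<Gamma> T"
  by (auto simp: wf_ctx_def nth_append less_Suc_eq)

lemma spine_mono: "spine X \<Gamma> k A ys \<Longrightarrow> set \<Gamma> \<subseteq> set \<Delta> \<Longrightarrow> spine X \<Delta> k A ys"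
  by (auto simp: spine_def)

lemma wf_type_mono: "wf_type X \<Gamma> T \<Longrightarrow> set \<Gamma> \<subseteq> set \<Delta> \<Longrightarrow> wf_type X \<Delta> T"
  by (auto elim!: wf_type.cases intro!: wf_type.const intro: spine_mono)

lemma wf_term_mono: "wf_term R X \<Gamma> t T \<Longrightarrow> set \<Gamma> \<subseteq> set \<Delta> \<Longrightarrow> wf_term R X \<Delta> t T"
  by (auto elim!: wf_term.cases intro!: wf_term.intros intro: spine_mono)

lemma wf_rhs_mono: "wf_rhs R X \<Gamma> r \<Longrightarrow> set \<Gamma> \<subseteq> set \<Delta> \<Longrightarrow> wf_rhs R X \<Delta> r"
  by (cases r) (auto intro: wf_type_mono wf_term_mono)

lemma wf_ctx_take: "wf_ctx X \<Gamma> \<Longrightarrow> wf_ctx X (take i \<Gamma>)"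
  by (auto simp: wf_ctx_def vars_take min_def)

lemma wf_type_entry:
  assumes "wf_ctx X \<Gamma>" "(x, T) \<in> set \<Gamma>"
  shows "wf_type X \<Gamma> T"
proof -
  obtain i where "i < length \<Gamma>" "\<Gamma> ! i = (x, T)" using assms(2) by (auto simp: in_set_conv_nth)
  then have "wf_type X (take i \<Gamma>) T" using assms(1) by (force simp: wf_ctx_def)
  then show ?thesis by (rule wf_type_mono) (rule set_take_subset)
qed

lemma wf_term_wf_type: "wf_ctx X \<Gamma> \<Longrightarrow> wf_term R X \<Gamma> t T \<Longrightarrow> wf_type X \<Gamma> T"
  by (auto elim!: wf_term.cases intro: wf_type.const wf_type_entry)

lemma spine_vars: "spine X \<Gamma> k A ys \<Longrightarrow> set ys \<subseteq> set (vars \<Gamma>)"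
  by (force simp: spine_def in_set_conv_nth vars_def)

lemma wf_type_fv: "wf_type X \<Gamma> T \<Longrightarrow> fv T \<subseteq> set (vars \<Gamma>)"
  by (auto elim!: wf_type.cases dest!: spine_vars)

lemma wf_term_fv: "wf_term R X \<Gamma> t T \<Longrightarrow> fv t \<subseteq> set (vars \<Gamma>)"
  by (auto elim!: wf_term.cases dest!: spine_vars) (force simp: vars_def)

lemma wf_closed:
  assumes "wf R X J"
  shows "closed J"
proof -
  have c: "wf_ctx X (jctx J)" and r: "wf_rhs R X (jctx J) (jrhs J)" using assms by (auto simp: wf_def)
  have "fv (snd p) \<subseteq> set (vars (jctx J))" if "p \<in> set (jctx J)" for p
    using wf_type_fv[OF wf_type_entry[OF c, of "fst p" "snd p"]] that by simp
  moreover have "fv e \<subseteq> set (vars (jctx J))" if "e \<in> set_rhs (jrhs J)" for e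
  proof -
    have "fv T \<subseteq> set (vars (jctx J))" if "wf_type X (jctx J) T" for T
      using that by (rule wf_type_fv)
    moreover have "fv t \<union> fv T \<subseteq> set (vars (jctx J))" if "wf_term R X (jctx J) t T" for t T
      using wf_term_fv[OF that] wf_type_fv[OF wf_term_wf_type[OF c that]] by simp
    ultimately show ?thesis
      using \<open>e \<in> set_rhs (jrhs J)\<close> r by (cases "jrhs J") (fastforce simp del: subset_iff)+
  qed
  moreover have "fst p \<in> set (vars (jctx J))" if "p \<in> set (jctx J)" for p
    using that by (simp add: vars_def)
  moreover have "distinct (vars (jctx J))" using c by (simp add: wf_ctx_def)
  ultimately show ?thesis by (simp add: closed_def fv_judgement_eq UN_subset_iff)
qed

lemma spine_permute:
  assumes "spine X \<Gamma> k A ys"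
  shows "spine X (map (map_prod f (permute_expr f)) \<Gamma>) k A (map f ys)"
  using assms by (force simp: spine_def take_map comp_def image_iff)

lemma wf_type_permute:
  "wf_type X \<Gamma> T \<Longrightarrow> wf_type X (map (map_prod f (permute_expr f)) \<Gamma>) (permute_expr f T)"
proof (induction rule: wf_type.induct)
  case (const k A ys)
  then show ?case using wf_type.const[OF spine_permute[OF const]] by (simp add: comp_def)
qed

lemma wf_term_permute:
  "wf_term R X \<Gamma> t T \<Longrightarrow>
    wf_term R X (map (map_prod f (permute_expr f)) \<Gamma>) (permute_expr f t) (permute_expr f T)"
proof (induction rule: wf_term.induct)
  case (const a k ys)
  then show ?case using wf_term.const[OF const(1) spine_permute[OF const(2)]] by (simp add: comp_def)
next
  case (var x T)
  then show ?case by (force intro!: wf_term.var)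
qed

lemma wf_permute:
  assumes "wf R X J" "inj_on f (set (vars (jctx J)))"
  shows "wf R X (permute f J)"
proof -
  have "wf_ctx X (jctx (permute f J))"
    using assms by (auto simp: wf_def wf_ctx_def distinct_map take_map intro!: wf_type_permute)
  moreover have "wf_rhs R X (jctx (permute f J)) (jrhs (permute f J))"
    using assms by (cases "jrhs J") (auto simp: wf_def intro!: wf_type_permute wf_term_permute)
  ultimately show ?thesis by (simp add: wf_def)
qed

text \<open>This is the weakening rule: declarations only ever refer to earlier ones, and a longer context
  still contains them.\<close>

lemma wf_ctx_insert:
  assumes "wf_ctx X (\<Gamma> @ \<Delta>)" "wf_type X \<Gamma> T" "y \<notin> set (vars (\<Gamma> @ \<Delta>))"
  shows "wf_ctx X (\<Gamma> @ (y, T) # \<Delta>)"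
  using assms(1,3)
proof (induction \<Delta> rule: rev_induct)
  case Nil
  then show ?case using assms(2) by (simp add: wf_ctx_snoc)
next
  case (snoc p \<Delta>)
  obtain x S where p: "p = (x, S)" by (cases p)
  have "wf_ctx X ((\<Gamma> @ \<Delta>) @ [(x, S)])" using snoc.prems p by simp
  then have *: "wf_ctx X (\<Gamma> @ \<Delta>)" "x \<notin> set (vars (\<Gamma> @ \<Delta>))" "wf_type X (\<Gamma> @ \<Delta>) S"
    unfolding wf_ctx_snoc by simp_all
  have "wf_ctx X ((\<Gamma> @ (y, T) # \<Delta>) @ [(x, S)])"
    unfolding wf_ctx_snoc using * snoc p by (auto elim: wf_type_mono)
  then show ?case using p by simp
qed

lemma bdpow_bdty: "i < k \<Longrightarrow> bdpow X i (k - i) A = bdpow X i (k - 1 - i) (bdty X (k - 1) A)"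
proof -
  assume "i < k"
  then have "k - i = Suc (k - 1 - i)" "i + (k - 1 - i) = k - 1" by simp_all
  then show ?thesis by (metis bdpow.simps(2))
qed

lemma vars_basic_ctx [simp]: "vars (basic_ctx X n A) = [1..<n]"
  by (simp add: vars_def basic_ctx_def comp_def)

lemma basic_ctx_Suc:
  assumes "n \<ge> 1"
  shows "basic_ctx X (Suc n) A =
    basic_ctx X n (bdty X n A) @ [(n, App (Inl (n, bdty X n A)) (map Var [1..<n]))]"
  using assms by (auto simp: basic_ctx_def bdpow_bdty[of _ "Suc n"])

lemma wf_basic_ctx:
  assumes "is_presheaf X" "n \<ge> 1" "A \<in> tyel X n"
  shows "wf_ctx X (basic_ctx X n A) \<and> spine X (basic_ctx X n A) n A [1..<n]"
  using assms(2,3)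
proof (induction n arbitrary: A)
  case (Suc n)
  have sp: "spine X (basic_ctx X (Suc n) A) (Suc n) A [1..<Suc n]"
    using Suc.prems by (auto simp: spine_def basic_ctx_def image_iff take_upt simp del: upt_Suc)
  show ?case
  proof (cases "n = 0")
    case True
    then show ?thesis using sp by (simp add: basic_ctx_def)
  next
    case False
    then have "bdty X n A \<in> tyel X n"
      using Suc.prems assms(1) by (auto simp: is_presheaf_def Pi_def)
    then have "wf_ctx X (basic_ctx X n (bdty X n A))"
        "spine X (basic_ctx X n (bdty X n A)) n (bdty X n A) [1..<n]"
      using Suc.IH False by auto
    then have "wf_ctx X (basic_ctx X (Suc n) A)"
      using False by (auto simp: basic_ctx_Suc wf_ctx_snoc intro!: wf_type.const)
    with sp show ?thesis by simp
  qed
qed simp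

lemma basics_free: "basics (free X) =
  {basic_type X n A |n A. n \<ge> 1 \<and> A \<in> tyel X n} \<union> {basic_term X n a |n a. n \<ge> 1 \<and> a \<in> tmel X n}"
  by (simp add: free_def)

lemma bdtm_in: "is_presheaf X \<Longrightarrow> n \<ge> 1 \<Longrightarrow> a \<in> tmel X n \<Longrightarrow> bdtm X n a \<in> tyel X n"
  by (auto simp: is_presheaf_def Pi_def)

lemma wf_basic_type: "is_presheaf X \<Longrightarrow> n \<ge> 1 \<Longrightarrow> A \<in> tyel X n \<Longrightarrow> wf R X (basic_type X n A)"
  using wf_basic_ctx[of X n A] by (auto simp: basic_type_def wf_def intro!: wf_type.const)

lemma wf_basic_term:
  assumes "is_presheaf X" "n \<ge> 1" "a \<in> tmel X n"
  shows "wf R X (basic_term X n a)"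
  using wf_basic_ctx[OF assms(1,2) bdtm_in[OF assms]] assms
  by (auto simp: basic_term_def wf_def intro!: wf_term.const)

text \<open>Each rule preserves well-formedness. Conversion does so because the types it exchanges are equal.\<close>

lemma derived_imp_wf:
  assumes X: "is_presheaf X" and R: "R = w_rules \<or> R = wp_rules" and J: "J \<in> derived R (free X)"
  shows "wf R X J"
  using J
proof (induction rule: derived.induct)
  case (basic J)
  then show ?case using wf_basic_type[OF X] wf_basic_term[OF X] by (auto simp: basics_free)
next
  case (rule r Js J)
  have wf: "\<forall>K\<in>set Js. wf R X K" using rule.IH by simp
  from rule(2) wf show ?case
  proof (cases rule: infers.cases)
    case (9 \<sigma> J')
    then show ?thesis using wf by (auto intro!: wf_permute intro: inj_on_subset[OF bij_is_inj])
  next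
    case (10 y \<Gamma> \<Delta> T r')
    have *: "wf_ctx X (\<Gamma> @ \<Delta>)" "wf_rhs R X (\<Gamma> @ \<Delta>) r'" "wf_type X \<Gamma> T"
      using wf 10 by (auto simp: wf_def)
    have "y \<notin> set (vars (\<Gamma> @ \<Delta>))" using 10 by (auto simp: fv_ctx_def)
    then have "wf_ctx X (\<Gamma> @ (y, T) # \<Delta>)" by (rule wf_ctx_insert[OF *(1,3)])
    moreover have "wf_rhs R X (\<Gamma> @ (y, T) # \<Delta>) r'" by (rule wf_rhs_mono[OF *(2)]) auto
    ultimately show ?thesis using 10 by (simp add: wf_def)
  next
    case (11 y \<Gamma> T)
    have *: "wf_ctx X \<Gamma>" "wf_type X \<Gamma> T" using wf 11 by (auto simp: wf_def)
    have "y \<notin> set (vars \<Gamma>)" using 11 by (auto simp: fv_ctx_def)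
    moreover have "range Project \<subseteq> R" using R rule(1) 11 by (auto simp: w_rules_def wp_rules_def)
    ultimately show ?thesis using 11 * by (auto simp: wf_def wf_ctx_snoc intro!: wf_term.var)
  qed (auto simp: wf_def intro: wf_term_wf_type)
qed

text \<open>The rule asks for a permutation of all variables, but a renaming that is injective on the variables
  of the judgement extends to one.\<close>

lemma derived_permute:
  assumes "J \<in> derived R T" "R = w_rules \<or> R = wp_rules" "inj_on f (fv_judgement J)"
  shows "permute f J \<in> derived R T"
proof -
  obtain \<sigma> where \<sigma>: "bij \<sigma>" "\<And>x. x \<in> fv_judgement J \<Longrightarrow> \<sigma> x = f x"
    using finite_inj_extends_to_bij[OF finite_fv_judgement assms(3)] by blast
  have "Perm \<sigma> \<in> R" using assms(2) by (auto simp: w_rules_def wp_rules_def)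
  then have "permute \<sigma> J \<in> derived R T"
    using assms(1) by (auto intro: derived.rule[OF _ infers.intros(9)[OF \<sigma>(1)]])
  then show ?thesis using permute_cong[of J \<sigma> f] \<sigma>(2) by simp
qed

lemma boundary_basic_type:
  "n \<ge> 1 \<Longrightarrow> boundary (basic_type X (Suc n) A) = [basic_type X n (bdty X n A)]"
  by (simp add: basic_type_def basic_ctx_Suc)

lemma boundary_basic_type_1: "boundary (basic_type X (Suc 0) A) = []"
  by (simp add: basic_type_def basic_ctx_def)

lemma boundary_basic_term: "boundary (basic_term X n a) = [basic_type X n (bdtm X n a)]"
  by (simp add: basic_term_def basic_type_def)

lemma basic_type_derived:
  assumes X: "is_presheaf X" and "n \<ge> 1" "A \<in> tyel X n"
  shows "basic_type X n A \<in> derived R (free X)"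
  using assms(2,3)
proof (induction n arbitrary: A rule: nat_induct_at_least)
  case base
  then have "basic_type X 1 A \<in> basics (free X)" by (auto simp: basics_free)
  then show ?case by (rule derived.basic) (simp add: boundary_basic_type_1)
next
  case (Suc n)
  then have "basic_type X (Suc n) A \<in> basics (free X)" by (auto simp: basics_free)
  moreover have "bdty X n A \<in> tyel X n"
    using X Suc by (auto simp: is_presheaf_def Pi_def)
  ultimately show ?case
    using Suc by (auto simp: boundary_basic_type intro: derived.basic)
qed

lemma basic_term_derived:
  assumes X: "is_presheaf X" and "n \<ge> 1" "a \<in> tmel X n"
  shows "basic_term X n a \<in> derived R (free X)"
proof (rule derived.basic)
  show "basic_term X n a \<in> basics (free X)" using assms by (auto simp: basics_free)
  show "K \<in> derived R (free X)" if "K \<in> set (boundary (basic_term X n a))" for K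
    using that basic_type_derived[OF X assms(2) bdtm_in[OF assms]] by (simp add: boundary_basic_term)
qed

lemma wf_ctx_fv: "wf_ctx X \<Gamma> \<Longrightarrow> fv_ctx \<Gamma> = set (vars \<Gamma>)"
  using wf_type_entry wf_type_fv by (fastforce simp: fv_ctx_def)

lemma derived_weaken:
  assumes "(\<Gamma> \<turnstile> Type T) \<in> derived R U" "(\<Gamma> @ \<Delta> \<turnstile> r) \<in> derived R U"
    "y \<notin> fv_ctx \<Gamma> \<union> fv_ctx \<Delta>" "R = w_rules \<or> R = wp_rules"
  shows "(\<Gamma> @ (y, T) # \<Delta> \<turnstile> r) \<in> derived R U"
proof -
  have "Weaken y \<in> R" using assms(4) by (auto simp: w_rules_def wp_rules_def)
  then show ?thesis
    using assms(1,2) by (intro derived.rule[OF _ infers.intros(10)[OF assms(3)]]) auto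
qed

text \<open>A judgement that mentions only variables in \<open>V\<close> can be derived in the part of its context that
  declares \<open>V\<close>, provided that this part is closed; the other declarations are then inserted by
  weakening, from left to right so that the type to be inserted is derivable in the final prefix.\<close>

lemma derived_from_filter:
  assumes R: "R = w_rules \<or> R = wp_rules" and \<Gamma>: "wf_ctx X \<Gamma>"
    and types: "\<And>\<Gamma>' y S \<Gamma>''. \<Gamma> = \<Gamma>' @ (y, S) # \<Gamma>'' \<Longrightarrow> (\<Gamma>' \<turnstile> Type S) \<in> derived R U"
    and V: "\<And>x T. (x, T) \<in> set \<Gamma> \<Longrightarrow> x \<in> V \<Longrightarrow> fv T \<subseteq> V"
    and J: "(filter (\<lambda>p. fst p \<in> V) \<Gamma> \<turnstile> r) \<in> derived R U"
  shows "(\<Gamma> \<turnstile> r) \<in> derived R U"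
proof -
  have "(\<Gamma>1 @ filter (\<lambda>p. fst p \<in> V) \<Gamma>2 \<turnstile> r) \<in> derived R U" if "\<Gamma> = \<Gamma>1 @ \<Gamma>2" for \<Gamma>1 \<Gamma>2
    using that
  proof (induction \<Gamma>1 arbitrary: \<Gamma>2 rule: rev_induct)
    case Nil
    then show ?case using J by simp
  next
    case (snoc p \<Gamma>1)
    obtain y S where p: "p = (y, S)" by (cases p)
    have IH: "(\<Gamma>1 @ filter (\<lambda>p. fst p \<in> V) ((y, S) # \<Gamma>2) \<turnstile> r) \<in> derived R U"
      using snoc.prems p by (intro snoc.IH) simp
    show ?case
    proof (cases "y \<in> V")
      case True
      then show ?thesis using IH p by simp
    next
      case False
      have "wf_ctx X \<Gamma>1" using wf_ctx_take[OF \<Gamma>, of "length \<Gamma>1"] snoc.prems by simp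
      then have "fv_ctx \<Gamma>1 = set (vars \<Gamma>1)" by (rule wf_ctx_fv)
      then have "y \<notin> fv_ctx \<Gamma>1" using \<Gamma> snoc.prems p by (simp add: wf_ctx_def)
      moreover have "y \<notin> fv_ctx (filter (\<lambda>p. fst p \<in> V) \<Gamma>2)"
        using False V snoc.prems by (fastforce simp: fv_ctx_def vars_def)
      ultimately have "(\<Gamma>1 @ (y, S) # filter (\<lambda>p. fst p \<in> V) \<Gamma>2 \<turnstile> r) \<in> derived R U"
        using IH types[of \<Gamma>1 y S \<Gamma>2] snoc.prems p False R by (intro derived_weaken) simp_all
      then show ?thesis using p by simp
    qed
  qed
  from this[of \<Gamma> "[]"] show ?thesis by simp
qed

text \<open>The arguments of a constant are declared in the order in which they are applied, and between them
  they cut out a copy of the context of the basic judgement. The induction removes the last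
  declaration of the context: if it is an argument at all, then it is the last one, since the type of
  the next argument would mention it before it is declared.\<close>

lemma filter_spine:
  fixes X :: "('a, 'b) presheaf"
  assumes X: "is_presheaf X" and "wf_ctx X \<Gamma>" "spine X \<Gamma> k A ys"
  shows "filter (\<lambda>p. fst p \<in> set ys) \<Gamma> =
    map (\<lambda>i. (ys ! i, App (Inl (Suc i, bdpow X (Suc i) (k - Suc i) A)) (map Var (take i ys)))) [0..<k - 1]"
  using assms(2,3)
proof (induction \<Gamma> arbitrary: k A ys rule: rev_induct)
  case Nil
  then have "\<not> 0 < k - 1" "length ys = k - 1" by (auto simp: spine_def)
  then show ?case by simp
next
  case (snoc p \<Gamma>)
  obtain z S where p: "p = (z, S)" by (cases p)
  let ?E = "\<lambda>i. App (Inl (Suc i, bdpow X (Suc i) (k - Suc i) A)) (map Var (take i ys)) :: (nat \<times> 'a + nat \<times> 'b) expr"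
  have \<Gamma>: "wf_ctx X \<Gamma>" "z \<notin> set (vars \<Gamma>)" "wf_type X \<Gamma> S"
    using snoc.prems p by (simp_all add: wf_ctx_snoc)
  have k: "k \<ge> 1" "A \<in> tyel X k" "length ys = k - 1"
    and E: "\<And>i. i < k - 1 \<Longrightarrow> (ys ! i, ?E i) \<in> set \<Gamma> \<or> (ys ! i, ?E i) = (z, S)"
    using snoc.prems p by (auto simp: spine_def)
  have E\<Gamma>: "(ys ! i, ?E i) \<in> set \<Gamma>" if "i < k - 1" "ys ! i \<noteq> z" for i
    using E that by blast
  show ?case
  proof (cases "z \<in> set ys")
    case False
    then have "spine X \<Gamma> k A ys"
      unfolding spine_def using k by (intro conjI allI impI E\<Gamma>) auto
    then show ?thesis using snoc.IH[OF \<Gamma>(1)] False p by simp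
  next
    case True
    \<comment> \<open>The next argument would have a type that mentions \<open>z\<close>, but no type in this context does.\<close>
    have last: "j = k - 2" if "j < k - 1" "ys ! j = z" for j
    proof (rule ccontr)
      assume "j \<noteq> k - 2"
      then have j: "j + 1 < k - 1" using that by simp
      have "z \<in> fv (?E (j + 1))"
        using that j k by (force simp: in_set_conv_nth)
      moreover have "fv (?E (j + 1)) \<subseteq> set (vars \<Gamma>)"
      proof (cases "(ys ! (j + 1), ?E (j + 1)) \<in> set \<Gamma>")
        case True
        then show ?thesis by (rule wf_type_fv[OF wf_type_entry[OF \<Gamma>(1)]])
      next
        case False
        then have "?E (j + 1) = S" using E[OF j] by blast
        then show ?thesis using wf_type_fv[OF \<Gamma>(3)] by (simp only:)
      qed
      ultimately show False using \<Gamma>(2) by blast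
    qed
    obtain j where j: "j < k - 1" "ys ! j = z" using True k by (auto simp: in_set_conv_nth)
    then have jk: "j = k - 2" "k \<ge> 2" using last by auto
    have zS: "(ys ! (k - 2), ?E (k - 2)) = (z, S)"
      using E[OF j(1)] j jk \<Gamma>(2) by (force simp: vars_def)
    define ys' where "ys' = butlast ys"
    have ys: "ys = ys' @ [z]"
    proof -
      have "ys \<noteq> []" using True by auto
      moreover from this have "last ys = z" using j jk k by (simp add: last_conv_nth numeral_2_eq_2)
      ultimately show ?thesis unfolding ys'_def by (metis append_butlast_last_id)
    qed
    have len: "length ys' = k - 2"
      using k(3) jk(2) unfolding ys by simp
    have ys'_nth: "ys' ! i = ys ! i" "take i ys' = take i ys" if "i < k - 2" for i
      using that len unfolding ys by (simp_all add: nth_append)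
    have "spine X \<Gamma> (k - 1) (bdty X (k - 1) A) ys'"
      unfolding spine_def
    proof (intro conjI allI impI)
      show "1 \<le> k - 1" "length ys' = k - 1 - 1" using jk len by simp_all
      show "bdty X (k - 1) A \<in> tyel X (k - 1)"
        using X k jk by (auto simp: is_presheaf_def Pi_def)
      fix i assume i: "i < k - 1 - 1"
      then have "(ys ! i, ?E i) \<in> set \<Gamma>" using last[of i] jk by (intro E\<Gamma>) linarith+
      then show "(ys' ! i, App (Inl (Suc i, bdpow X (Suc i) (k - 1 - Suc i) (bdty X (k - 1) A)))
          (map Var (take i ys'))) \<in> set \<Gamma>"
        using i ys'_nth[of i] bdpow_bdty[of "Suc i" k X A] by simp
    qed
    from snoc.IH[OF \<Gamma>(1) this]
    have "filter (\<lambda>p. fst p \<in> set ys') \<Gamma> = map (\<lambda>i. (ys ! i, ?E i)) [0..<k - 2]"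
      using ys'_nth bdpow_bdty[of "Suc _" k X A] by (auto simp: numeral_2_eq_2)
    moreover have "filter (\<lambda>p. fst p \<in> set ys) \<Gamma> = filter (\<lambda>p. fst p \<in> set ys') \<Gamma>"
      using \<Gamma>(2) ys by (intro filter_cong refl) (auto simp: vars_def)
    moreover have "[0..<k - 1] = [0..<k - 2] @ [k - 2]"
      using jk upt_Suc_append[of 0 "k - 2"] by (simp add: Suc_diff_Suc numeral_2_eq_2)
    ultimately show ?thesis using zS p True by simp
  qed
qed

lemma spine_distinct:
  assumes X: "is_presheaf X" and "wf_ctx X \<Gamma>" "spine X \<Gamma> k A ys"
  shows "distinct ys"
proof -
  have "vars (filter (\<lambda>p. fst p \<in> set ys) \<Gamma>) = ys"
    unfolding filter_spine[OF assms] using assms(3)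
    by (intro nth_equalityI) (simp_all add: vars_def spine_def)
  moreover have "distinct (vars (filter (\<lambda>p. fst p \<in> set ys) \<Gamma>))"
    using assms(2) by (simp add: wf_ctx_def vars_def distinct_map_filter)
  ultimately show ?thesis by simp
qed

lemma spine_eq_permute_basic_ctx:
  fixes X :: "('a, 'b) presheaf"
  assumes X: "is_presheaf X" and \<Gamma>: "wf_ctx X \<Gamma>" and sp: "spine X \<Gamma> k A ys"
  defines "f \<equiv> \<lambda>i. ys ! (i - 1)"
  shows "filter (\<lambda>p. fst p \<in> set ys) \<Gamma> = map (map_prod f (permute_expr f)) (basic_ctx X k A)"
    and "map (permute_expr f) (map Var [1..<k]) = (map Var ys :: (nat \<times> 'a + nat \<times> 'b) expr list)"
    and "inj_on f {1..<k}"
proof -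
  have len: "length ys = k - 1" using sp by (simp add: spine_def)
  have args: "map (permute_expr f) (map Var [1..<Suc i]) =
      (map Var (take i ys) :: (nat \<times> 'a + nat \<times> 'b) expr list)" if "i \<le> k - 1" for i
    using that len by (intro nth_equalityI) (simp_all add: f_def del: upt_Suc)
  have "k = Suc (k - 1)" using sp by (simp add: spine_def)
  then have upt: "[1..<k] = map Suc [0..<k - 1]" by (metis One_nat_def map_Suc_upt)
  show "filter (\<lambda>p. fst p \<in> set ys) \<Gamma> = map (map_prod f (permute_expr f)) (basic_ctx X k A)"
    unfolding filter_spine[OF X \<Gamma> sp] basic_ctx_def upt map_map
  proof (rule map_cong[OF refl])
    fix i assume "i \<in> set [0..<k - 1]"
    then have "i \<le> k - 1" by simp
    from args[OF this] show "(ys ! i, App (Inl (Suc i, bdpow X (Suc i) (k - Suc i) A)) (map Var (take i ys)) :: (nat \<times> 'a + nat \<times> 'b) expr) =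
        (map_prod f (permute_expr f) \<circ> ((\<lambda>i. (i, App (Inl (i, bdpow X i (k - i) A)) (map Var [1..<i]))) \<circ> Suc)) i"
      by (simp only: o_apply map_prod_simp permute_expr_simps)
        (simp add: f_def del: upt_Suc)
  qed
  show "map (permute_expr f) (map Var [1..<k]) = (map Var ys :: (nat \<times> 'a + nat \<times> 'b) expr list)"
    using args[of "k - 1"] \<open>k = Suc (k - 1)\<close> len by (simp del: upt_Suc)
  show "inj_on f {1..<k}"
    using spine_distinct[OF X \<Gamma> sp] len
    by (auto simp: inj_on_def f_def nth_eq_iff_index_eq)
qed

lemma fv_judgement_basic_type:
  assumes "is_presheaf X" "n \<ge> 1" "A \<in> tyel X n"
  shows "fv_judgement (basic_type X n A) = {1..<n}"
  using wf_closed[OF wf_basic_type[OF assms]] vars_subset_fv_judgement[of "basic_type X n A"]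
  by (auto simp: closed_def basic_type_def)

lemma fv_judgement_basic_term:
  assumes "is_presheaf X" "n \<ge> 1" "a \<in> tmel X n"
  shows "fv_judgement (basic_term X n a) = {1..<n}"
  using wf_closed[OF wf_basic_term[OF assms]] vars_subset_fv_judgement[of "basic_term X n a"]
  by (auto simp: closed_def basic_term_def)

text \<open>By the previous lemmas a well-formed type judgement is a weakening of a renamed basic judgement; the
  types used for weakening live in shorter contexts.\<close>

lemma wf_type_derived:
  assumes X: "is_presheaf X" and R: "R = w_rules \<or> R = wp_rules"
    and "wf_ctx X \<Gamma>" "wf_type X \<Gamma> T"
  shows "(\<Gamma> \<turnstile> Type T) \<in> derived R (free X)"
  using assms(3,4)
proof (induction "length \<Gamma>" arbitrary: \<Gamma> T rule: less_induct)
  case less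
  from less.prems(2) obtain k A ys where T: "T = App (Inl (k, A)) (map Var ys)"
    and sp: "spine X \<Gamma> k A ys" by (auto elim: wf_type.cases)
  note f = spine_eq_permute_basic_ctx[OF X less.prems(1) sp]
  have k: "k \<ge> 1" "A \<in> tyel X k" using sp by (auto simp: spine_def)
  show ?case
  proof (rule derived_from_filter[OF R less.prems(1)])
    show "(\<Gamma>' \<turnstile> Type S) \<in> derived R (free X)" if "\<Gamma> = \<Gamma>' @ (y, S) # \<Gamma>''" for \<Gamma>' y S \<Gamma>''
    proof (rule less.hyps)
      have "wf_ctx X (\<Gamma>' @ [(y, S)])"
        using wf_ctx_take[OF less.prems(1), of "Suc (length \<Gamma>')"] that by simp
      then show "wf_ctx X \<Gamma>'" "wf_type X \<Gamma>' S" by (simp_all add: wf_ctx_snoc)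
    qed (simp add: that)
    show "fv S \<subseteq> set ys" if "(x, S) \<in> set \<Gamma>" "x \<in> set ys" for x S
    proof -
      have "(x, S) \<in> set (filter (\<lambda>p. fst p \<in> set ys) \<Gamma>)" using that by simp
      then show ?thesis
        unfolding filter_spine[OF X less.prems(1) sp] by (auto dest: in_set_takeD)
    qed
    have "permute (\<lambda>i. ys ! (i - 1)) (basic_type X k A) \<in> derived R (free X)"
      using f(3) k by (intro derived_permute basic_type_derived X R) (simp_all add: fv_judgement_basic_type X)
    then show "(filter (\<lambda>p. fst p \<in> set ys) \<Gamma> \<turnstile> Type T) \<in> derived R (free X)"
      using f(1,2) T by (simp add: permute_def basic_type_def)
  qed
qed

lemma wf_ctx_entry_derived:
  assumes X: "is_presheaf X" and R: "R = w_rules \<or> R = wp_rules" and "wf_ctx X (\<Gamma>' @ (y, S) # \<Gamma>'')"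
  shows "(\<Gamma>' \<turnstile> Type S) \<in> derived R (free X)"
proof -
  have "wf_ctx X (\<Gamma>' @ [(y, S)])"
    using wf_ctx_take[OF assms(3), of "Suc (length \<Gamma>')"] by simp
  then show ?thesis by (intro wf_type_derived X R) (simp_all add: wf_ctx_snoc)
qed

text \<open>A term constant is treated like a type. A variable is projected at the moment when it is declared,
  and weakened by the later declarations.\<close>

lemma wf_term_derived:
  assumes X: "is_presheaf X" and R: "R = w_rules \<or> R = wp_rules"
    and \<Gamma>: "wf_ctx X \<Gamma>" and t: "wf_term R X \<Gamma> t T"
  shows "(\<Gamma> \<turnstile> Term t T) \<in> derived R (free X)"
  using t
proof cases
  case (const a k ys)
  note sp = const(4)
  note f = spine_eq_permute_basic_ctx[OF X \<Gamma> sp]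
  have k: "k \<ge> 1" using sp by (auto simp: spine_def)
  show ?thesis
  proof (rule derived_from_filter[OF R \<Gamma>])
    show "(\<Gamma>' \<turnstile> Type S) \<in> derived R (free X)" if "\<Gamma> = \<Gamma>' @ (y, S) # \<Gamma>''" for \<Gamma>' y S \<Gamma>''
      using wf_ctx_entry_derived[OF X R] \<Gamma> that by blast
    show "fv S \<subseteq> set ys" if "(x, S) \<in> set \<Gamma>" "x \<in> set ys" for x S
    proof -
      have "(x, S) \<in> set (filter (\<lambda>p. fst p \<in> set ys) \<Gamma>)" using that by simp
      then show ?thesis
        unfolding filter_spine[OF X \<Gamma> sp] by (auto dest: in_set_takeD)
    qed
    have "permute (\<lambda>i. ys ! (i - 1)) (basic_term X k a) \<in> derived R (free X)"
      using f(3) k const by (intro derived_permute basic_term_derived X R) (simp_all add: fv_judgement_basic_term X)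
    then show "(filter (\<lambda>p. fst p \<in> set ys) \<Gamma> \<turnstile> Term t T) \<in> derived R (free X)"
      using f(1,2) const by (simp add: permute_def basic_term_def)
  qed
next
  case (var x)
  from \<Gamma> var(3) show ?thesis
  proof (induction \<Gamma> rule: rev_induct)
    case (snoc p \<Gamma>)
    obtain z S where p: "p = (z, S)" by (cases p)
    have *: "wf_ctx X \<Gamma>" "z \<notin> set (vars \<Gamma>)" "wf_type X \<Gamma> S"
      using snoc.prems p by (simp_all add: wf_ctx_snoc)
    have S: "(\<Gamma> \<turnstile> Type S) \<in> derived R (free X)" by (rule wf_type_derived[OF X R *(1,3)])
    have z: "z \<notin> fv_ctx \<Gamma>" using * by (simp add: wf_ctx_fv)
    show ?case
    proof (cases "(x, T) = (z, S)")
      case True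
      have "Project z \<in> R" using var(2) by auto
      then have "(\<Gamma> @ [(z, S)] \<turnstile> Term (Var z) S) \<in> derived R (free X)"
        using S by (intro derived.rule[OF _ infers.intros(11)[OF z]]) auto
      then show ?thesis using True p var by simp
    next
      case False
      then have "(\<Gamma> \<turnstile> Term t T) \<in> derived R (free X)" using snoc * p by auto
      then have "(\<Gamma> @ (z, S) # [] \<turnstile> Term t T) \<in> derived R (free X)"
        using S z R by (intro derived_weaken) (auto simp: fv_ctx_def)
      then show ?thesis using p by simp
    qed
  qed simp
qed

theorem derived_iff_wf:
  assumes X: "is_presheaf X" and R: "R = w_rules \<or> R = wp_rules"
  shows "J \<in> derived R (free X) \<longleftrightarrow> wf R X J"
proof
  assume "wf R X J"
  then have \<Gamma>: "wf_ctx X (jctx J)" and r: "wf_rhs R X (jctx J) (jrhs J)" by (auto simp: wf_def)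
  have eq: "TmRefl \<in> R" "TyRefl \<in> R" using R by (auto simp: w_rules_def wp_rules_def)
  have J: "J = (jctx J \<turnstile> jrhs J)" by simp
  show "J \<in> derived R (free X)"
  proof (cases "jrhs J")
    case (Type T)
    then show ?thesis using wf_type_derived[OF X R \<Gamma>] r J by (metis wf_rhs.simps(1))
  next
    case (Term t T)
    then show ?thesis using wf_term_derived[OF X R \<Gamma>] r J by (metis wf_rhs.simps(2))
  next
    case (TypeEq T T')
    then have "T = T'" "(jctx J \<turnstile> Type T) \<in> derived R (free X)"
      using wf_type_derived[OF X R \<Gamma>] r by auto
    then have "(jctx J \<turnstile> TypeEq T T') \<in> derived R (free X)"
      by (auto intro: derived.rule[OF eq(2) infers.intros(4)])
    then show ?thesis using TypeEq J by simp
  next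
    case (TermEq t t' T)
    then have "t = t'" "(jctx J \<turnstile> Term t T) \<in> derived R (free X)"
      using wf_term_derived[OF X R \<Gamma>] r by auto
    then have "(jctx J \<turnstile> TermEq t t' T) \<in> derived R (free X)"
      by (auto intro: derived.rule[OF eq(1) infers.intros(1)])
    then show ?thesis using TermEq J by simp
  qed
qed (rule derived_imp_wf[OF X R])

section \<open>The equivalence of judgements of a free theory\<close>

text \<open>The renaming in the definition of \<open>\<equiv>\<close> carries the variables of one context to the variables of the
  other, position by position.\<close>

lemma map_transport:
  assumes "distinct ys" "length xs = length ys"
  shows "map (\<lambda>v. xs ! (pos ys v - 1)) ys = xs"
  using assms by (intro nth_equalityI) (simp_all add: pos_nth)

lemma inj_on_transport:
  assumes "distinct xs" "distinct ys" "length xs = length ys"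
  shows "inj_on (\<lambda>v. xs ! (pos ys v - 1)) (set ys)"
proof -
  have "distinct (map (\<lambda>v. xs ! (pos ys v - 1)) ys)" using assms by (simp only: map_transport)
  then show ?thesis by (simp only: distinct_map)
qed

lemma normal_form_eq_iff:
  assumes J: "closed J" and K: "closed K" and len: "length (jctx J) = length (jctx K)"
  shows "normal_form J = normal_form K \<longleftrightarrow> J = permute (\<lambda>v. vars (jctx J) ! (pos (vars (jctx K)) v - 1)) K"
proof
  assume eq: "normal_form J = normal_form K"
  have "J = permute (\<lambda>i. vars (jctx J) ! (i - 1)) (normal_form K)" using from_normal_form[OF J] eq by simp
  then show "J = permute (\<lambda>v. vars (jctx J) ! (pos (vars (jctx K)) v - 1)) K"
    by (simp add: normal_form_def permute_comp comp_def)
next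
  assume "J = permute (\<lambda>v. vars (jctx J) ! (pos (vars (jctx K)) v - 1)) K"
  moreover have "inj_on (\<lambda>v. vars (jctx J) ! (pos (vars (jctx K)) v - 1)) (set (vars (jctx K)))"
    using J K len by (intro inj_on_transport) (simp_all add: closed_def)
  ultimately show "normal_form J = normal_form K" using normal_form_permute[OF K] by metis
qed

lemma normal_form_eqE:
  assumes "closed J" "closed K" "normal_form J = normal_form K"
  obtains f where "inj_on f (set (vars (jctx K)))" "J = permute f K"
proof -
  have len: "length (jctx J) = length (jctx K)" using assms(3) length_normal_form by metis
  show ?thesis
    using assms normal_form_eq_iff[OF assms(1,2) len] len
    by (intro that[OF inj_on_transport]) (auto simp: closed_def)
qed

lemma ctx_eq_iff: "\<Gamma> = map (map_prod f g) \<Delta> \<longleftrightarrow> vars \<Gamma> = map f (vars \<Delta>) \<and> map snd \<Gamma> = map g (map snd \<Delta>)"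
proof (induction \<Gamma> arbitrary: \<Delta>)
  case (Cons p \<Gamma>)
  then show ?case by (cases \<Delta>; cases p) (auto simp: vars_def)
qed (auto simp: vars_def)

definition type_or_term :: "'w judgement \<Rightarrow> bool" where
  "type_or_term J \<longleftrightarrow> (\<exists>T. jrhs J = Type T) \<or> (\<exists>t T. jrhs J = Term t T)"

lemma wf_types:
  assumes "wf_ctx X \<Gamma>" "wf_type X \<Gamma> S" "i \<le> length \<Gamma>"
  shows "wf_ctx X (take i \<Gamma>) \<and> wf_type X (take i \<Gamma>) ((map snd \<Gamma> @ [S]) ! i)"
  using assms by (auto simp: wf_ctx_take nth_append wf_ctx_def[of X \<Gamma>])

text \<open>A derivable equation of types has equal sides, so the chain of equations that defines \<open>\<equiv>\<close> says that
  the renaming by position transforms one judgement into the other.\<close>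

lemma type_equiv_iff:
  assumes X: "is_presheaf X" and R: "R = w_rules \<or> R = wp_rules"
    and \<Gamma>: "wf_ctx X \<Gamma>" "wf_type X \<Gamma> S" and \<Delta>: "wf_ctx X \<Delta>" "wf_type X \<Delta> S'"
  defines "f \<equiv> \<lambda>v. vars \<Gamma> ! (pos (vars \<Delta>) v - 1)"
  shows "type_equiv R (free X) \<Gamma> S \<Delta> S' \<longleftrightarrow>
    length \<Gamma> = length \<Delta> \<and> \<Gamma> = map (map_prod f (permute_expr f)) \<Delta> \<and> S = permute_expr f S'"
proof (cases "length \<Gamma> = length \<Delta>")
  case True
  have "(take i \<Gamma> \<turnstile> TypeEq ((map snd \<Gamma> @ [S]) ! i)
          (replace (take i (vars \<Delta>)) (take i (vars \<Gamma>)) ((map snd \<Delta> @ [S']) ! i))) \<in> derived R (free X)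
      \<longleftrightarrow> (map snd \<Gamma> @ [S]) ! i = map (permute_expr f) (map snd \<Delta> @ [S']) ! i"
    if i: "i \<le> length \<Gamma>" for i
  proof -
    let ?b = "(map snd \<Delta> @ [S']) ! i"
    have "wf_type X (take i \<Delta>) ?b" using wf_types[OF \<Delta>] i True by simp
    from wf_type_fv[OF this] have fv: "fv ?b \<subseteq> set (take i (vars \<Delta>))" by (simp add: vars_take)
    have "replace (take i (vars \<Delta>)) (take i (vars \<Gamma>)) ?b =
        permute_expr (\<lambda>v. take i (vars \<Gamma>) ! (pos (take i (vars \<Delta>)) v - 1)) ?b"
      using True by (intro replace_eq_permute fv) simp
    also have "\<dots> = permute_expr f ?b"
    proof (rule permute_expr_cong)
      fix x assume "x \<in> fv ?b"
      then have x: "x \<in> set (take i (vars \<Delta>))" using fv by blast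
      then have "pos (vars \<Delta>) x = pos (take i (vars \<Delta>)) x"
        using pos_append[OF x, of "drop i (vars \<Delta>)"] by simp
      moreover have "pos (take i (vars \<Delta>)) x \<le> i" using pos_le[OF x] by simp
      moreover have "pos (take i (vars \<Delta>)) x \<ge> 1" by simp
      ultimately show "take i (vars \<Gamma>) ! (pos (take i (vars \<Delta>)) x - 1) = f x"
        unfolding f_def by (metis One_nat_def Suc_le_lessD Suc_pred nth_take pos_ge_1(2))
    qed
    also have "\<dots> = map (permute_expr f) (map snd \<Delta> @ [S']) ! i"
      using i True by (intro nth_map[symmetric]) simp
    finally show ?thesis
      using wf_types[OF \<Gamma> i] by (auto simp: derived_iff_wf[OF X R] wf_def)
  qed
  then have "type_equiv R (free X) \<Gamma> S \<Delta> S' \<longleftrightarrow>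
      (\<forall>i\<le>length \<Gamma>. (map snd \<Gamma> @ [S]) ! i = map (permute_expr f) (map snd \<Delta> @ [S']) ! i)"
    using True by (simp add: type_equiv_def)
  also have "\<dots> \<longleftrightarrow> map snd \<Gamma> @ [S] = map (permute_expr f) (map snd \<Delta> @ [S'])"
    using True by (auto simp: list_eq_iff_nth_eq less_Suc_eq_le)
  also have "\<dots> \<longleftrightarrow> map snd \<Gamma> = map (permute_expr f) (map snd \<Delta>) \<and> S = permute_expr f S'"
    by simp
  also have "vars \<Gamma> = map f (vars \<Delta>)"
    unfolding f_def using True \<Delta> by (intro map_transport[symmetric]) (simp_all add: wf_ctx_def)
  then have "(map snd \<Gamma> = map (permute_expr f) (map snd \<Delta>)) = (\<Gamma> = map (map_prod f (permute_expr f)) \<Delta>)"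
    by (simp add: ctx_eq_iff)
  finally show ?thesis using True by simp
qed (auto simp: type_equiv_def)

theorem jrel_free:
  assumes X: "is_presheaf X" and R: "R = w_rules \<or> R = wp_rules"
  shows "(J, K) \<in> jrel R (free X) \<longleftrightarrow>
    J \<in> derived R (free X) \<and> K \<in> derived R (free X) \<and> type_or_term J \<and> normal_form J = normal_form K"
proof (cases "J \<in> derived R (free X) \<and> K \<in> derived R (free X)")
  case True
  then have J: "wf R X J" and K: "wf R X K" by (simp_all add: derived_iff_wf[OF X R])
  obtain \<Gamma> r where Jr: "J = (\<Gamma> \<turnstile> r)" by (cases J)
  obtain \<Delta> r' where Kr: "K = (\<Delta> \<turnstile> r')" by (cases K)
  define f where "f v = vars \<Gamma> ! (pos (vars \<Delta>) v - 1)" for v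
  have normal_form: "normal_form (\<Gamma> \<turnstile> r) = normal_form (\<Delta> \<turnstile> r') \<longleftrightarrow> length \<Gamma> = length \<Delta> \<and>
      \<Gamma> = map (map_prod f (permute_expr f)) \<Delta> \<and> r = map_rhs (permute_expr f) r'"
  proof (cases "length \<Gamma> = length \<Delta>")
    case True
    then show ?thesis
      using normal_form_eq_iff[OF wf_closed[OF J] wf_closed[OF K]] by (simp add: Jr Kr permute_def f_def[abs_def])
  next
    case False
    then have "normal_form (\<Gamma> \<turnstile> r) \<noteq> normal_form (\<Delta> \<turnstile> r')" using length_normal_form by (metis judgement.sel(1))
    then show ?thesis using False by simp
  qed
  have c: "wf_ctx X \<Gamma>" "wf_ctx X \<Delta>" using J K by (simp_all add: wf_def Jr Kr)
  have te: "type_equiv R (free X) \<Gamma> S \<Delta> S' \<longleftrightarrow>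
      length \<Gamma> = length \<Delta> \<and> \<Gamma> = map (map_prod f (permute_expr f)) \<Delta> \<and> S = permute_expr f S'"
    if "wf_type X \<Gamma> S" "wf_type X \<Delta> S'" for S S'
    using type_equiv_iff[OF X R c(1) that(1) c(2) that(2)] by (simp add: f_def[abs_def])
  have "equiv_judgements R (free X) J K \<longleftrightarrow> type_or_term J \<and> normal_form J = normal_form K"
  proof (cases r)
    case (Type S)
    then show ?thesis
      using J K te normal_form by (cases r') (auto simp: Jr Kr type_or_term_def wf_def)
  next
    case (Term s S)
    show ?thesis
    proof (cases r')
      case r': (Term t S')
      have "wf_term R X \<Gamma> s S" "wf_term R X \<Delta> t S'" using J K by (simp_all add: wf_def Jr Kr r' Term)
      then have S: "wf_type X \<Gamma> S" "wf_type X \<Delta> S'" "fv t \<subseteq> set (vars \<Delta>)"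
        using wf_term_wf_type c wf_term_fv by blast+
      have "equiv_judgements R (free X) J K \<longleftrightarrow> type_equiv R (free X) \<Gamma> S \<Delta> S' \<and>
          s = replace (vars \<Delta>) (vars \<Gamma>) t"
        using J by (auto simp: Jr Kr r' Term derived_iff_wf[OF X R] wf_def)
      also have "\<dots> \<longleftrightarrow> type_equiv R (free X) \<Gamma> S \<Delta> S' \<and> s = permute_expr f t"
        using replace_eq_permute[of "vars \<Gamma>" "vars \<Delta>" t] S(3) by (auto simp: type_equiv_def f_def[abs_def])
      finally show ?thesis
        using te[OF S(1,2)] normal_form by (auto simp: Jr Kr r' Term type_or_term_def)
    qed (use normal_form in \<open>auto simp: Jr Kr Term\<close>)
  qed (auto simp: Jr Kr type_or_term_def)
  then show ?thesis using True by (simp add: jrel_def)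
qed (auto simp: jrel_def)

lemma is_gat_free:
  assumes X: "is_presheaf X" and R: "R = w_rules \<or> R = wp_rules"
  shows "is_gat R (free X)"
proof -
  let ?C = "tyconsts (free X) <+> tmconsts (free X)"
  have c: "?C = {(n, A). n \<ge> 1 \<and> A \<in> tyel X n} <+> {(n, a). n \<ge> 1 \<and> a \<in> tmel X n}"
    by (simp add: free_def)
  have ty: "set_expr T \<subseteq> ?C" if "wf_type X \<Gamma> T" for \<Gamma> T
    using that by cases (auto simp: c spine_def)
  have tm: "set_expr t \<subseteq> ?C" if "wf_term R X \<Gamma> t T" for \<Gamma> t T
    using that by cases (auto simp: c spine_def)
  have basics: "basics (free X) \<subseteq> derived R (free X)"
    using basic_type_derived[OF X] basic_term_derived[OF X] by (auto simp: basics_free)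
  have over: "judgement_over ?C J" if "J \<in> basics (free X)" for J
  proof -
    have "J \<in> derived R (free X)" using that basics by blast
    then have "wf R X J" by (simp add: derived_iff_wf[OF X R])
    then have \<Gamma>: "wf_ctx X (jctx J)" and r: "wf_rhs R X (jctx J) (jrhs J)" by (auto simp: wf_def)
    have "set_expr (snd p) \<subseteq> ?C" if "p \<in> set (jctx J)" for p
      using ty[OF wf_type_entry[OF \<Gamma>, of "fst p"]] that by simp
    moreover have "set_expr e \<subseteq> ?C" if "e \<in> set_rhs (jrhs J)" for e
    proof -
      have "set_expr t \<subseteq> ?C \<and> set_expr T \<subseteq> ?C" if "wf_term R X (jctx J) t T" for t T
        using tm[OF that] ty[OF wf_term_wf_type[OF \<Gamma> that]] by simp
      then show ?thesis using \<open>e \<in> set_rhs (jrhs J)\<close> r ty by (cases "jrhs J") (simp; blast)+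
    qed
    ultimately show ?thesis using \<Gamma> unfolding judgement_over_def wf_ctx_def by blast
  qed
  have it: "introduces_type (n, A) (basic_type X m B) \<longleftrightarrow> (n, A) = (m, B)" for n A m B
    by (auto simp: introduces_type_def basic_type_def)
  have it': "\<not> introduces_type (n, A) (basic_term X m a)" for n A m a
    by (simp add: introduces_type_def basic_term_def)
  have im: "introduces_term (n, a) (basic_term X m b) \<longleftrightarrow> (n, a) = (m, b)" for n a m b
    by (auto simp: introduces_term_def basic_term_def)
  have im': "\<not> introduces_term (n, a) (basic_type X m A)" for n A m a
    by (simp add: introduces_term_def basic_type_def)
  have "\<exists>!J. J \<in> basics (free X) \<and> introduces_type A J" if A: "A \<in> tyconsts (free X)" for A
  proof -
    obtain n B where A: "A = (n, B)" "n \<ge> 1" "B \<in> tyel X n" using A by (auto simp: free_def)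
    show ?thesis
      by (rule ex1I[of _ "basic_type X n B"]) (use A it it' in \<open>auto simp: basics_free\<close>)
  qed
  moreover have "\<exists>!J. J \<in> basics (free X) \<and> introduces_term a J" if a: "a \<in> tmconsts (free X)" for a
  proof -
    obtain n b where a: "a = (n, b)" "n \<ge> 1" "b \<in> tmel X n" using a by (auto simp: free_def)
    show ?thesis
      by (rule ex1I[of _ "basic_term X n b"]) (use a im im' in \<open>auto simp: basics_free\<close>)
  qed
  moreover have "(\<exists>A\<in>tyconsts (free X). introduces_type A J) \<or>
      (\<exists>f\<in>tmconsts (free X). introduces_term f J) \<or> is_equality J" if J: "J \<in> basics (free X)" for J
  proof -
    consider n A where "J = basic_type X n A" "(n, A) \<in> tyconsts (free X)"
      | n a where "J = basic_term X n a" "(n, a) \<in> tmconsts (free X)"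
      using J by (auto simp: free_def)
    then show ?thesis using it im by cases blast+
  qed
  ultimately show ?thesis using basics over by (simp add: is_gat_def)
qed

lemma type_or_term_simps [simp]:
  "type_or_term (\<Gamma> \<turnstile> Type T)" "type_or_term (\<Gamma> \<turnstile> Term t T)"
  by (simp_all add: type_or_term_def)

lemma mem_jclass: "K \<in> jclass R T J \<longleftrightarrow> (J, K) \<in> jrel R T"
  by (simp add: jclass_def)

lemma type_or_term_normal_form_cong: "normal_form J = normal_form K \<Longrightarrow> type_or_term J \<Longrightarrow> type_or_term K"
  using jrhs_normal_form[of J] jrhs_normal_form[of K] by (cases "jrhs K") (auto simp: type_or_term_def)

lemma jclass_eqI:
  assumes "is_presheaf X" "R = w_rules \<or> R = wp_rules"
    and "normal_form J = normal_form K" "J \<in> derived R (free X)" "K \<in> derived R (free X)"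
  shows "jclass R (free X) J = jclass R (free X) K"
  using assms(3-5) type_or_term_normal_form_cong[of J K] type_or_term_normal_form_cong[of K J]
  by (auto simp: mem_jclass jrel_free[OF assms(1,2)])

lemma jrel_free_refl:
  assumes "is_presheaf X" "R = w_rules \<or> R = wp_rules" "J \<in> derived R (free X)" "type_or_term J"
  shows "(J, J) \<in> jrel R (free X)"
  using assms by (simp add: jrel_free)

section \<open>The underlying structure of a free theory\<close>

lemma boundary_permute: "boundary (permute f J) = map (permute f) (boundary J)"
  by (cases J rule: boundary.cases) (auto simp: permute_def map_butlast last_map)

lemma wf_boundary:
  assumes "wf R X J" "K \<in> set (boundary J)"
  shows "wf R X K"
  using assms
proof (cases J rule: boundary.cases)
  case (1 \<Gamma> T)
  then have \<Gamma>: "\<Gamma> \<noteq> []" "K = (butlast \<Gamma> \<turnstile> Type (snd (last \<Gamma>)))"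
    using assms(2) by (auto split: if_splits)
  then have "wf_ctx X (butlast \<Gamma> @ [(fst (last \<Gamma>), snd (last \<Gamma>))])" using assms(1) 1 by (simp add: wf_def)
  then show ?thesis unfolding wf_ctx_snoc using \<Gamma> by (simp add: wf_def)
qed (auto simp: wf_def intro: wf_term_wf_type)

lemma boundary_derived:
  assumes "is_presheaf X" "R = w_rules \<or> R = wp_rules" "J \<in> derived R (free X)" "K \<in> set (boundary J)"
  shows "K \<in> derived R (free X)"
  using assms(3,4) wf_boundary by (auto simp: derived_iff_wf[OF assms(1,2)])

lemma derived_closed:
  assumes "is_presheaf X" "R = w_rules \<or> R = wp_rules" "J \<in> derived R (free X)"
  shows "closed J"
  using assms by (intro wf_closed[of R X]) (simp add: derived_iff_wf)

text \<open>Equivalent judgements differ by a renaming, which commutes with boundaries; so every representative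
  yields the same class.\<close>

lemma class_boundary_jclass:
  assumes X: "is_presheaf X" and R: "R = w_rules \<or> R = wp_rules"
    and J: "J \<in> derived R (free X)" "type_or_term J" "boundary J = [K]"
  shows "class_boundary R (free X) (jclass R (free X) J) = jclass R (free X) K"
proof -
  have K: "K \<in> derived R (free X)" using boundary_derived[OF X R J(1)] J(3) by simp
  have "(\<Union>K'\<in>set (boundary J'). jclass R (free X) K') = jclass R (free X) K"
    if "J' \<in> jclass R (free X) J" for J'
  proof -
    have J': "J' \<in> derived R (free X)" "normal_form J' = normal_form J"
      using that by (simp_all add: mem_jclass jrel_free[OF X R])
    obtain f where f: "inj_on f (set (vars (jctx J)))" "J' = permute f J"
      using J' J(1) derived_closed[OF X R] normal_form_eqE by metis
    then have bd: "boundary J' = [permute f K]" using J(3) by (simp add: boundary_permute)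
    have "set (vars (jctx K)) \<subseteq> set (vars (jctx J))"
      using J(3) by (cases J rule: boundary.cases)
        (auto simp: vars_def split: if_splits dest!: in_set_butlastD intro: rev_image_eqI)
    then have "normal_form (permute f K) = normal_form K"
      using f(1) by (intro normal_form_permute derived_closed[OF X R K]) (rule inj_on_subset)
    then have "jclass R (free X) (permute f K) = jclass R (free X) K"
      using boundary_derived[OF X R J'(1)] bd K by (intro jclass_eqI[OF X R]) simp_all
    then show ?thesis by (simp add: bd)
  qed
  moreover have "J \<in> jclass R (free X) J"
    using J by (simp add: mem_jclass jrel_free[OF X R])
  ultimately show ?thesis unfolding class_boundary_def by blast
qed

lemma tyel_forget: "c \<in> tyel (forget R T) n \<longleftrightarrow>
    (\<exists>\<Gamma> S. (\<Gamma> \<turnstile> Type S) \<in> derived R T \<and> Suc (length \<Gamma>) = n \<and> c = jclass R T (\<Gamma> \<turnstile> Type S))"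
proof -
  have "c \<in> tyel (forget R T) n \<longleftrightarrow> (\<exists>J\<in>type_judgements R T. degree J = n \<and> c = jclass R T J)"
    by (auto simp: forget_def quotient_def jclass_def)
  also have "\<dots> \<longleftrightarrow> (\<exists>\<Gamma> S. (\<Gamma> \<turnstile> Type S) \<in> type_judgements R T \<and> degree (\<Gamma> \<turnstile> Type S) = n \<and> c = jclass R T (\<Gamma> \<turnstile> Type S))"
    unfolding type_judgements_def by blast
  finally show ?thesis by (simp add: type_judgements_def degree_def)
qed

lemma tmel_forget: "c \<in> tmel (forget R T) n \<longleftrightarrow>
    (\<exists>\<Gamma> s S. (\<Gamma> \<turnstile> Term s S) \<in> derived R T \<and> Suc (length \<Gamma>) = n \<and> c = jclass R T (\<Gamma> \<turnstile> Term s S))"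
proof -
  have "c \<in> tmel (forget R T) n \<longleftrightarrow> (\<exists>J\<in>term_judgements R T. degree J = n \<and> c = jclass R T J)"
    by (auto simp: forget_def quotient_def jclass_def)
  also have "\<dots> \<longleftrightarrow> (\<exists>\<Gamma> s S. (\<Gamma> \<turnstile> Term s S) \<in> term_judgements R T \<and> degree (\<Gamma> \<turnstile> Term s S) = n \<and> c = jclass R T (\<Gamma> \<turnstile> Term s S))"
    unfolding term_judgements_def by blast
  finally show ?thesis by (simp add: term_judgements_def degree_def)
qed

lemma bd_forget [simp]:
  "bdty (forget R T) n = class_boundary R T" "bdtm (forget R T) n = class_boundary R T"
  by (simp_all add: forget_def)

lemma class_boundary_type:
  assumes "is_presheaf X" "R = w_rules \<or> R = wp_rules" "(\<Gamma> \<turnstile> Type S) \<in> derived R (free X)" "\<Gamma> \<noteq> []"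
  shows "class_boundary R (free X) (jclass R (free X) (\<Gamma> \<turnstile> Type S)) =
    jclass R (free X) (butlast \<Gamma> \<turnstile> Type (snd (last \<Gamma>)))"
  using assms by (intro class_boundary_jclass) simp_all

lemma class_boundary_term:
  assumes "is_presheaf X" "R = w_rules \<or> R = wp_rules" "(\<Gamma> \<turnstile> Term s S) \<in> derived R (free X)"
  shows "class_boundary R (free X) (jclass R (free X) (\<Gamma> \<turnstile> Term s S)) = jclass R (free X) (\<Gamma> \<turnstile> Type S)"
  using assms by (intro class_boundary_jclass) simp_all

lemma is_presheaf_forget:
  assumes X: "is_presheaf X" and R: "R = w_rules \<or> R = wp_rules"
  shows "is_presheaf (forget R (free X))"
  unfolding is_presheaf_def bd_forget
proof (intro allI impI conjI funcsetI)
  fix n :: nat and c assume "n \<ge> 1" "c \<in> tyel (forget R (free X)) (n + 1)"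
  then obtain \<Gamma> S where c: "(\<Gamma> \<turnstile> Type S) \<in> derived R (free X)" "Suc (length \<Gamma>) = n + 1"
    "c = jclass R (free X) (\<Gamma> \<turnstile> Type S)" unfolding tyel_forget by blast
  then have ne: "\<Gamma> \<noteq> []" "length \<Gamma> = n" using \<open>n \<ge> 1\<close> by auto
  have "class_boundary R (free X) c = jclass R (free X) (butlast \<Gamma> \<turnstile> Type (snd (last \<Gamma>)))"
    using class_boundary_type[OF X R c(1) ne(1)] c(3) by simp
  moreover have "(butlast \<Gamma> \<turnstile> Type (snd (last \<Gamma>))) \<in> derived R (free X)"
    using boundary_derived[OF X R c(1)] ne(1) by simp
  ultimately show "class_boundary R (free X) c \<in> tyel (forget R (free X)) n"
    unfolding tyel_forget using ne \<open>n \<ge> 1\<close>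
    by (intro exI[of _ "butlast \<Gamma>"] exI[of _ "snd (last \<Gamma>)"]) simp
next
  fix n :: nat and c assume "n \<ge> 1" "c \<in> tmel (forget R (free X)) n"
  then obtain \<Gamma> s S where c: "(\<Gamma> \<turnstile> Term s S) \<in> derived R (free X)" "Suc (length \<Gamma>) = n"
    "c = jclass R (free X) (\<Gamma> \<turnstile> Term s S)" unfolding tmel_forget by blast
  then have "class_boundary R (free X) c = jclass R (free X) (\<Gamma> \<turnstile> Type S)"
    using class_boundary_term[OF X R] by simp
  moreover have "(\<Gamma> \<turnstile> Type S) \<in> derived R (free X)"
    using boundary_derived[OF X R c(1)] by simp
  ultimately show "class_boundary R (free X) c \<in> tyel (forget R (free X)) n"
    unfolding tyel_forget using c(2) by (intro exI[of _ \<Gamma>] exI[of _ S]) simp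
qed

lemma bdpow_forget:
  assumes X: "is_presheaf X" and R: "R = w_rules \<or> R = wp_rules"
    and "(\<Gamma> \<turnstile> Type S) \<in> derived R (free X)" "i < length \<Gamma>"
  shows "bdpow (forget R (free X)) (Suc i) (length \<Gamma> - i) (jclass R (free X) (\<Gamma> \<turnstile> Type S)) =
    jclass R (free X) (take i \<Gamma> \<turnstile> Type (snd (\<Gamma> ! i)))"
  using assms(3,4)
proof (induction \<Gamma> arbitrary: S rule: rev_induct)
  case (snoc p \<Gamma>)
  have p: "(\<Gamma> \<turnstile> Type (snd p)) \<in> derived R (free X)"
    using boundary_derived[OF X R snoc.prems(1)] by simp
  have bd: "class_boundary R (free X) (jclass R (free X) (\<Gamma> @ [p] \<turnstile> Type S)) =
      jclass R (free X) (\<Gamma> \<turnstile> Type (snd p))"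
    using class_boundary_type[OF X R snoc.prems(1)] by simp
  show ?case
  proof (cases "i = length \<Gamma>")
    case True
    then show ?thesis by (simp add: bd)
  next
    case False
    then have i: "i < length \<Gamma>" using snoc.prems(2) by simp
    then have "length (\<Gamma> @ [p]) - i = Suc (length \<Gamma> - i)" by simp
    then show ?thesis using snoc.IH[OF p i] i by (simp add: bd nth_append)
  qed
qed simp

section \<open>The translation of a theory of derived judgements\<close>

text \<open>Any representative gives the same normal form.\<close>

definition rep :: "'w judgement set \<Rightarrow> 'w judgement" where
  "rep c = normal_form (SOME J. J \<in> c)"

text \<open>What a constant that names the judgement stands for.\<close>

primrec subject :: "'e rhs \<Rightarrow> 'e" where
  "subject (Type T) = T"
| "subject (Term t T) = t"
| "subject (TypeEq T T') = T"
| "subject (TermEq t t' T) = t"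

definition const_body :: "nat \<times> 'w judgement set + nat \<times> 'w judgement set \<Rightarrow> 'w expr" where
  "const_body w = subject (jrhs (rep (case_sum snd snd w)))"

text \<open>The arguments of a constant are variables in every derived judgement. They are copied and not
  translated, so that no recursion is needed.\<close>

fun translate_expr :: "(nat \<times> 'w judgement set + nat \<times> 'w judgement set) expr \<Rightarrow> 'w expr" where
  "translate_expr (Var x) = Var x"
| "translate_expr (App w es) = subst (\<lambda>i. case es ! (i - 1) of Var y \<Rightarrow> Var y | _ \<Rightarrow> undefined) (const_body w)"

definition translate :: "(nat \<times> 'w judgement set + nat \<times> 'w judgement set) judgement \<Rightarrow> 'w judgement" where
  "translate J = (map (map_prod id translate_expr) (jctx J) \<turnstile> map_rhs translate_expr (jrhs J))"

text \<open>The expressions on which the translation is given by renaming: all the variables of the body of the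
  constant receive an argument. On other expressions the translation could introduce variables, and
  then it would violate the side conditions of weakening and projection.\<close>

inductive translatable :: "(nat \<times> 'w judgement set + nat \<times> 'w judgement set) expr \<Rightarrow> bool" where
  "translatable (Var x)"
| "fv (const_body w) \<subseteq> {1..length ys} \<Longrightarrow> translatable (App w (map Var ys))"

definition translatable_judgement ::
    "(nat \<times> 'w judgement set + nat \<times> 'w judgement set) judgement \<Rightarrow> bool" where
  "translatable_judgement J \<longleftrightarrow>
     (\<forall>p\<in>set (jctx J). translatable (snd p)) \<and> (\<forall>e\<in>set_rhs (jrhs J). translatable e)"

lemma translate_expr_App_Var:
  assumes "fv (const_body w) \<subseteq> {1..length ys}"
  shows "translate_expr (App w (map Var ys)) = permute_expr (\<lambda>i. ys ! (i - 1)) (const_body w)"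
  unfolding translate_expr.simps permute_expr_def
proof (rule subst_cong)
  fix i assume "i \<in> fv (const_body w)"
  then have "i - 1 < length ys" using assms by fastforce
  then show "(case map Var ys ! (i - 1) of Var y \<Rightarrow> Var y | _ \<Rightarrow> undefined) = Var (ys ! (i - 1))"
    by simp
qed

lemma translate_expr_permute: "translatable e \<Longrightarrow> translate_expr (permute_expr f e) = permute_expr f (translate_expr e)"
proof (induction rule: translatable.induct)
  case (2 w ys)
  then have "translate_expr (App w (map Var (map f ys))) = permute_expr (\<lambda>i. map f ys ! (i - 1)) (const_body w)"
    by (intro translate_expr_App_Var) simp
  also have "\<dots> = permute_expr (f \<circ> (\<lambda>i. ys ! (i - 1))) (const_body w)"
  proof (rule permute_expr_cong)
    fix i assume "i \<in> fv (const_body w)"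
    then have "i - 1 < length ys" using 2 by fastforce
    then show "map f ys ! (i - 1) = (f \<circ> (\<lambda>i. ys ! (i - 1))) i" by simp
  qed
  also have "\<dots> = permute_expr f (translate_expr (App w (map Var ys)))"
    unfolding translate_expr_App_Var[OF 2] by (simp only: permute_expr_comp)
  finally show ?case by (simp add: comp_def del: translate_expr.simps)
qed simp

lemma fv_translate_expr: "translatable e \<Longrightarrow> fv (translate_expr e) \<subseteq> fv e"
proof (induction rule: translatable.induct)
  case (2 w ys)
  have "ys ! (i - 1) \<in> set ys" if "i \<in> fv (const_body w)" for i
  proof -
    have "i - 1 < length ys" using 2 that by fastforce
    then show ?thesis by simp
  qed
  then show ?case unfolding translate_expr_App_Var[OF 2] by auto
qed simp

lemma translate_sel [simp]: "jctx (translate J) = map (map_prod id translate_expr) (jctx J)" "jrhs (translate J) = map_rhs translate_expr (jrhs J)"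
  by (simp_all add: translate_def)

lemma vars_translate [simp]: "vars (jctx (translate J)) = vars (jctx J)"
  by simp

lemma translate_permute:
  assumes "translatable_judgement J"
  shows "translate (permute f J) = permute f (translate J)"
proof -
  have "translate_expr (permute_expr f (snd p)) = permute_expr f (translate_expr (snd p))" if "p \<in> set (jctx J)" for p
    using assms that by (intro translate_expr_permute) (simp add: translatable_judgement_def)
  moreover have "map_rhs (translate_expr \<circ> permute_expr f) (jrhs J) = map_rhs (permute_expr f \<circ> translate_expr) (jrhs J)"
    using assms by (intro rhs.map_cong refl) (simp add: translatable_judgement_def translate_expr_permute)
  ultimately show ?thesis
    by (cases J) (auto simp: translate_def permute_def rhs.map_comp split_beta map_prod_def)
qed

lemma translate_boundary: "boundary (translate J) = map translate (boundary J)"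
  by (cases J rule: boundary.cases) (auto simp: translate_def map_butlast last_map)

lemma fv_ctx_translate:
  assumes "\<forall>p\<in>set \<Gamma>. translatable (snd p)"
  shows "fv_ctx (map (map_prod id translate_expr) \<Gamma>) \<subseteq> fv_ctx \<Gamma>"
proof -
  have "fv (translate_expr (snd p)) \<subseteq> fv_ctx \<Gamma>" if "p \<in> set \<Gamma>" for p
    using that assms fv_translate_expr[of "snd p"] by (force simp: fv_ctx_def)
  then show ?thesis by (auto simp: fv_ctx_def vars_def)
qed

text \<open>Translation works expression by expression, keeps the declared variables and introduces no new ones,
  so it turns an instance of a rule, with its side conditions, into an instance of the same rule.\<close>

lemma translate_infers:
  assumes "infers r Js J" "\<forall>K\<in>set Js. translatable_judgement K"
  shows "infers r (map translate Js) (translate J)"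
  using assms
proof cases
  case (9 \<sigma> J')
  then show ?thesis using assms(2) infers.intros(9)[of \<sigma> "translate J'"] by (simp add: translate_permute)
next
  case (10 y \<Gamma> \<Delta> T r')
  have "\<forall>p\<in>set \<Gamma>. translatable (snd p)" "\<forall>p\<in>set \<Delta>. translatable (snd p)"
    using assms(2) 10 by (simp_all add: translatable_judgement_def)
  then have "y \<notin> fv_ctx (map (map_prod id translate_expr) \<Gamma>) \<union> fv_ctx (map (map_prod id translate_expr) \<Delta>)"
    using 10 fv_ctx_translate by blast
  from infers.intros(10)[OF this, of "translate_expr T" "map_rhs translate_expr r'"] show ?thesis
    using 10 by (simp add: translate_def)
next
  case (11 y \<Gamma> T)
  have "\<forall>p\<in>set \<Gamma>. translatable (snd p)"
    using assms(2) 11 by (simp add: translatable_judgement_def)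
  then have "y \<notin> fv_ctx (map (map_prod id translate_expr) \<Gamma>)" using 11 fv_ctx_translate by blast
  from infers.intros(11)[OF this, of "translate_expr T"] show ?thesis using 11 by (simp add: translate_def)
qed (auto simp: translate_def intro: infers.intros)

lemma infers_functional: "infers r Js J \<Longrightarrow> infers r Js K \<Longrightarrow> J = K"
  by (induction rule: infers.induct) (auto elim: infers.cases)

lemma translate_normal_form: "translatable_judgement J \<Longrightarrow> translate (normal_form J) = normal_form (translate J)"
  by (simp only: normal_form_def translate_permute vars_translate)

lemma rep_jclass:
  assumes X: "is_presheaf X" and R: "R = w_rules \<or> R = wp_rules"
    and J: "J \<in> derived R (free X)" "type_or_term J"
  shows "rep (jclass R (free X) J) = normal_form J"
proof -
  have "J \<in> jclass R (free X) J" using J by (simp add: mem_jclass jrel_free[OF X R])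
  then have "(SOME K. K \<in> jclass R (free X) J) \<in> jclass R (free X) J" by (rule someI)
  moreover have "normal_form K = normal_form J" if "K \<in> jclass R (free X) J" for K
    using that by (simp add: mem_jclass jrel_free[OF X R])
  ultimately show ?thesis unfolding rep_def by blast
qed

lemma fv_subject: "fv (subject (jrhs J)) \<subseteq> fv_judgement J"
  by (cases "jrhs J") (auto simp: fv_judgement_eq)

lemma fv_const_body:
  assumes X: "is_presheaf X" and R: "R = w_rules \<or> R = wp_rules"
    and J: "J \<in> derived R (free X)" "type_or_term J"
    and w: "case_sum snd snd w = jclass R (free X) J"
  shows "const_body w = subject (jrhs (normal_form J))" "fv (const_body w) \<subseteq> {1..length (jctx J)}"
proof -
  show *: "const_body w = subject (jrhs (normal_form J))"
    by (simp add: const_body_def w rep_jclass[OF X R J])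
  have c: "closed J" by (rule derived_closed[OF X R J(1)])
  have "fv_judgement (normal_form J) \<subseteq> set (vars (jctx (normal_form J)))" using closed_normal_form[OF c] by (simp only: closed_def)
  then have "fv_judgement (normal_form J) \<subseteq> {1..length (jctx J)}"
    unfolding vars_normal_form[OF c] by (simp add: atLeastLessThanSuc_atLeastAtMost del: upt_Suc)
  then show "fv (const_body w) \<subseteq> {1..length (jctx J)}"
    using fv_subject[of "normal_form J"] * by simp
qed

lemma wf_translatable:
  assumes X: "is_presheaf X" and R: "R = w_rules \<or> R = wp_rules"
    and J: "wf R (forget R (free X)) J"
  shows "translatable_judgement J"
proof -
  have ty: "translatable T" if "wf_type (forget R (free X)) \<Gamma> T" for \<Gamma> T
    using that
  proof cases
    case (const k c ys)
    then have "c \<in> tyel (forget R (free X)) k" "length ys = k - 1" by (simp_all add: spine_def)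
    then obtain \<Delta> S where S: "(\<Delta> \<turnstile> Type S) \<in> derived R (free X)" "length \<Delta> = length ys"
      "c = jclass R (free X) (\<Delta> \<turnstile> Type S)" by (auto simp: tyel_forget)
    have "fv (const_body (Inl (k, c))) \<subseteq> {1..length ys}"
      using fv_const_body(2)[OF X R S(1)] S by simp
    then show ?thesis unfolding const(1) by (rule translatable.intros)
  qed
  have tm: "translatable t" if "wf_term R (forget R (free X)) \<Gamma> t T" for \<Gamma> t T
    using that
  proof cases
    case (const c k ys)
    then have "c \<in> tmel (forget R (free X)) k" "length ys = k - 1" by (simp_all add: spine_def)
    then obtain \<Delta> s S where S: "(\<Delta> \<turnstile> Term s S) \<in> derived R (free X)" "length \<Delta> = length ys"
      "c = jclass R (free X) (\<Delta> \<turnstile> Term s S)" by (auto simp: tmel_forget)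
    have "fv (const_body (Inr (k, c))) \<subseteq> {1..length ys}"
      using fv_const_body(2)[OF X R S(1)] S by simp
    then show ?thesis unfolding const(1) by (rule translatable.intros)
  qed (auto intro: translatable.intros)
  have \<Gamma>: "wf_ctx (forget R (free X)) (jctx J)" and r: "wf_rhs R (forget R (free X)) (jctx J) (jrhs J)"
    using J by (auto simp: wf_def)
  have "translatable (snd p)" if "p \<in> set (jctx J)" for p
    using ty[OF wf_type_entry[OF \<Gamma>, of "fst p"]] that by simp
  moreover have "translatable e" if "e \<in> set_rhs (jrhs J)" for e
    using that r ty[of "jctx J"] tm[of "jctx J"] wf_term_wf_type[OF \<Gamma>] by (cases "jrhs J") auto
  ultimately show ?thesis by (simp add: translatable_judgement_def)
qed

lemma derived_translatable:
  assumes X: "is_presheaf X" and R: "R = w_rules \<or> R = wp_rules"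
    and J: "J \<in> derived R (free (forget R (free X)))"
  shows "translatable_judgement J"
  using J by (intro wf_translatable[OF X R]) (simp add: derived_iff_wf[OF is_presheaf_forget[OF X R] R])

lemma translate_expr_const:
  assumes X: "is_presheaf X" and R: "R = w_rules \<or> R = wp_rules"
    and J: "J \<in> derived R (free X)" "type_or_term J" and w: "case_sum snd snd w = jclass R (free X) J"
  shows "translate_expr (App w (map Var [1..<Suc (length (jctx J))])) = subject (jrhs (normal_form J))"
proof -
  have "translate_expr (App w (map Var [1..<Suc (length (jctx J))])) =
      permute_expr (\<lambda>i. [1..<Suc (length (jctx J))] ! (i - 1)) (const_body w)"
    using fv_const_body(2)[OF assms] by (intro translate_expr_App_Var) (simp del: upt_Suc)
  also have "\<dots> = const_body w"
    using fv_const_body(2)[OF assms] by (intro permute_expr_id) (fastforce simp del: upt_Suc)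
  finally show ?thesis using fv_const_body(1)[OF assms] by simp
qed

lemma translate_expr_basic_ctx:
  assumes X: "is_presheaf X" and R: "R = w_rules \<or> R = wp_rules"
    and J: "(\<Gamma> \<turnstile> Type T) \<in> derived R (free X)"
  shows "map (map_prod id translate_expr) (basic_ctx (forget R (free X)) (Suc (length \<Gamma>)) (jclass R (free X) (\<Gamma> \<turnstile> Type T))) =
    map (map_prod (pos (vars \<Gamma>)) (permute_expr (pos (vars \<Gamma>)))) \<Gamma>"
proof (rule nth_equalityI)
  fix i assume "i < length (map (map_prod id translate_expr)
    (basic_ctx (forget R (free X)) (Suc (length \<Gamma>)) (jclass R (free X) (\<Gamma> \<turnstile> Type T))))"
  then have i: "i < length \<Gamma>" by (simp add: basic_ctx_def del: upt_Suc)
  let ?K = "take i \<Gamma> \<turnstile> Type (snd (\<Gamma> ! i))"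
  have wf: "wf_ctx X \<Gamma>" using J by (simp add: derived_iff_wf[OF X R] wf_def)
  then have K: "?K \<in> derived R (free X)"
    using i by (auto simp: derived_iff_wf[OF X R] wf_def wf_ctx_take) (simp add: wf_ctx_def)
  have "bdpow (forget R (free X)) (Suc i) (Suc (length \<Gamma>) - Suc i) (jclass R (free X) (\<Gamma> \<turnstile> Type T)) =
      jclass R (free X) ?K"
    using bdpow_forget[OF X R J i] by simp
  then have "map (map_prod id translate_expr)
      (basic_ctx (forget R (free X)) (Suc (length \<Gamma>)) (jclass R (free X) (\<Gamma> \<turnstile> Type T))) ! i =
      (Suc i, translate_expr (App (Inl (Suc i, jclass R (free X) ?K)) (map Var [1..<Suc i])))"
    using i by (simp add: basic_ctx_def del: upt_Suc translate_expr.simps)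
  also have "translate_expr (App (Inl (Suc i, jclass R (free X) ?K)) (map Var [1..<Suc i])) = subject (jrhs (normal_form ?K))"
    using translate_expr_const[OF X R K, of "Inl (Suc i, jclass R (free X) ?K)"] i by (simp del: upt_Suc translate_expr.simps)
  also have "\<dots> = permute_expr (pos (take i (vars \<Gamma>))) (snd (\<Gamma> ! i))"
    by (simp add: jrhs_normal_form vars_take)
  also have "\<dots> = permute_expr (pos (vars \<Gamma>)) (snd (\<Gamma> ! i))"
  proof (rule permute_expr_cong)
    fix x assume "x \<in> fv (snd (\<Gamma> ! i))"
    moreover have "fv (snd (\<Gamma> ! i)) \<subseteq> set (vars (take i \<Gamma>))"
      using wf i by (intro wf_type_fv[of X]) (simp add: wf_ctx_def)
    ultimately have "x \<in> set (take i (vars \<Gamma>))" by (auto simp: vars_take)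
    from pos_append[OF this, of "drop i (vars \<Gamma>)"]
    show "pos (take i (vars \<Gamma>)) x = pos (vars \<Gamma>) x" by simp
  qed
  also have "Suc i = pos (vars \<Gamma>) (vars \<Gamma> ! i)"
    using wf i by (intro pos_nth[symmetric]) (simp_all add: wf_ctx_def)
  also have "(pos (vars \<Gamma>) (vars \<Gamma> ! i), permute_expr (pos (vars \<Gamma>)) (snd (\<Gamma> ! i))) =
      map (map_prod (pos (vars \<Gamma>)) (permute_expr (pos (vars \<Gamma>)))) \<Gamma> ! i"
    using i by (cases "\<Gamma> ! i") (simp add: vars_def)
  finally show "map (map_prod id translate_expr)
      (basic_ctx (forget R (free X)) (Suc (length \<Gamma>)) (jclass R (free X) (\<Gamma> \<turnstile> Type T))) ! i =
    map (map_prod (pos (vars \<Gamma>)) (permute_expr (pos (vars \<Gamma>)))) \<Gamma> ! i" .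
qed (simp add: basic_ctx_def del: upt_Suc)

text \<open>The defining equation of the counit: up to the choice of representative, the basic judgement of a
  class goes to that class.\<close>

lemma translate_basic_type:
  assumes X: "is_presheaf X" and R: "R = w_rules \<or> R = wp_rules"
    and J: "(\<Gamma> \<turnstile> Type T) \<in> derived R (free X)"
  shows "translate (basic_type (forget R (free X)) (Suc (length \<Gamma>)) (jclass R (free X) (\<Gamma> \<turnstile> Type T))) =
    normal_form (\<Gamma> \<turnstile> Type T)"
  using translate_expr_basic_ctx[OF assms] translate_expr_const[OF X R J, of "Inl (Suc (length \<Gamma>), jclass R (free X) (\<Gamma> \<turnstile> Type T))"]
  by (simp add: translate_def basic_type_def normal_form_def permute_def del: upt_Suc translate_expr.simps)

lemma translate_basic_term:
  assumes X: "is_presheaf X" and R: "R = w_rules \<or> R = wp_rules"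
    and J: "(\<Gamma> \<turnstile> Term t T) \<in> derived R (free X)"
  shows "translate (basic_term (forget R (free X)) (Suc (length \<Gamma>)) (jclass R (free X) (\<Gamma> \<turnstile> Term t T))) =
    normal_form (\<Gamma> \<turnstile> Term t T)"
proof -
  have T: "(\<Gamma> \<turnstile> Type T) \<in> derived R (free X)" using boundary_derived[OF X R J] by simp
  show ?thesis
    using translate_expr_basic_ctx[OF X R T] class_boundary_term[OF X R J]
      translate_expr_const[OF X R T, of "Inl (Suc (length \<Gamma>), jclass R (free X) (\<Gamma> \<turnstile> Type T))"]
      translate_expr_const[OF X R J, of "Inr (Suc (length \<Gamma>), jclass R (free X) (\<Gamma> \<turnstile> Term t T))"]
    by (simp add: translate_def basic_term_def normal_form_def permute_def del: upt_Suc translate_expr.simps)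
qed

lemma normal_form_derived:
  assumes "is_presheaf X" "R = w_rules \<or> R = wp_rules" "J \<in> derived R (free X)"
  shows "normal_form J \<in> derived R (free X)"
proof -
  have "fv_judgement J \<subseteq> set (vars (jctx J))" using derived_closed[OF assms] by (simp add: closed_def)
  then show ?thesis
    unfolding normal_form_def using assms(2,3) by (intro derived_permute inj_on_subset[OF inj_on_pos]) auto
qed

lemma translate_derived:
  assumes X: "is_presheaf X" and R: "R = w_rules \<or> R = wp_rules"
    and J: "J \<in> derived R (free (forget R (free X)))"
  shows "translate J \<in> derived R (free X)"
  using J
proof (induction rule: derived.induct)
  case (basic J)
  let ?Y = "forget R (free X)"
  consider n c where "J = basic_type ?Y n c" "c \<in> tyel ?Y n" | n c where "J = basic_term ?Y n c" "c \<in> tmel ?Y n"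
    using basic(1) by (auto simp: basics_free)
  then show ?case
  proof cases
    case 1
    then obtain \<Gamma> S where "(\<Gamma> \<turnstile> Type S) \<in> derived R (free X)" "Suc (length \<Gamma>) = n"
      "c = jclass R (free X) (\<Gamma> \<turnstile> Type S)" unfolding tyel_forget by blast
    then show ?thesis using 1 translate_basic_type[OF X R] normal_form_derived[OF X R] by metis
  next
    case 2
    then obtain \<Gamma> s S where "(\<Gamma> \<turnstile> Term s S) \<in> derived R (free X)" "Suc (length \<Gamma>) = n"
      "c = jclass R (free X) (\<Gamma> \<turnstile> Term s S)" unfolding tmel_forget by blast
    then show ?thesis using 2 translate_basic_term[OF X R] normal_form_derived[OF X R] by metis
  qed
next
  case (rule r Js J)
  have "infers r (map translate Js) (translate J)"
    using rule.hyps(2) derived_translatable[OF X R] rule.hyps by (intro translate_infers) auto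
  then show ?case by (rule derived.rule[OF rule.hyps(1)]) (use rule.IH in auto)
qed

lemma translate_interp:
  assumes X: "is_presheaf X" and R: "R = w_rules \<or> R = wp_rules"
  shows "is_interp R (free (forget R (free X))) (free X) translate"
  unfolding is_interp_def
proof (intro conjI ballI allI impI)
  show "is_gat R (free (forget R (free X)))" by (intro is_gat_free is_presheaf_forget X R)
  show "is_gat R (free X)" by (intro is_gat_free X R)
  show "translate \<in> derived R (free (forget R (free X))) \<rightarrow> derived R (free X)"
    using translate_derived[OF X R] by blast
  show "boundary (translate J) = map translate (boundary J)" for J :: "(nat \<times> (nat \<times> 'a + nat \<times> 'b) judgement set + nat \<times> (nat \<times> 'a + nat \<times> 'b) judgement set) judgement"
    by (rule translate_boundary)
  fix r Js K and J :: "(nat \<times> (nat \<times> 'a + nat \<times> 'b) judgement set + nat \<times> (nat \<times> 'a + nat \<times> 'b) judgement set) judgement"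
  assume *: "set Js \<subseteq> derived R (free (forget R (free X)))" "infers r Js J" "infers r (map translate Js) K"
  have "infers r (map translate Js) (translate J)"
    using *(1) derived_translatable[OF X R] by (intro translate_infers[OF *(2)]) blast
  then show "translate J = K" using *(3) by (rule infers_functional)
qed

lemma translate_jrel:
  assumes X: "is_presheaf X" and R: "R = w_rules \<or> R = wp_rules"
    and JK: "(J, K) \<in> jrel R (free (forget R (free X)))"
  shows "(translate J, translate K) \<in> jrel R (free X)"
proof -
  have *: "J \<in> derived R (free (forget R (free X)))" "K \<in> derived R (free (forget R (free X)))"
    "type_or_term J" "normal_form J = normal_form K"
    using JK by (simp_all add: jrel_free[OF is_presheaf_forget[OF X R] R])
  then have "normal_form (translate J) = normal_form (translate K)"
    using derived_translatable[OF X R] translate_normal_form by metis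
  moreover have "type_or_term (translate J)" using *(3) by (auto simp: type_or_term_def)
  ultimately show ?thesis using * translate_derived[OF X R] by (simp add: jrel_free[OF X R])
qed

section \<open>The counit and the multiplication\<close>

lemma type_or_term_permute: "type_or_term (permute f J) = type_or_term J"
  by (cases "jrhs J") (simp_all add: type_or_term_def)

text \<open>Both sides of this instance of preservation of deduction are always defined.\<close>

lemma interp_permute:
  assumes \<phi>: "is_interp R T U \<phi>" and R: "R = w_rules \<or> R = wp_rules" and J: "J \<in> derived R T" and "bij \<sigma>"
  shows "\<phi> (permute \<sigma> J) = permute \<sigma> (\<phi> J)"
proof -
  have "Perm \<sigma> \<in> R" using R by (auto simp: w_rules_def wp_rules_def)
  moreover have "infers (Perm \<sigma>) [J] (permute \<sigma> J)" "infers (Perm \<sigma>) (map \<phi> [J]) (permute \<sigma> (\<phi> J))"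
    using \<open>bij \<sigma>\<close> by (auto intro: infers.intros)
  moreover have "set [J] \<subseteq> derived R T" using J by simp
  ultimately show ?thesis using \<phi> unfolding is_interp_def by blast
qed

text \<open>A variable \<open>x\<close> of \<open>\<phi> J\<close> that does not occur in \<open>J\<close> could be exchanged with a fresh one: this fixes \<open>J\<close>
  and therefore \<open>\<phi> J\<close>, although it replaces \<open>x\<close>.\<close>

lemma fv_judgement_interp:
  assumes \<phi>: "is_interp R T U \<phi>" and R: "R = w_rules \<or> R = wp_rules" and J: "J \<in> derived R T"
  shows "fv_judgement (\<phi> J) \<subseteq> fv_judgement J"
proof
  fix x assume x: "x \<in> fv_judgement (\<phi> J)"
  show "x \<in> fv_judgement J"
  proof (rule ccontr)
    assume "x \<notin> fv_judgement J"
    obtain z where z: "z \<notin> fv_judgement J \<union> fv_judgement (\<phi> J)"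
      using ex_new_if_finite[of "fv_judgement J \<union> fv_judgement (\<phi> J)"] by auto
    define \<sigma> where "\<sigma> = id(x := z, z := x)"
    have "bij \<sigma>" by (rule involuntory_imp_bij) (auto simp: \<sigma>_def)
    then have "\<phi> (permute \<sigma> J) = permute \<sigma> (\<phi> J)" by (rule interp_permute[OF \<phi> R J])
    moreover have "permute \<sigma> J = J"
      using \<open>x \<notin> fv_judgement J\<close> z by (intro permute_id) (auto simp: \<sigma>_def)
    ultimately have "fv_judgement (\<phi> J) = \<sigma> ` fv_judgement (\<phi> J)" by (metis fv_judgement_permute)
    moreover have "z = \<sigma> x" by (simp add: \<sigma>_def)
    ultimately show False using x z by blast
  qed
qed

lemma normal_form_idem: "closed J \<Longrightarrow> normal_form (normal_form J) = normal_form J"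
  using normal_form_permute[OF _ inj_on_pos, of J] by (simp only: normal_form_def)

lemma singleton_boundary: "boundary J = [K] \<Longrightarrow> \<exists>\<Gamma> S. K = (\<Gamma> \<turnstile> Type S)"
  by (cases J rule: boundary.cases) (auto split: if_splits)

text \<open>Boundary preservation alone does not exclude that a type judgement goes to a term judgement of
  lower degree. But a type judgement is the whole boundary of its own weakening by itself, and
  whatever the image of that weakening is, a boundary with a single entry consists of a type
  judgement.\<close>

lemma interp_type:
  assumes \<phi>: "is_interp R (free Z) (free X) \<phi>" and Z: "is_presheaf Z" and R: "R = w_rules \<or> R = wp_rules"
    and "(\<Gamma> \<turnstile> Type S) \<in> derived R (free Z)"
  shows "\<exists>\<Gamma>' S'. \<phi> (\<Gamma> \<turnstile> Type S) = (\<Gamma>' \<turnstile> Type S') \<and> length \<Gamma>' = length \<Gamma>"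
  using assms(4)
proof (induction \<Gamma> arbitrary: S rule: rev_induct)
  have bd: "boundary (\<phi> J) = map \<phi> (boundary J)" if "J \<in> derived R (free Z)" for J
    using \<phi> that by (simp add: is_interp_def)
  have kind: "\<exists>\<Gamma>' S'. \<phi> (\<Gamma> \<turnstile> Type S) = (\<Gamma>' \<turnstile> Type S')"
    if J: "(\<Gamma> \<turnstile> Type S) \<in> derived R (free Z)" for \<Gamma> S
  proof -
    \<comment> \<open>A fresh variable, so that \<open>J\<close> may be weakened by its own type.\<close>
    obtain y where y: "y \<notin> fv_judgement (\<Gamma> \<turnstile> Type S)" using ex_new_if_finite[OF infinite_UNIV_nat finite_fv_judgement] by blast
    then have "(\<Gamma> @ (y, S) # [] \<turnstile> Type S) \<in> derived R (free Z)"
      using J R by (intro derived_weaken) (simp_all add: fv_judgement_def fv_ctx_def)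
    from bd[OF this] have "boundary (\<phi> (\<Gamma> @ [(y, S)] \<turnstile> Type S)) = [\<phi> (\<Gamma> \<turnstile> Type S)]" by simp
    then show ?thesis by (rule singleton_boundary)
  qed
  {
    case Nil
    obtain \<Gamma>' S' where "\<phi> ([] \<turnstile> Type S) = (\<Gamma>' \<turnstile> Type S')" using kind Nil by blast
    then show ?case using bd[OF Nil] by (simp split: if_splits)
  next
    case (snoc p \<Gamma>)
    obtain \<Delta> S' where \<Delta>: "\<phi> (\<Gamma> @ [p] \<turnstile> Type S) = (\<Delta> \<turnstile> Type S')" using kind snoc.prems by blast
    have "(\<Gamma> \<turnstile> Type (snd p)) \<in> derived R (free Z)"
      using boundary_derived[OF Z R snoc.prems] by simp
    from snoc.IH[OF this] obtain \<Gamma>' T' where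
      "\<phi> (\<Gamma> \<turnstile> Type (snd p)) = (\<Gamma>' \<turnstile> Type T')" "length \<Gamma>' = length \<Gamma>" by blast
    then show ?case using bd[OF snoc.prems] \<Delta> by (cases \<Delta> rule: rev_cases) auto
  }
qed

text \<open>The image of a term judgement has a single boundary; if it were a type judgement, then its context
  would be one longer and would need more variables than there are.\<close>

lemma interp_term:
  assumes \<phi>: "is_interp R (free Z) (free X) \<phi>" and Z: "is_presheaf Z" and X: "is_presheaf X"
    and R: "R = w_rules \<or> R = wp_rules" and J: "(\<Gamma> \<turnstile> Term s S) \<in> derived R (free Z)"
  shows "\<exists>\<Gamma>' s' S'. \<phi> (\<Gamma> \<turnstile> Term s S) = (\<Gamma>' \<turnstile> Term s' S')"
proof -
  have "(\<Gamma> \<turnstile> Type S) \<in> derived R (free Z)" using boundary_derived[OF Z R J] by simp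
  from interp_type[OF \<phi> Z R this] obtain \<Gamma>' S' where
    S': "\<phi> (\<Gamma> \<turnstile> Type S) = (\<Gamma>' \<turnstile> Type S')" "length \<Gamma>' = length \<Gamma>" by blast
  have bd: "boundary (\<phi> (\<Gamma> \<turnstile> Term s S)) = [\<Gamma>' \<turnstile> Type S']"
    using \<phi> J S'(1) by (simp add: is_interp_def)
  show ?thesis
  proof (cases "\<phi> (\<Gamma> \<turnstile> Term s S)" rule: boundary.cases)
    case (1 \<Delta> T)
    then have "length \<Delta> = Suc (length \<Gamma>)" using bd S'(2) by (cases \<Delta> rule: rev_cases) auto
    moreover have "\<phi> (\<Gamma> \<turnstile> Term s S) \<in> derived R (free X)" using \<phi> J by (auto simp: is_interp_def)
    then have "distinct (vars \<Delta>)" using derived_closed[OF X R] 1 by (force simp: closed_def)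
    then have "card (set (vars \<Delta>)) = length \<Delta>" by (simp add: distinct_card)
    moreover have "set (vars \<Delta>) \<subseteq> set (vars \<Gamma>)"
      using vars_subset_fv_judgement[of "\<phi> (\<Gamma> \<turnstile> Term s S)"] fv_judgement_interp[OF \<phi> R J] derived_closed[OF Z R J] 1
      by (auto simp: closed_def)
    then have "card (set (vars \<Delta>)) \<le> length \<Gamma>"
      using card_mono[of "set (vars \<Gamma>)"] card_length[of "vars \<Gamma>"] by (metis List.finite_set le_trans vars_simps(4))
    ultimately show ?thesis by simp
  qed (use bd in auto)
qed

text \<open>Interpretations that satisfy the defining condition of the counit.\<close>

locale counit_candidate =
  fixes R :: "rule set" and X :: "('a, 'b) presheaf"
    and \<phi> :: "(nat \<times> (nat \<times> 'a + nat \<times> 'b) judgement set + nat \<times> (nat \<times> 'a + nat \<times> 'b) judgement set) judgement \<Rightarrow>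
      (nat \<times> 'a + nat \<times> 'b) judgement"
  assumes X: "is_presheaf X" and R: "R = w_rules \<or> R = wp_rules"
    and interp: "is_interp R (free (forget R (free X))) (free X) \<phi>"
    and on_types: "\<And>J. J \<in> type_judgements R (free X) \<Longrightarrow>
      (\<phi> (basic_type (forget R (free X)) (degree J) (jclass R (free X) J)), J) \<in> jrel R (free X)"
    and on_terms: "\<And>J. J \<in> term_judgements R (free X) \<Longrightarrow>
      (\<phi> (basic_term (forget R (free X)) (degree J) (jclass R (free X) J)), J) \<in> jrel R (free X)"
begin

abbreviation "Y \<equiv> forget R (free X)"

lemma Y: "is_presheaf Y"
  by (rule is_presheaf_forget[OF X R])

lemma interp_derived: "J \<in> derived R (free Y) \<Longrightarrow> \<phi> J \<in> derived R (free X)"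
  using interp by (auto simp: is_interp_def)

lemma interp_boundary: "J \<in> derived R (free Y) \<Longrightarrow> boundary (\<phi> J) = map \<phi> (boundary J)"
  using interp by (auto simp: is_interp_def)

text \<open>Judgements with the same variables and the same normal form are equal.\<close>

lemma eq_translateI:
  assumes J: "J \<in> derived R (free Y)" and K: "K \<in> derived R (free X)" and translate_expr: "translate J = normal_form K"
    and normal_form: "normal_form (\<phi> J) = normal_form K" and vars: "vars (jctx (\<phi> J)) = vars (jctx J)"
  shows "\<phi> J = translate J"
proof (rule normal_form_inj)
  show "closed (\<phi> J)" by (rule derived_closed[OF X R interp_derived[OF J]])
  show "closed (translate J)" unfolding translate_expr by (rule closed_normal_form[OF derived_closed[OF X R K]])
  show "normal_form (\<phi> J) = normal_form (translate J)"
    unfolding translate_expr normal_form by (rule normal_form_idem[OF derived_closed[OF X R K], symmetric])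
  show "vars (jctx (\<phi> J)) = vars (jctx (translate J))" unfolding vars_translate by (rule vars)
qed

text \<open>The boundary determines the image of a basic type judgement except for the name of the last
  declared variable. The image has as many variables as the judgement and no others, so only one name
  is left for it.\<close>

lemma eq_translate_basic_type:
  assumes "n \<ge> 1" "c \<in> tyel Y n"
  shows "\<phi> (basic_type Y n c) = translate (basic_type Y n c)"
  using assms
proof (induction n arbitrary: c rule: nat_induct_at_least)
  have *: "\<phi> (basic_type Y n c) = translate (basic_type Y n c)"
    if n: "n \<ge> 1" and c: "c \<in> tyel Y n" and vars: "vars (jctx (\<phi> (basic_type Y n c))) = [1..<n]" for n c
  proof -
    obtain \<Gamma> S where J: "(\<Gamma> \<turnstile> Type S) \<in> derived R (free X)" "Suc (length \<Gamma>) = n"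
      "c = jclass R (free X) (\<Gamma> \<turnstile> Type S)" using c unfolding tyel_forget by blast
    show ?thesis
    proof (rule eq_translateI[OF basic_type_derived[OF Y n c] J(1)])
      show "translate (basic_type Y n c) = normal_form (\<Gamma> \<turnstile> Type S)"
        using translate_basic_type[OF X R J(1)] J(2,3) by simp
      show "normal_form (\<phi> (basic_type Y n c)) = normal_form (\<Gamma> \<turnstile> Type S)"
        using on_types[of "\<Gamma> \<turnstile> Type S"] J by (simp add: type_judgements_def degree_def jrel_free[OF X R])
      show "vars (jctx (\<phi> (basic_type Y n c))) = vars (jctx (basic_type Y n c))"
        using vars by (simp add: basic_type_def)
    qed
  qed
  have len: "\<exists>\<Gamma> T. \<phi> (basic_type Y n c) = (\<Gamma> \<turnstile> Type T) \<and> length \<Gamma> = n - 1"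
    if n: "n \<ge> 1" and c: "c \<in> tyel Y n" for n c
    using interp_type[OF interp Y R] basic_type_derived[OF Y n c] unfolding basic_type_def
    by (metis length_upt vars_basic_ctx vars_simps(4))
  {
    case base
    have "vars (jctx (\<phi> (basic_type Y 1 c))) = []"
      using len[of 1 c] base by auto
    then show ?case using base by (intro *) simp_all
  next
    case (Suc m)
    let ?J = "basic_type Y (Suc m) c"
    have J: "?J \<in> derived R (free Y)" using Suc by (intro basic_type_derived[OF Y]) simp_all
    obtain \<Gamma> T where \<Gamma>: "\<phi> ?J = (\<Gamma> \<turnstile> Type T)" "length \<Gamma> = m"
      using len[of "Suc m" c] Suc by auto
    then have ne: "\<Gamma> \<noteq> []" using Suc by auto
    have "class_boundary R (free X) c \<in> tyel Y m"
      using Y Suc by (auto simp: is_presheaf_def Pi_def)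
    then have "boundary (\<phi> ?J) = [translate (basic_type Y m (class_boundary R (free X) c))]"
      using Suc interp_boundary[OF J] by (simp add: boundary_basic_type)
    then have "(butlast \<Gamma> \<turnstile> Type (snd (last \<Gamma>))) = translate (basic_type Y m (class_boundary R (free X) c))"
      using \<Gamma> ne by simp
    then have "vars (butlast \<Gamma>) = vars (jctx (translate (basic_type Y m (class_boundary R (free X) c))))"
      by (metis judgement.sel(1))
    then have "vars (butlast \<Gamma>) = [1..<m]" by (simp only: vars_translate) (simp add: basic_type_def)
    then have vars: "vars \<Gamma> = [1..<m] @ [fst (last \<Gamma>)]"
      using ne by (metis append_butlast_last_id vars_simps(1-3))
    have "set (vars \<Gamma>) \<subseteq> fv_judgement (\<phi> ?J)" using \<Gamma> vars_subset_fv_judgement[of "\<phi> ?J"] by simp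
    also have "\<dots> \<subseteq> {1..<Suc m}"
      using fv_judgement_interp[OF interp R J] Suc fv_judgement_basic_type[OF Y] by simp
    finally have "fst (last \<Gamma>) \<in> {1..<Suc m}" using vars by simp
    moreover have "distinct (vars \<Gamma>)"
      using derived_closed[OF X R interp_derived[OF J]] \<Gamma> by (simp add: closed_def)
    then have "fst (last \<Gamma>) \<notin> {1..<m}" using vars by simp
    ultimately have "fst (last \<Gamma>) = m" by auto
    then have "vars \<Gamma> = [1..<Suc m]" using vars Suc by simp
    then show ?case using Suc \<Gamma> by (intro *) simp_all
  }
qed

lemma eq_translate_basic_term:
  assumes n: "n \<ge> 1" and c: "c \<in> tmel Y n"
  shows "\<phi> (basic_term Y n c) = translate (basic_term Y n c)"
proof -
  obtain \<Gamma> s S where J: "(\<Gamma> \<turnstile> Term s S) \<in> derived R (free X)" "Suc (length \<Gamma>) = n"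
    "c = jclass R (free X) (\<Gamma> \<turnstile> Term s S)" using c unfolding tmel_forget by blast
  have normal_form: "normal_form (\<phi> (basic_term Y n c)) = normal_form (\<Gamma> \<turnstile> Term s S)"
    using on_terms[of "\<Gamma> \<turnstile> Term s S"] J by (simp add: term_judgements_def degree_def jrel_free[OF X R])
  have bt: "basic_term Y n c \<in> derived R (free Y)" by (rule basic_term_derived[OF Y n c])
  obtain \<Delta> t T where \<Delta>: "\<phi> (basic_term Y n c) = (\<Delta> \<turnstile> Term t T)"
    using interp_term[OF interp Y X R] bt unfolding basic_term_def by metis
  have "boundary (\<phi> (basic_term Y n c)) = [\<phi> (basic_type Y n (bdtm Y n c))]"
    using interp_boundary[OF bt] by (simp only: boundary_basic_term list.map)
  also have "\<phi> (basic_type Y n (bdtm Y n c)) = translate (basic_type Y n (bdtm Y n c))"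
    by (rule eq_translate_basic_type[OF n bdtm_in[OF Y n c]])
  finally have "\<Delta> = jctx (translate (basic_type Y n (bdtm Y n c)))" using \<Delta> by (metis boundary.simps(2) judgement.sel(1) list.inject)
  then have "vars \<Delta> = vars (jctx (basic_type Y n (bdtm Y n c)))" by (simp only: vars_translate)
  then have vars: "vars \<Delta> = [1..<n]" by (simp add: basic_type_def)
  have translate_expr: "translate (basic_term Y n c) = normal_form (\<Gamma> \<turnstile> Term s S)"
    using translate_basic_term[OF X R J(1)] J(2,3) by simp
  have "vars (jctx (\<phi> (basic_term Y n c))) = vars (jctx (basic_term Y n c))"
    using vars \<Delta> by (simp add: basic_term_def)
  with normal_form translate_expr show ?thesis by (intro eq_translateI[OF bt J(1)])
qed

text \<open>Rules other than conversion that conclude a type or term judgement have only such premises; there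
  the translated premises are an instance of the rule, whose conclusion must be the value. Conversion
  leaves its second premise as it is, because the types are equal.\<close>

lemma eq_translate:
  assumes "J \<in> derived R (free Y)" "type_or_term J"
  shows "\<phi> J = translate J"
  using assms
proof (induction rule: derived.induct)
  case (basic J)
  then show ?case using eq_translate_basic_type eq_translate_basic_term by (auto simp: basics_free)
next
  case (rule r Js J)
  show ?case
  proof (cases "\<forall>K\<in>set Js. type_or_term K")
    case True
    then have eq: "map \<phi> Js = map translate Js" using rule.IH by simp
    have "infers r (map translate Js) (translate J)"
      using rule.hyps(3) derived_translatable[OF X R] by (intro translate_infers[OF rule.hyps(2)]) blast
    then have "infers r (map \<phi> Js) (translate J)" by (simp only: eq)
    moreover have "set Js \<subseteq> derived R (free Y)" using rule.hyps by auto
    ultimately show ?thesis using interp rule.hyps(1,2) unfolding is_interp_def by blast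
  next
    case False
    from rule.hyps(2) show ?thesis
    proof cases
      case (7 \<Gamma> T1 T2 t)
      then have "(\<Gamma> \<turnstile> TypeEq T1 T2) \<in> derived R (free Y)" using rule.hyps by simp
      then have "T1 = T2" by (simp add: derived_iff_wf[OF Y R] wf_def)
      then show ?thesis using rule.IH[of J] 7 by simp
    qed (use False rule.prems in \<open>auto simp: type_or_term_permute type_or_term_def[of "_ \<turnstile> _"]\<close>)
  qed
qed

end

lemma is_counit_candidate:
  assumes "is_presheaf X" "R = w_rules \<or> R = wp_rules" "is_counit R (free X) \<Phi>" "\<phi> \<in> \<Phi>"
    "is_interp R (free (forget R (free X))) (free X) \<phi>"
  shows "counit_candidate R X \<phi>"
  using assms by unfold_locales (auto simp: is_counit_def)

lemma interp_rel_translateI: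
  assumes X: "is_presheaf X" and R: "R = w_rules \<or> R = wp_rules"
  shows "(translate, translate) \<in> interp_rel R (free (forget R (free X))) (free X)"
proof -
  have "(translate J, translate J) \<in> jrel R (free X)"
    if "J \<in> type_judgements R (free (forget R (free X))) \<union> term_judgements R (free (forget R (free X)))" for J
  proof -
    have "J \<in> derived R (free (forget R (free X)))" "type_or_term J"
      using that by (auto simp: type_judgements_def term_judgements_def)
    then show ?thesis by (intro translate_jrel[OF X R] jrel_free_refl is_presheaf_forget[OF X R] R)
  qed
  then show ?thesis using translate_interp[OF X R] by (simp add: interp_rel_def)
qed

text \<open>A class of interpretations in the quotient could be empty if its representative were not related to
  itself, and an empty class would satisfy the condition on the counit vacuously. This is why uniqueness
  needs \<open>interp_type\<close> and \<open>interp_term\<close>.\<close>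

theorem counit_eq:
  assumes X: "is_presheaf X" and R: "R = w_rules \<or> R = wp_rules"
  shows "counit R (free X) = interp_rel R (free (forget R (free X))) (free X) `` {translate}"
  unfolding counit_def
proof (rule the_equality)
  let ?F = "free (forget R (free X))"
  have Y: "is_presheaf (forget R (free X))" by (rule is_presheaf_forget[OF X R])
  have rel: "(\<epsilon> K, J) \<in> jrel R (free X)"
    if "(translate, \<epsilon>) \<in> interp_rel R ?F (free X)" "K \<in> type_judgements R ?F \<union> term_judgements R ?F"
      "translate K = normal_form J" "J \<in> derived R (free X)" for \<epsilon> K J
  proof -
    have "(translate K, \<epsilon> K) \<in> jrel R (free X)" using that(1,2) unfolding interp_rel_def by blast
    then have *: "type_or_term (normal_form J)" "normal_form (normal_form J) = normal_form (\<epsilon> K)" "\<epsilon> K \<in> derived R (free X)"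
      unfolding that(3) by (simp_all add: jrel_free[OF X R])
    then have "normal_form (\<epsilon> K) = normal_form J" using normal_form_idem derived_closed[OF X R that(4)] by metis
    moreover have "type_or_term (\<epsilon> K)" by (rule type_or_term_normal_form_cong[OF *(2,1)])
    ultimately show ?thesis using * that(4) by (simp add: jrel_free[OF X R])
  qed
  have "(\<epsilon> (basic_type (forget R (free X)) (degree J) (jclass R (free X) J)), J) \<in> jrel R (free X)"
    if \<epsilon>: "(translate, \<epsilon>) \<in> interp_rel R ?F (free X)" and "J \<in> type_judgements R (free X)" for \<epsilon> J
  proof -
    obtain \<Gamma> S where J: "J = (\<Gamma> \<turnstile> Type S)" "(\<Gamma> \<turnstile> Type S) \<in> derived R (free X)"
      using \<open>J \<in> type_judgements R (free X)\<close> by (auto simp: type_judgements_def)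
    have "basic_type (forget R (free X)) (degree J) (jclass R (free X) J) \<in> derived R ?F"
      using J by (intro basic_type_derived Y) (auto simp: degree_def tyel_forget)
    then show ?thesis
      using J translate_basic_type[OF X R J(2)]
      by (intro rel[OF \<epsilon>]) (auto simp: type_judgements_def degree_def basic_type_def)
  qed
  moreover have "(\<epsilon> (basic_term (forget R (free X)) (degree J) (jclass R (free X) J)), J) \<in> jrel R (free X)"
    if \<epsilon>: "(translate, \<epsilon>) \<in> interp_rel R ?F (free X)" and "J \<in> term_judgements R (free X)" for \<epsilon> J
  proof -
    obtain \<Gamma> s S where J: "J = (\<Gamma> \<turnstile> Term s S)" "(\<Gamma> \<turnstile> Term s S) \<in> derived R (free X)"
      using \<open>J \<in> term_judgements R (free X)\<close> by (auto simp: term_judgements_def)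
    have "basic_term (forget R (free X)) (degree J) (jclass R (free X) J) \<in> derived R ?F"
      using J by (intro basic_term_derived Y) (auto simp: degree_def tmel_forget)
    then show ?thesis
      using J translate_basic_term[OF X R J(2)]
      by (intro rel[OF \<epsilon>]) (auto simp: term_judgements_def degree_def basic_term_def)
  qed
  moreover have "interp_rel R ?F (free X) `` {translate} \<in> gat_hom R ?F (free X)"
    unfolding gat_hom_def using translate_interp[OF X R] by (intro quotientI) simp
  ultimately show "is_counit R (free X) (interp_rel R ?F (free X) `` {translate})"
    by (simp add: is_counit_def)
next
  let ?F = "free (forget R (free X))"
  fix \<Phi> assume \<Phi>: "is_counit R (free X) \<Phi>"
  then have "\<Phi> \<in> gat_hom R ?F (free X)" by (simp add: is_counit_def)
  then obtain \<phi> where \<phi>: "is_interp R ?F (free X) \<phi>" "\<Phi> = interp_rel R ?F (free X) `` {\<phi>}"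
    by (auto simp: gat_hom_def quotient_def)
  have Y: "is_presheaf (forget R (free X))" by (rule is_presheaf_forget[OF X R])
  have "(\<phi> J, \<phi> J) \<in> jrel R (free X)" if J: "J \<in> type_judgements R ?F \<union> term_judgements R ?F" for J
  proof (rule jrel_free_refl[OF X R])
    show "\<phi> J \<in> derived R (free X)"
      using \<phi>(1) J by (auto simp: is_interp_def type_judgements_def term_judgements_def)
    consider \<Gamma> S where "J = (\<Gamma> \<turnstile> Type S)" "(\<Gamma> \<turnstile> Type S) \<in> derived R ?F"
      | \<Gamma> s S where "J = (\<Gamma> \<turnstile> Term s S)" "(\<Gamma> \<turnstile> Term s S) \<in> derived R ?F"
      using J by (auto simp: type_judgements_def term_judgements_def)
    then show "type_or_term (\<phi> J)"
    proof cases
      case 1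
      then show ?thesis using interp_type[OF \<phi>(1) Y R 1(2)] by auto
    next
      case 2
      then show ?thesis using interp_term[OF \<phi>(1) Y X R 2(2)] by auto
    qed
  qed
  then have "\<phi> \<in> \<Phi>" using \<phi> by (simp add: interp_rel_def)
  then interpret counit_candidate R X \<phi> by (rule is_counit_candidate[OF X R \<Phi> _ \<phi>(1)])
  have "\<phi> J = translate J" if "J \<in> type_judgements R ?F \<union> term_judgements R ?F" for J
    using that by (intro eq_translate) (auto simp: type_judgements_def term_judgements_def)
  then show "\<Phi> = interp_rel R ?F (free X) `` {translate}"
    using \<phi> translate_interp[OF X R] by (auto simp: interp_rel_def)
qed

theorem mult_jclass:
  assumes X: "is_presheaf X" and R: "R = w_rules \<or> R = wp_rules"
    and J: "J \<in> derived R (free (forget R (free X)))" "type_or_term J"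
  shows "mult R X (jclass R (free (forget R (free X))) J) = jclass R (free X) (translate J)"
proof -
  let ?F = "free (forget R (free X))"
  have Y: "is_presheaf (forget R (free X))" by (rule is_presheaf_forget[OF X R])
  have "jclass R (free X) (\<phi> K) = jclass R (free X) (translate J)"
    if \<phi>: "\<phi> \<in> counit R (free X)" and K: "K \<in> jclass R ?F J" for \<phi> K
  proof -
    have JK: "(J, K) \<in> jrel R ?F" using K by (simp add: mem_jclass)
    then have *: "K \<in> derived R ?F" "normal_form J = normal_form K" by (simp_all add: jrel_free[OF Y R])
    have "type_or_term K" by (rule type_or_term_normal_form_cong[OF *(2) J(2)])
    then have "K \<in> type_judgements R ?F \<union> term_judgements R ?F"
      using *(1) by (cases K) (auto simp: type_or_term_def type_judgements_def term_judgements_def)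
    then have "(translate K, \<phi> K) \<in> jrel R (free X)"
      using \<phi> by (simp add: counit_eq[OF X R] interp_rel_def)
    moreover have "(translate J, translate K) \<in> jrel R (free X)" by (rule translate_jrel[OF X R JK])
    ultimately show ?thesis by (intro jclass_eqI[OF X R]) (simp_all add: jrel_free[OF X R])
  qed
  moreover have "translate \<in> counit R (free X)"
    using interp_rel_translateI[OF X R] by (simp add: counit_eq[OF X R])
  moreover have "J \<in> jclass R ?F J" using J by (simp add: mem_jclass jrel_free_refl[OF Y R])
  ultimately show ?thesis unfolding mult_def forget_map_def by blast
qed

section \<open>Heaps\<close>

text \<open>The ancestor of \<open>i\<close> at depth \<open>l\<close> in the tree of a heap; at depth \<open>0\<close> it is the root \<open>0\<close>.
  The arguments of the \<open>i\<close>-th type of a heap are its ancestors at depths \<open>1, 2, \<dots>\<close>.\<close>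

definition anc :: "(nat \<Rightarrow> nat) \<Rightarrow> nat \<Rightarrow> nat \<Rightarrow> nat" where
  "anc \<phi> i l = (\<phi> ^^ (dp \<phi> i - l)) i"

lemma Hp_zero [simp]: "\<phi> \<in> Hp n \<Longrightarrow> \<phi> 0 = 0"
  and Hp_less: "\<phi> \<in> Hp n \<Longrightarrow> 1 \<le> i \<Longrightarrow> i \<le> n \<Longrightarrow> \<phi> i < i"
  by (auto simp: Hp_def)

lemma Hp_funpow_zero [simp]: "\<phi> \<in> Hp n \<Longrightarrow> (\<phi> ^^ k) 0 = 0"
  by (induction k) simp_all

lemma Hp_funpow_le:
  assumes "\<phi> \<in> Hp n" "i \<le> n"
  shows "(\<phi> ^^ k) i \<le> i"
proof (induction k)
  case (Suc k)
  show ?case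
  proof (cases "(\<phi> ^^ k) i = 0")
    case False
    then have "\<phi> ((\<phi> ^^ k) i) < (\<phi> ^^ k) i" using Suc assms by (intro Hp_less[OF assms(1)]) simp_all
    then show ?thesis using Suc by simp
  qed (use assms in simp)
qed simp

text \<open>The case distinction is needed since the root \<open>0\<close> is its own image, hence has depth 1.\<close>

lemma dp_rec:
  assumes \<phi>: "\<phi> \<in> Hp n" and i: "1 \<le> i" "i \<le> n"
  shows "dp \<phi> i = (if \<phi> i = 0 then 1 else Suc (dp \<phi> (\<phi> i)))"
proof -
  define D where "D j = (\<lambda>k. (\<phi> ^^ k) j) ` {1..}" for j
  have dp: "dp \<phi> j = card (D j)" for j
    unfolding dp_def D_def by (rule arg_cong[of _ _ card]) auto
  have D: "D j = insert (\<phi> j) (D (\<phi> j))" for j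
  proof -
    have "k \<in> {1..} \<longleftrightarrow> k \<in> range Suc" for k by (cases k) auto
    then have "{1..} = range (Suc :: nat \<Rightarrow> nat)" by blast
    then have "D j = (\<lambda>k. (\<phi> ^^ k) (\<phi> j)) ` UNIV"
      unfolding D_def by (simp only: image_image funpow_Suc_right o_apply)
    also have "(UNIV :: nat set) = insert 0 {1..}" by auto
    also have "(\<lambda>k. (\<phi> ^^ k) (\<phi> j)) ` insert 0 {1..} = insert (\<phi> j) (D (\<phi> j))"
      unfolding D_def image_insert by simp
    finally show ?thesis .
  qed
  show ?thesis
  proof (cases "\<phi> i = 0")
    case True
    have "D 0 = {0}" unfolding D_def by (simp add: Hp_funpow_zero[OF \<phi>] image_constant_conv)
    then have "D i = {0}" using D[of i] True by auto
    then show ?thesis using True by (simp add: dp)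
  next
    case False
    let ?j = "\<phi> i"
    have j: "?j \<le> n" using Hp_less[OF \<phi> i] i by simp
    have less: "x < ?j" if x: "x \<in> D ?j" for x
    proof -
      obtain k where k: "k \<ge> 1" "x = (\<phi> ^^ k) ?j" using x unfolding D_def by auto
      then obtain m where m: "k = Suc m" by (cases k) simp_all
      have "x = (\<phi> ^^ m) (\<phi> ?j)" unfolding k(2) m by (simp only: funpow_Suc_right o_apply)
      moreover have "\<phi> ?j < ?j" using Hp_less[OF \<phi>] False j by simp
      ultimately show ?thesis using Hp_funpow_le[OF \<phi>, of "\<phi> ?j" m] j by simp
    qed
    then have "D ?j \<subseteq> {..<?j}" by blast
    then have "finite (D ?j)" by (rule finite_subset) simp
    moreover have "?j \<notin> D ?j" using less by blast
    ultimately show ?thesis using False by (simp add: dp D[of i])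
  qed
qed

lemma dp_ge_1: "\<phi> \<in> Hp n \<Longrightarrow> 1 \<le> i \<Longrightarrow> i \<le> n \<Longrightarrow> 1 \<le> dp \<phi> i"
  using dp_rec[of \<phi> n i] by simp

lemma dp_funpow:
  assumes \<phi>: "\<phi> \<in> Hp n" and i: "1 \<le> i" "i \<le> n" and "m < dp \<phi> i"
  shows "(\<phi> ^^ m) i > 0 \<and> dp \<phi> ((\<phi> ^^ m) i) = dp \<phi> i - m"
  using assms(4)
proof (induction m)
  case (Suc m)
  let ?j = "(\<phi> ^^ m) i"
  have j: "?j > 0" "dp \<phi> ?j = dp \<phi> i - m" "?j \<le> n"
    using Suc Hp_funpow_le[OF \<phi> i(2), of m] i by auto
  have "dp \<phi> ?j = (if \<phi> ?j = 0 then 1 else Suc (dp \<phi> (\<phi> ?j)))"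
    using j by (intro dp_rec[OF \<phi>]) simp_all
  then show ?case using j Suc.prems by (auto split: if_splits)
qed (use i in simp)

lemma funpow_pos_iff:
  assumes \<phi>: "\<phi> \<in> Hp n" and i: "1 \<le> i" "i \<le> n"
  shows "(\<phi> ^^ m) i > 0 \<longleftrightarrow> m < dp \<phi> i"
proof (cases "m < dp \<phi> i")
  case False
  let ?j = "(\<phi> ^^ (dp \<phi> i - 1)) i"
  have d: "dp \<phi> i \<ge> 1" by (rule dp_ge_1[OF assms])
  then have j: "?j > 0" "dp \<phi> ?j = 1" "?j \<le> n"
    using dp_funpow[OF assms, of "dp \<phi> i - 1"] Hp_funpow_le[OF \<phi> i(2), of "dp \<phi> i - 1"] i by auto
  have "\<phi> ?j = 0"
  proof (rule ccontr)
    assume *: "\<phi> ?j \<noteq> 0"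
    have "\<phi> ?j \<le> n" using Hp_less[OF \<phi>, of ?j] j by simp
    then have "dp \<phi> (\<phi> ?j) \<ge> 1" using * by (intro dp_ge_1[OF \<phi>]) simp_all
    then show False using dp_rec[OF \<phi>, of ?j] j * by simp
  qed
  moreover have "m = (m - dp \<phi> i) + Suc (dp \<phi> i - 1)" using False d by simp
  then have "(\<phi> ^^ m) i = (\<phi> ^^ (m - dp \<phi> i)) (\<phi> ?j)" by (metis funpow_add funpow.simps(2) o_apply)
  ultimately show ?thesis using False \<phi> by simp
qed (use dp_funpow[OF assms] in blast)

lemma anc_dp [simp]: "anc \<phi> i (dp \<phi> i) = i"
  by (simp add: anc_def)

lemma anc_0:
  assumes \<phi>: "\<phi> \<in> Hp n" and i: "1 \<le> i" "i \<le> n"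
  shows "anc \<phi> i 0 = 0"
  using funpow_pos_iff[OF assms, of "dp \<phi> i"] by (simp add: anc_def)

lemma anc:
  assumes \<phi>: "\<phi> \<in> Hp n" and i: "1 \<le> i" "i \<le> n" and l: "1 \<le> l" "l \<le> dp \<phi> i"
  shows "1 \<le> anc \<phi> i l" "anc \<phi> i l \<le> n" "dp \<phi> (anc \<phi> i l) = l"
  using dp_funpow[OF \<phi> i, of "dp \<phi> i - l"] Hp_funpow_le[OF \<phi> i(2), of "dp \<phi> i - l"] l i
  by (auto simp: anc_def)

lemma anc_less:
  assumes \<phi>: "\<phi> \<in> Hp n" and i: "1 \<le> i" "i \<le> n" and l: "l < dp \<phi> i"
  shows "anc \<phi> i l < i"
proof -
  have "dp \<phi> i - l = Suc (dp \<phi> i - l - 1)" using l by simp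
  then have "anc \<phi> i l = (\<phi> ^^ (dp \<phi> i - l - 1)) (\<phi> i)"
    unfolding anc_def by (metis funpow_Suc_right o_apply)
  moreover have "\<phi> i < i" by (rule Hp_less[OF \<phi> i])
  ultimately show ?thesis using Hp_funpow_le[OF \<phi>, of "\<phi> i" "dp \<phi> i - l - 1"] i by simp
qed

lemma anc_anc:
  assumes \<phi>: "\<phi> \<in> Hp n" and i: "1 \<le> i" "i \<le> n" and l: "1 \<le> l" "l \<le> dp \<phi> i" and m: "m \<le> l"
  shows "anc \<phi> (anc \<phi> i l) m = anc \<phi> i m"
proof -
  have "anc \<phi> (anc \<phi> i l) m = (\<phi> ^^ (l - m)) ((\<phi> ^^ (dp \<phi> i - l)) i)"
    using anc(3)[OF \<phi> i l] by (simp add: anc_def)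
  also have "\<dots> = (\<phi> ^^ ((l - m) + (dp \<phi> i - l))) i" by (simp add: funpow_add)
  also have "(l - m) + (dp \<phi> i - l) = dp \<phi> i - m" using l m by simp
  finally show ?thesis by (simp add: anc_def)
qed

lemma anc_sibling:
  assumes \<phi>: "\<phi> \<in> Hp n" and i: "1 \<le> i" "i \<le> n" and j: "1 \<le> j" "j \<le> n" and eq: "\<phi> i = \<phi> j"
  shows "dp \<phi> i = dp \<phi> j" "l < dp \<phi> j \<Longrightarrow> anc \<phi> i l = anc \<phi> j l"
proof -
  show d: "dp \<phi> i = dp \<phi> j" using dp_rec[OF \<phi> i] dp_rec[OF \<phi> j] eq by simp
  assume "l < dp \<phi> j"
  then have "dp \<phi> j - l = Suc (dp \<phi> j - l - 1)" by simp
  then show "anc \<phi> i l = anc \<phi> j l"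
    unfolding anc_def d by (metis eq funpow_Suc_right o_apply)
qed

lemma heap_args_anc: "heap_args \<phi> i = map Var (map (anc \<phi> i) [1..<dp \<phi> i])"
  by (simp add: heap_args_def anc_def)

lemma heap_maps_in: "h \<in> heap_maps X n \<phi> \<Longrightarrow> 1 \<le> i \<Longrightarrow> i \<le> n \<Longrightarrow> h i \<in> tyel X (dp \<phi> i)"
  unfolding heap_maps_def by (auto dest: PiE_mem)

lemma heap_maps_bdty: "h \<in> heap_maps X n \<phi> \<Longrightarrow> 1 \<le> i \<Longrightarrow> i \<le> n \<Longrightarrow> 0 < \<phi> i \<Longrightarrow>
    h (\<phi> i) = bdty X (dp \<phi> (\<phi> i)) (h i)"
  unfolding heap_maps_def by simp

text \<open>A map out of a heap is determined along a branch by its value at the end of the branch.\<close>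

lemma heap_map_anc:
  assumes \<phi>: "\<phi> \<in> Hp n" and h: "h \<in> heap_maps X n \<phi>" and i: "1 \<le> i" "i \<le> n" and l: "1 \<le> l" "l \<le> dp \<phi> i"
  shows "h (anc \<phi> i l) = bdpow X l (dp \<phi> i - l) (h i)"
  using i l
proof (induction "dp \<phi> i - l" arbitrary: i)
  case 0
  then have "l = dp \<phi> i" by simp
  then show ?case by simp
next
  case (Suc k)
  note i = Suc.prems(1,2)
  have d: "dp \<phi> i = l + Suc k" using Suc by simp
  have ne: "\<phi> i \<noteq> 0"
  proof
    assume "\<phi> i = 0"
    then have "dp \<phi> i = 1" using dp_rec[OF \<phi> i] by simp
    then show False using d Suc.prems(3) by simp
  qed
  then have j: "dp \<phi> (\<phi> i) = l + k" "1 \<le> \<phi> i" "\<phi> i \<le> n"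
    using dp_rec[OF \<phi> i] d Hp_less[OF \<phi> i] i ne by simp_all
  have "anc \<phi> (\<phi> i) l = anc \<phi> i l"
    unfolding anc_def d j(1) by (simp add: funpow_swap1)
  then have "h (anc \<phi> i l) = bdpow X l k (h (\<phi> i))"
    using Suc.hyps(1)[of "\<phi> i"] j Suc.prems(3) by simp
  also have "h (\<phi> i) = bdty X (l + k) (h i)" using h i ne j(1) by (auto simp: heap_maps_def)
  finally show ?case by (simp add: d)
qed

lemma heapP_types: "(\<phi>, h) \<in> tyel (heapP X) n \<longleftrightarrow> \<phi> \<in> Hp n \<and> h \<in> heap_maps X n \<phi>"
  by (simp add: heapP_def)

lemma bdty_heapP: "bdty (heapP X) n (\<phi>, h) = (restrict \<phi> {0..n}, restrict h {1..n})"
  by (simp add: heapP_def)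

lemma heap_spine:
  assumes \<phi>: "\<phi> \<in> Hp n" and h: "h \<in> heap_maps X n \<phi>" and i: "1 \<le> i" "i \<le> n" and m: "i \<le> m"
  shows "spine X (heap_ctx (\<phi>, h) m) (dp \<phi> i) (h i) (map (anc \<phi> i) [1..<dp \<phi> i])"
  unfolding spine_def
proof (intro conjI allI impI)
  show "1 \<le> dp \<phi> i" by (rule dp_ge_1[OF \<phi> i])
  show "h i \<in> tyel X (dp \<phi> i)" using h i by (auto simp: heap_maps_def)
  show "length (map (anc \<phi> i) [1..<dp \<phi> i]) = dp \<phi> i - 1" by simp
  fix k assume k: "k < dp \<phi> i - 1"
  let ?l = "Suc k"
  let ?j = "anc \<phi> i ?l"
  have l: "1 \<le> ?l" "?l \<le> dp \<phi> i" "?l < dp \<phi> i" using k by simp_all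
  note j = anc[OF \<phi> i l(1,2)]
  have "?j < m" using anc_less[OF \<phi> i l(3)] m by simp
  then have "(?j, heap_type (\<phi>, h) ?j) \<in> set (heap_ctx (\<phi>, h) m)"
    using j(1) by (auto simp: heap_ctx_def)
  moreover have "map (anc \<phi> i) [1..<dp \<phi> i] ! k = ?j" using k by simp
  moreover have "take k (map (anc \<phi> i) [1..<dp \<phi> i]) = map (anc \<phi> ?j) [1..<?l]"
  proof -
    have "take k (map (anc \<phi> i) [1..<dp \<phi> i]) = map (anc \<phi> i) [1..<?l]"
      using k by (simp add: take_map take_upt del: upt_Suc)
    also have "\<dots> = map (anc \<phi> ?j) [1..<?l]"
      using anc_anc[OF \<phi> i l(1,2)] by (intro map_cong) auto
    finally show ?thesis .
  qed
  moreover have "h ?j = bdpow X ?l (dp \<phi> i - ?l) (h i)" by (rule heap_map_anc[OF \<phi> h i l(1,2)])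
  ultimately show "(map (anc \<phi> i) [1..<dp \<phi> i] ! k,
      App (Inl (Suc k, bdpow X (Suc k) (dp \<phi> i - Suc k) (h i))) (map Var (take k (map (anc \<phi> i) [1..<dp \<phi> i]))))
    \<in> set (heap_ctx (\<phi>, h) m)"
    using j(3) by (simp add: heap_type_def heap_args_anc)
qed

lemma heap_type_anc:
  "heap_type p i = App (Inl (dp (fst p) i, snd p i)) (map Var (map (anc (fst p) i) [1..<dp (fst p) i]))"
  by (simp add: heap_type_def heap_args_anc split_beta)

lemma heap_ctx_Suc: "1 \<le> m \<Longrightarrow> heap_ctx p (Suc m) = heap_ctx p m @ [(m, heap_type p m)]"
  by (simp add: heap_ctx_def)

lemma vars_heap_ctx [simp]: "vars (heap_ctx p m) = [1..<m]"
  by (simp add: vars_def heap_ctx_def comp_def)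

lemma length_heap_ctx [simp]: "length (heap_ctx p m) = m - 1"
  by (simp add: heap_ctx_def)

lemma wf_heap_type:
  assumes "\<phi> \<in> Hp n" "h \<in> heap_maps X n \<phi>" "1 \<le> i" "i \<le> n" "i \<le> m"
  shows "wf_type X (heap_ctx (\<phi>, h) m) (heap_type (\<phi>, h) i)"
  unfolding heap_type_anc fst_conv snd_conv by (rule wf_type.const[OF heap_spine[OF assms]])

lemma wf_heap_ctx:
  assumes \<phi>: "\<phi> \<in> Hp n" and h: "h \<in> heap_maps X n \<phi>" and "m \<le> Suc n"
  shows "wf_ctx X (heap_ctx (\<phi>, h) m)"
  using assms(3)
proof (induction m)
  case (Suc m)
  show ?case
  proof (cases "m = 0")
    case True
    then show ?thesis by (simp add: heap_ctx_def)
  next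
    case False
    then show ?thesis
      using Suc wf_heap_type[OF \<phi> h, of m m] by (simp add: heap_ctx_Suc wf_ctx_snoc)
  qed
qed (simp add: heap_ctx_def)

lemma heap_type_derived:
  assumes X: "is_presheaf X" and R: "R = w_rules \<or> R = wp_rules"
    and \<phi>: "\<phi> \<in> Hp n" and h: "h \<in> heap_maps X n \<phi>" and n: "1 \<le> n"
  shows "(heap_ctx (\<phi>, h) n \<turnstile> Type (heap_type (\<phi>, h) n)) \<in> derived R (free X)"
  using wf_heap_ctx[OF \<phi> h, of n] wf_heap_type[OF \<phi> h n] by (simp add: derived_iff_wf[OF X R] wf_def)

lemma heap_const_derived:
  assumes X: "is_presheaf X" and R: "R = w_rules \<or> R = wp_rules"
    and \<phi>: "\<phi> \<in> Hp n" and h: "h \<in> heap_maps X n \<phi>" and n: "1 \<le> n" and a: "a \<in> Tm X (dp \<phi> n) (h n)"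
  shows "(heap_ctx (\<phi>, h) n \<turnstile> Term (App (Inr (dp \<phi> n, a)) (heap_args \<phi> n)) (heap_type (\<phi>, h) n))
    \<in> derived R (free X)"
proof -
  have a: "a \<in> tmel X (dp \<phi> n)" "bdtm X (dp \<phi> n) a = h n" using a by (simp_all add: Tm_def)
  have "spine X (heap_ctx (\<phi>, h) n) (dp \<phi> n) (bdtm X (dp \<phi> n) a) (map (anc \<phi> n) [1..<dp \<phi> n])"
    unfolding a(2) using n by (intro heap_spine[OF \<phi> h]) simp_all
  from wf_term.const[OF a(1) this, of R]
  have "wf_term R X (heap_ctx (\<phi>, h) n) (App (Inr (dp \<phi> n, a)) (heap_args \<phi> n)) (heap_type (\<phi>, h) n)"
    unfolding heap_type_anc heap_args_anc a(2) fst_conv snd_conv .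
  then show ?thesis using wf_heap_ctx[OF \<phi> h, of n] by (simp add: derived_iff_wf[OF X R] wf_def)
qed

lemma heap_proj_derived:
  assumes X: "is_presheaf X" and R: "R = wp_rules"
    and \<phi>: "\<phi> \<in> Hp n" and h: "h \<in> heap_maps X n \<phi>" and i: "1 \<le> i" "i < n"
  shows "(heap_ctx (\<phi>, h) n \<turnstile> Term (Var i) (heap_type (\<phi>, h) i)) \<in> derived R (free X)"
proof -
  have "(i, heap_type (\<phi>, h) i) \<in> set (heap_ctx (\<phi>, h) n)" using i by (auto simp: heap_ctx_def)
  then have "wf_term R X (heap_ctx (\<phi>, h) n) (Var i) (heap_type (\<phi>, h) i)"
    using R by (intro wf_term.var) (simp_all add: wp_rules_def)
  then show ?thesis using wf_heap_ctx[OF \<phi> h, of n] R by (simp add: derived_iff_wf[OF X] wf_def)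
qed

text \<open>Siblings have the same proper ancestors. This is what makes \<open>\<pi>\<^sub>i\<close> a term of the \<open>n\<close>-th type.\<close>

lemma heap_type_sibling:
  assumes \<phi>: "\<phi> \<in> Hp n" and i: "1 \<le> i" "i \<le> n" and j: "1 \<le> j" "j \<le> n" and eq: "\<phi> i = \<phi> j" "h i = h j"
  shows "heap_type (\<phi>, h) i = heap_type (\<phi>, h) j"
  using anc_sibling[OF \<phi> i j eq(1)] eq(2) unfolding heap_type_anc by simp

lemma funpow_restrict:
  assumes \<phi>: "\<phi> \<in> Hp n" and "m \<le> n" "i \<le> m"
  shows "(restrict \<phi> {0..m} ^^ k) i = (\<phi> ^^ k) i"
proof (induction k)
  case (Suc k)
  have "(\<phi> ^^ k) i \<le> m" using Hp_funpow_le[OF \<phi>, of i k] assms(2,3) by simp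
  then show ?case using Suc by simp
qed simp

lemma dp_restrict: "\<phi> \<in> Hp n \<Longrightarrow> m \<le> n \<Longrightarrow> i \<le> m \<Longrightarrow> dp (restrict \<phi> {0..m}) i = dp \<phi> i"
  unfolding dp_def by (simp add: funpow_restrict)

lemma heap_type_restrict:
  assumes "\<phi> \<in> Hp n" "m \<le> n" "1 \<le> i" "i \<le> m"
  shows "heap_type (restrict \<phi> {0..m}, restrict h {1..m}) i = heap_type (\<phi>, h) i"
  using assms unfolding heap_type_def heap_args_def by (simp add: dp_restrict funpow_restrict)

lemma heap_ctx_restrict:
  assumes "\<phi> \<in> Hp n" "m \<le> n"
  shows "heap_ctx (restrict \<phi> {0..m}, restrict h {1..m}) m = heap_ctx (\<phi>, h) m"
  unfolding heap_ctx_def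
proof (rule map_cong[OF refl])
  fix i assume "i \<in> set [1..<m]"
  then show "(i, heap_type (restrict \<phi> {0..m}, restrict h {1..m}) i) = (i, heap_type (\<phi>, h) i)"
    using heap_type_restrict[OF assms, of i h] by simp
qed

text \<open>For \<open>k = 0\<close> this uses that heaps and maps are extensional functions.\<close>

lemma bdpow_heapP:
  assumes "(\<phi>, h) \<in> tyel (heapP X) (l + k)"
  shows "bdpow (heapP X) l k (\<phi>, h) = (restrict \<phi> {0..l}, restrict h {1..l})"
proof (cases k)
  case 0
  then have "\<phi> \<in> extensional {0..l}" "h \<in> extensional {1..l}"
    using assms unfolding heapP_types Hp_def heap_maps_def PiE_def by (simp_all only: add_0_right) blast+
  then show ?thesis using 0 by (simp add: extensional_restrict)
next
  case (Suc k)
  have "bdpow (heapP X) l (Suc k) (\<phi>, h) = (restrict \<phi> {0..l}, restrict h {1..l})" for \<phi> h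
  proof (induction k arbitrary: \<phi> h)
    case 0
    then show ?case by (simp only: bdpow.simps bdty_heapP add_0_right)
  next
    case (Suc k)
    have "{0..l + Suc k} \<inter> {0..l} = {0..l}" "{1..l + Suc k} \<inter> {1..l} = {1..l}" by auto
    then show ?case
      using Suc[of "restrict \<phi> {0..l + Suc k}" "restrict h {1..l + Suc k}"]
      by (simp only: bdpow.simps(2)[of _ _ "Suc k"] bdty_heapP restrict_restrict)
  qed
  then show ?thesis by (simp only: Suc)
qed

lemma normal_form_heap:
  assumes "closed (heap_ctx p n \<turnstile> r)" "1 \<le> n"
  shows "normal_form (heap_ctx p n \<turnstile> r) = (heap_ctx p n \<turnstile> r)"
  using assms by (intro normal_form_id) simp_all

section \<open>The identification of the iterated monad\<close>

lemma ident_ty_in_forget: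
  assumes X: "is_presheaf X" and R: "R = w_rules \<or> R = wp_rules" and "p \<in> tyel (heapP X) m" "1 \<le> m"
  shows "ident_ty R X m p \<in> tyel (forget R (free X)) m"
proof -
  obtain \<phi> h where p: "p = (\<phi>, h)" "\<phi> \<in> Hp m" "h \<in> heap_maps X m \<phi>"
    using assms(3) by (cases p) (auto simp: heapP_types)
  show ?thesis
    unfolding tyel_forget ident_ty_def
    using heap_type_derived[OF X R p(2,3) assms(4)] p(1) assms(4)
    by (intro exI[of _ "heap_ctx p m"] exI[of _ "heap_type p m"]) simp
qed

text \<open>The identification of a heap with a class of judgements respects boundaries: both remove the last
  element.\<close>

lemma class_boundary_ident_ty:
  fixes X :: "('a, 'b) presheaf"
  assumes X: "is_presheaf X" and R: "R = w_rules \<or> R = wp_rules" and p: "p \<in> tyel (heapP X) (Suc m)" "1 \<le> m"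
  shows "class_boundary R (free X) (ident_ty R X (Suc m) p) = ident_ty R X m (bdty (heapP X) m p)"
proof -
  obtain \<phi> h where p': "p = (\<phi>, h)" "\<phi> \<in> Hp (Suc m)" "h \<in> heap_maps X (Suc m) \<phi>"
    using p by (cases p) (auto simp: heapP_types)
  have ctx: "heap_ctx p (Suc m) = (heap_ctx p m @ [(m, heap_type p m)] :: (nat \<times> 'a + nat \<times> 'b) ctx)"
    by (rule heap_ctx_Suc[OF p(2)])
  have r: "heap_ctx (bdty (heapP X) m p) m = (heap_ctx p m :: (nat \<times> 'a + nat \<times> 'b) ctx)"
      "heap_type (bdty (heapP X) m p) m = (heap_type p m :: (nat \<times> 'a + nat \<times> 'b) expr)"
    unfolding p'(1) bdty_heapP
    by (rule heap_ctx_restrict[OF p'(2)] heap_type_restrict[OF p'(2)]; use p(2) in simp)+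
  have d: "(heap_ctx p (Suc m) \<turnstile> Type (heap_type p (Suc m))) \<in> derived R (free X)"
    using heap_type_derived[OF X R p'(2,3)] p'(1) by simp
  have ne: "heap_ctx p (Suc m) \<noteq> ([] :: (nat \<times> 'a + nat \<times> 'b) ctx)" using ctx by simp
  have "class_boundary R (free X) (ident_ty R X (Suc m) p) =
      jclass R (free X) (butlast (heap_ctx p (Suc m)) \<turnstile> Type (snd (last (heap_ctx p (Suc m)))))"
    unfolding ident_ty_def by (rule class_boundary_type[OF X R d ne])
  also have "\<dots> = ident_ty R X m (bdty (heapP X) m p)"
    by (simp add: ctx ident_ty_def r)
  finally show ?thesis .
qed

lemma ident_entries_heap:
  assumes X: "is_presheaf X" and R: "R = w_rules \<or> R = wp_rules" and q: "(\<psi>, g) \<in> tyel (heapP (heapP X)) n"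
  shows "(\<lambda>i\<in>{1..n}. ident_ty R X (dp \<psi> i) (g i)) \<in> heap_maps (forget R (free X)) n \<psi>"
proof -
  have \<psi>: "\<psi> \<in> Hp n" and g: "g \<in> heap_maps (heapP X) n \<psi>" using q by (simp_all add: heapP_types)
  show ?thesis
    unfolding heap_maps_def
  proof (intro CollectI conjI ballI impI)
    show "(\<lambda>i\<in>{1..n}. ident_ty R X (dp \<psi> i) (g i)) \<in> (\<Pi>\<^sub>E i\<in>{1..n}. tyel (forget R (free X)) (dp \<psi> i))"
      using heap_maps_in[OF g] dp_ge_1[OF \<psi>] by (auto intro!: ident_ty_in_forget[OF X R])
    fix i assume i: "i \<in> {1..n}" "0 < \<psi> i"
    then have j: "1 \<le> \<psi> i" "\<psi> i \<le> n" "dp \<psi> i = Suc (dp \<psi> (\<psi> i))"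
      using Hp_less[OF \<psi>, of i] dp_rec[OF \<psi>, of i] by simp_all
    have "g i \<in> tyel (heapP X) (Suc (dp \<psi> (\<psi> i)))"
      using heap_maps_in[OF g, of i] i(1) j(3) by simp
    from class_boundary_ident_ty[OF X R this dp_ge_1[OF \<psi> j(1,2)]]
    have "class_boundary R (free X) (ident_ty R X (dp \<psi> i) (g i)) =
        ident_ty R X (dp \<psi> (\<psi> i)) (bdty (heapP X) (dp \<psi> (\<psi> i)) (g i))" using j(3) by simp
    moreover have "g (\<psi> i) = bdty (heapP X) (dp \<psi> (\<psi> i)) (g i)"
      using heap_maps_bdty[OF g] i by simp
    ultimately show "(\<lambda>i\<in>{1..n}. ident_ty R X (dp \<psi> i) (g i)) (\<psi> i) =
        bdty (forget R (free X)) (dp \<psi> (\<psi> i)) ((\<lambda>i\<in>{1..n}. ident_ty R X (dp \<psi> i) (g i)) i)"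
      using i j by simp
  qed
qed

section \<open>Ancestors in \<open>\<psi> \<star> \<phi>\<close> and the value of the multiplication\<close>

locale iterated_heap =
  fixes X :: "('a, 'b) presheaf" and n :: nat and \<psi> :: "nat \<Rightarrow> nat" and g :: "nat \<Rightarrow> 'a ptype"
  assumes X: "is_presheaf X" and n: "1 \<le> n" and q: "(\<psi>, g) \<in> tyel (heapP (heapP X)) n"
begin

abbreviation "\<phi> i \<equiv> fst (g i)"
abbreviation "h i \<equiv> snd (g i)"
abbreviation "\<sigma> \<equiv> star_heap n \<psi> g"
abbreviation "s \<equiv> star_map n \<psi> g"

lemma \<psi>: "\<psi> \<in> Hp n" and g: "g \<in> heap_maps (heapP X) n \<psi>"
  using q by (simp_all add: heapP_types)

lemma entry:
  assumes "1 \<le> i" "i \<le> n"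
  shows "\<phi> i \<in> Hp (dp \<psi> i)" "h i \<in> heap_maps X (dp \<psi> i) (\<phi> i)"
proof -
  have "g i \<in> tyel (heapP X) (dp \<psi> i)" by (rule heap_maps_in[OF g assms])
  then show "\<phi> i \<in> Hp (dp \<psi> i)" "h i \<in> heap_maps X (dp \<psi> i) (\<phi> i)"
    by (cases "g i"; simp add: heapP_types)+
qed

text \<open>Compatibility of the entries extends from parents to all ancestors.\<close>

lemma entry_anc:
  assumes i: "1 \<le> i" "i \<le> n" and l: "1 \<le> l" "l \<le> dp \<psi> i"
  shows "g (anc \<psi> i l) = (restrict (\<phi> i) {0..l}, restrict (h i) {1..l})"
proof -
  have "g (anc \<psi> i l) = bdpow (heapP X) l (dp \<psi> i - l) (g i)"
    by (rule heap_map_anc[OF \<psi> g i l])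
  also have "\<dots> = (restrict (\<phi> i) {0..l}, restrict (h i) {1..l})"
    using bdpow_heapP[of "\<phi> i" "h i" X l "dp \<psi> i - l"] heap_maps_in[OF g i] l by simp
  finally show ?thesis .
qed

lemma star_heap_eq:
  assumes "1 \<le> i" "i \<le> n"
  shows "\<sigma> i = anc \<psi> i (\<phi> i (dp \<psi> i))"
  using assms by (simp add: star_heap_def anc_def)

lemma star_heap_0 [simp]: "\<sigma> 0 = 0"
  by (simp add: star_heap_def)

text \<open>On the branch of \<open>i\<close>, with its elements numbered by depth, the heap \<open>\<psi> \<star> \<phi>\<close> acts as \<open>\<phi>\<^sub>i\<close> does.\<close>

lemma star_heap_anc:
  assumes i: "1 \<le> i" "i \<le> n" and l: "l \<le> dp \<psi> i"
  shows "\<sigma> (anc \<psi> i l) = anc \<psi> i (\<phi> i l)"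
proof (cases "l = 0")
  case True
  then show ?thesis using anc_0[OF \<psi> i] entry(1)[OF i] by simp
next
  case False
  then have l': "1 \<le> l" using l by simp
  have "\<sigma> (anc \<psi> i l) = anc \<psi> (anc \<psi> i l) (\<phi> (anc \<psi> i l) l)"
    using star_heap_eq anc[OF \<psi> i l' l] by simp
  also have "\<phi> (anc \<psi> i l) l = \<phi> i l" by (simp add: entry_anc[OF i l' l])
  also have "anc \<psi> (anc \<psi> i l) (\<phi> i l) = anc \<psi> i (\<phi> i l)"
    using Hp_less[OF entry(1)[OF i] l' l] by (intro anc_anc[OF \<psi> i l' l]) simp
  finally show ?thesis .
qed

lemma star_heap_funpow:
  assumes i: "1 \<le> i" "i \<le> n"
  shows "(\<sigma> ^^ k) i = anc \<psi> i ((\<phi> i ^^ k) (dp \<psi> i))"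
proof (induction k)
  case (Suc k)
  have "(\<phi> i ^^ k) (dp \<psi> i) \<le> dp \<psi> i" by (rule Hp_funpow_le[OF entry(1)[OF i] order_refl])
  from star_heap_anc[OF i this] show ?case using Suc by simp
qed simp

lemma star_heap_Hp: "\<sigma> \<in> Hp n"
proof -
  have less: "\<sigma> i < i" if i: "1 \<le> i" "i \<le> n" for i
    unfolding star_heap_eq[OF i]
    using Hp_less[OF entry(1)[OF i] dp_ge_1[OF \<psi> i] order_refl] by (rule anc_less[OF \<psi> i])
  have "\<sigma> i \<in> {0..n}" if "i \<in> {0..n}" for i
    using less[of i] that by (cases "i = 0") auto
  moreover have "\<sigma> i = undefined" if "i \<notin> {0..n}" for i
    using that unfolding star_heap_def restrict_def by (simp only: if_False)
  ultimately have "\<sigma> \<in> {0..n} \<rightarrow>\<^sub>E {0..n}" by (rule PiE_I)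
  then show ?thesis
    unfolding Hp_def using less by (intro CollectI conjI star_heap_0 ballI) simp_all
qed

text \<open>The depth of \<open>i\<close> is the number of iterates of \<open>i\<close>, itself included, that differ from \<open>0\<close>, and on
  depths up to that of \<open>i\<close> the function \<open>anc \<psi> i\<close> sends only \<open>0\<close> to \<open>0\<close>.\<close>

lemma dp_star:
  assumes i: "1 \<le> i" "i \<le> n"
  shows "dp \<sigma> i = dp (\<phi> i) (dp \<psi> i)"
proof -
  note d = dp_ge_1[OF \<psi> i]
  have "m < dp \<sigma> i \<longleftrightarrow> m < dp (\<phi> i) (dp \<psi> i)" for m
  proof -
    let ?x = "(\<phi> i ^^ m) (dp \<psi> i)"
    have le: "?x \<le> dp \<psi> i" by (rule Hp_funpow_le[OF entry(1)[OF i] order_refl])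
    have "m < dp \<sigma> i \<longleftrightarrow> anc \<psi> i ?x > 0"
      using funpow_pos_iff[OF star_heap_Hp i, of m] star_heap_funpow[OF i, of m] by simp
    also have "\<dots> \<longleftrightarrow> ?x > 0"
      using anc_0[OF \<psi> i] anc(1)[OF \<psi> i, of ?x] le by (cases "?x = 0") auto
    also have "\<dots> \<longleftrightarrow> m < dp (\<phi> i) (dp \<psi> i)"
      by (rule funpow_pos_iff[OF entry(1)[OF i] d order_refl])
    finally show ?thesis .
  qed
  then show ?thesis by (metis nat_neq_iff)
qed

lemma anc_star:
  assumes i: "1 \<le> i" "i \<le> n"
  shows "anc \<sigma> i l = anc \<psi> i (anc (\<phi> i) (dp \<psi> i) l)"
  unfolding anc_def[of \<sigma>] anc_def[of "\<phi> i"] star_heap_funpow[OF i] dp_star[OF i] ..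

lemma star_map_eq: "1 \<le> i \<Longrightarrow> i \<le> n \<Longrightarrow> s i = h i (dp \<psi> i)"
  by (simp add: star_map_def)

lemma star_map_anc:
  assumes i: "1 \<le> i" "i \<le> n" and l: "1 \<le> l" "l \<le> dp \<psi> i"
  shows "s (anc \<psi> i l) = h i l"
  using star_map_eq anc[OF \<psi> i l] l by (simp add: entry_anc[OF i l])

lemma star_map_heap_maps: "s \<in> heap_maps X n \<sigma>"
  unfolding heap_maps_def
proof (intro CollectI conjI ballI impI PiE_I)
  fix i assume "i \<in> {1..n}"
  then have i: "1 \<le> i" "i \<le> n" by simp_all
  have d: "dp \<psi> i \<in> {1..dp \<psi> i}" using dp_ge_1[OF \<psi> i] by simp
  show "s i \<in> tyel X (dp \<sigma> i)"
    unfolding star_map_eq[OF i] dp_star[OF i] using d by (intro heap_maps_in[OF entry(2)[OF i]]) simp_all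
  let ?m = "\<phi> i (dp \<psi> i)"
  assume "0 < \<sigma> i"
  then have "0 < ?m" unfolding star_heap_eq[OF i] using anc_0[OF \<psi> i] by (cases "?m = 0") simp_all
  moreover have "?m < dp \<psi> i" using Hp_less[OF entry(1)[OF i]] d by simp
  ultimately have m: "1 \<le> ?m" "?m \<le> dp \<psi> i" by simp_all
  have "dp \<sigma> (\<sigma> i) = dp (\<phi> i) ?m"
    unfolding star_heap_eq[OF i]
    using dp_star[of "anc \<psi> i ?m"] anc[OF \<psi> i m] dp_restrict[OF entry(1)[OF i] m(2) order_refl]
    by (simp add: entry_anc[OF i m])
  moreover have "h i ?m = bdty X (dp (\<phi> i) ?m) (h i (dp \<psi> i))"
    using d \<open>0 < ?m\<close> by (intro heap_maps_bdty[OF entry(2)[OF i]]) simp_all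
  ultimately show "s (\<sigma> i) = bdty X (dp \<sigma> (\<sigma> i)) (s i)"
    using star_map_anc[OF i m] by (simp add: star_heap_eq[OF i] star_map_eq[OF i])
next
  fix i assume "i \<notin> {1..n}"
  then show "s i = undefined" by (auto simp: star_map_def)
qed

lemma star_type: "star n (\<psi>, g) \<in> tyel (heapP X) n"
  using star_heap_Hp star_map_heap_maps by (simp add: star_def heapP_types)

text \<open>The expressions of the judgement of \<open>\<psi> \<star> \<phi>\<close> are those of the judgements of the \<open>\<phi>\<^sub>i\<close>, instantiated at
  the ancestors of \<open>i\<close>.\<close>

lemma heap_type_star:
  assumes i: "1 \<le> i" "i \<le> n"
  shows "heap_type (\<sigma>, s) i = permute_expr (anc \<psi> i) (heap_type (g i) (dp \<psi> i))"
  unfolding heap_type_anc by (simp add: dp_star[OF i] star_map_eq[OF i] anc_star[OF i])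

lemma heap_args_star:
  assumes i: "1 \<le> i" "i \<le> n"
  shows "heap_args \<sigma> i = map (permute_expr (anc \<psi> i)) (heap_args (\<phi> i) (dp \<psi> i))"
  unfolding heap_args_anc dp_star[OF i] by (simp add: anc_star[OF i])

text \<open>The judgement of a heap is its own normal form, so this is how the translation unfolds a constant
  that names such a judgement.\<close>

lemma translate_expr_const_args:
  assumes R: "R = w_rules \<or> R = wp_rules" and i: "1 \<le> i" "i \<le> n"
    and J: "(heap_ctx (g i) (dp \<psi> i) \<turnstile> r) \<in> derived R (free X)" "type_or_term (heap_ctx (g i) (dp \<psi> i) \<turnstile> r)"
    and w: "case_sum snd snd w = jclass R (free X) (heap_ctx (g i) (dp \<psi> i) \<turnstile> r)"
  shows "translate_expr (App w (heap_args \<psi> i)) = permute_expr (anc \<psi> i) (subject r)"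
proof -
  let ?J = "heap_ctx (g i) (dp \<psi> i) \<turnstile> r"
  let ?ys = "map (anc \<psi> i) [1..<dp \<psi> i]"
  have "normal_form ?J = ?J" by (rule normal_form_heap[OF derived_closed[OF X R J(1)] dp_ge_1[OF \<psi> i]])
  then have body: "const_body w = subject r" using fv_const_body(1)[OF X R J w] by simp
  have fv: "fv (const_body w) \<subseteq> {1..length ?ys}" using fv_const_body(2)[OF X R J w] by simp
  have "translate_expr (App w (heap_args \<psi> i)) = permute_expr (\<lambda>l. ?ys ! (l - 1)) (const_body w)"
    unfolding heap_args_anc by (rule translate_expr_App_Var[OF fv])
  also have "\<dots> = permute_expr (anc \<psi> i) (const_body w)"
    using fv by (intro permute_expr_cong) fastforce
  finally show ?thesis by (simp only: body)
qed

definition entries :: "rule set \<Rightarrow> nat \<Rightarrow> (nat \<times> 'a + nat \<times> 'b) judgement set" where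
  "entries R = (\<lambda>i\<in>{1..n}. ident_ty R X (dp \<psi> i) (g i))"

lemma entries: "R = w_rules \<or> R = wp_rules \<Longrightarrow> entries R \<in> heap_maps (forget R (free X)) n \<psi>"
  unfolding entries_def by (rule ident_entries_heap[OF X _ q])

lemma ident_entries_eq: "ident_entries R X n (\<psi>, g) = (\<psi>, entries R)"
  by (simp add: ident_entries_def entries_def)

lemma translate_expr_heap_type:
  assumes R: "R = w_rules \<or> R = wp_rules" and i: "1 \<le> i" "i \<le> n"
  shows "translate_expr (heap_type (\<psi>, entries R) i) = heap_type (\<sigma>, s) i"
proof -
  let ?J = "heap_ctx (g i) (dp \<psi> i) \<turnstile> Type (heap_type (g i) (dp \<psi> i))"
  have "entries R i = jclass R (free X) ?J" using i by (simp add: entries_def ident_ty_def)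
  moreover have "?J \<in> derived R (free X)"
    using heap_type_derived[OF X R entry[OF i] dp_ge_1[OF \<psi> i]] by simp
  ultimately have "translate_expr (App (Inl (dp \<psi> i, entries R i)) (heap_args \<psi> i)) =
      permute_expr (anc \<psi> i) (subject (Type (heap_type (g i) (dp \<psi> i))))"
    by (intro translate_expr_const_args[OF R i]) simp_all
  then show ?thesis unfolding heap_type_star[OF i] by (simp add: heap_type_def del: translate_expr.simps)
qed

lemma translate_expr_heap_ctx:
  assumes R: "R = w_rules \<or> R = wp_rules"
  shows "map (map_prod id translate_expr) (heap_ctx (\<psi>, entries R) n) = heap_ctx (\<sigma>, s) n"
  unfolding heap_ctx_def map_map using translate_expr_heap_type[OF R] by (intro map_cong) auto

lemma mult_heap:
  assumes R: "R = w_rules \<or> R = wp_rules"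
    and J: "(heap_ctx (\<psi>, entries R) n \<turnstile> r) \<in> derived R (free (forget R (free X)))"
      "type_or_term (heap_ctx (\<psi>, entries R) n \<turnstile> r)"
  shows "mult R X (jclass R (free (forget R (free X))) (heap_ctx (\<psi>, entries R) n \<turnstile> r)) =
    jclass R (free X) (heap_ctx (\<sigma>, s) n \<turnstile> map_rhs translate_expr r)"
  unfolding mult_jclass[OF X R J] by (simp add: translate_def translate_expr_heap_ctx[OF R])

lemma mult_type:
  assumes R: "R = w_rules \<or> R = wp_rules"
  shows "mult R X (ident2_ty R X n (\<psi>, g)) = ident_ty R X n (star n (\<psi>, g))"
proof -
  have "(heap_ctx (\<psi>, entries R) n \<turnstile> Type (heap_type (\<psi>, entries R) n)) \<in> derived R (free (forget R (free X)))"
    by (rule heap_type_derived[OF is_presheaf_forget[OF X R] R \<psi> entries[OF R] n])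
  from mult_heap[OF R this] show ?thesis
    by (simp add: ident2_ty_def ident_entries_eq ident_ty_def monad_def star_def translate_expr_heap_type[OF R n])
qed

lemma ident_tm_derived:
  assumes R: "R = wp_rules" and m: "1 \<le> m" and p: "p \<in> tyel (heapP X) m" and u: "(p, u) \<in> Tm (heapP X) m p"
  obtains t where "ident_tm R X m (p, u) = jclass R (free X) (heap_ctx p m \<turnstile> Term t (heap_type p m))"
    "(heap_ctx p m \<turnstile> Term t (heap_type p m)) \<in> derived R (free X)"
    "t = (case u of Old a \<Rightarrow> App (Inr (dp (fst p) m, a)) (heap_args (fst p) m) | Proj i \<Rightarrow> Var i)"
proof -
  have R': "R = w_rules \<or> R = wp_rules" using R by simp
  obtain f k where p': "p = (f, k)" "f \<in> Hp m" "k \<in> heap_maps X m f"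
    using p by (cases p) (auto simp: heapP_types)
  show ?thesis
  proof (cases u)
    case (Old a)
    then have "a \<in> Tm X (dp f m) (k m)" using u p' by (auto simp: Tm_def heapP_def)
    from heap_const_derived[OF X R' p'(2,3) m this] show ?thesis
      using that Old p' by simp
  next
    case (Proj i)
    then have i: "1 \<le> i" "i < m" "f i = f m" "k i = k m" using u p' by (auto simp: Tm_def heapP_def)
    have eq: "heap_type p i = (heap_type p m :: (nat \<times> 'a + nat \<times> 'b) expr)"
      unfolding p'(1) using i m by (intro heap_type_sibling[OF p'(2)]) simp_all
    show ?thesis
      using heap_proj_derived[OF X R p'(2,3) i(1,2)] eq Proj p'(1) by (intro that[of "Var i"]) simp_all
  qed
qed

lemma term_cases:
  assumes "((\<psi>, g), t) \<in> Tm (heapP (heapP X)) n (\<psi>, g)"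
  obtains (old) u where "t = Old (g n, u)" "(g n, u) \<in> Tm (heapP X) (dp \<psi> n) (g n)"
    | (proj) i where "t = Proj i" "1 \<le> i" "i < n" "\<psi> i = \<psi> n" "g i = g n"
proof -
  have "t \<in> Old ` Tm (heapP X) (dp \<psi> n) (g n) \<union> Proj ` {i \<in> {1..n - 1}. \<psi> n = \<psi> i \<and> g n = g i}"
    using assms by (simp add: Tm_def heapP_def)
  then consider v where "t = Old v" "v \<in> Tm (heapP X) (dp \<psi> n) (g n)"
    | i where "t = Proj i" "1 \<le> i" "i \<le> n - 1" "\<psi> n = \<psi> i" "g n = g i"
    by auto
  then show ?thesis
  proof cases
    case (1 v)
    moreover obtain p u where "v = (p, u)" by (cases v)
    moreover have "p = g n" using 1 \<open>v = (p, u)\<close> by (simp add: Tm_def heapP_def)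
    ultimately show ?thesis using old by simp
  next
    case (2 i)
    then show ?thesis using n by (intro proj[of i]) simp_all
  qed
qed

lemma star_term_old:
  assumes a: "a \<in> Tm X (dp (\<phi> n) (dp \<psi> n)) (h n (dp \<psi> n))"
  shows "(star n (\<psi>, g), Old a) \<in> Tm (heapP X) n (star n (\<psi>, g))"
  using a star_heap_Hp star_map_heap_maps
  by (simp add: Tm_def heapP_def star_def dp_star[OF n order_refl] star_map_eq[OF n order_refl])

lemma star_term_proj:
  assumes j: "1 \<le> j" "j < n" "\<sigma> j = \<sigma> n" "s j = s n"
  shows "(star n (\<psi>, g), Proj j) \<in> Tm (heapP X) n (star n (\<psi>, g))"
  using j star_heap_Hp star_map_heap_maps by (simp add: Tm_def heapP_def star_def)

text \<open>Siblings in \<open>\<psi>\<close> with equal entries are siblings in \<open>\<psi> \<star> \<phi>\<close>: their parents in \<open>\<psi> \<star> \<phi>\<close> are proper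
  ancestors in \<open>\<psi>\<close>, which siblings share.\<close>

lemma star_outer_proj:
  assumes i: "1 \<le> i" "i < n" "\<psi> i = \<psi> n" "g i = g n"
  shows "\<sigma> i = \<sigma> n" "s i = s n"
proof -
  have i': "i \<le> n" using i by simp
  have d: "dp \<psi> i = dp \<psi> n" and a: "\<And>l. l < dp \<psi> n \<Longrightarrow> anc \<psi> i l = anc \<psi> n l"
    using anc_sibling[OF \<psi> i(1) i' n order_refl i(3)] by auto
  have "\<phi> n (dp \<psi> n) < dp \<psi> n"
    by (rule Hp_less[OF entry(1)[OF n order_refl] dp_ge_1[OF \<psi> n order_refl] order_refl])
  then show "\<sigma> i = \<sigma> n"
    using a by (simp add: star_heap_eq[OF i(1) i'] star_heap_eq[OF n order_refl] d i(4))
  show "s i = s n" by (simp add: star_map_eq[OF i(1) i'] star_map_eq[OF n order_refl] d i(4))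
qed

text \<open>Siblings in \<open>\<phi>\<^sub>n\<close> become siblings in \<open>\<psi> \<star> \<phi>\<close> when they are placed on the branch of \<open>n\<close>.\<close>

lemma star_inner_proj:
  assumes i: "1 \<le> i" "i < dp \<psi> n" "\<phi> n i = \<phi> n (dp \<psi> n)" "h n i = h n (dp \<psi> n)"
  shows "1 \<le> anc \<psi> n i" "anc \<psi> n i < n" "\<sigma> (anc \<psi> n i) = \<sigma> n" "s (anc \<psi> n i) = s n"
proof -
  have i': "i \<le> dp \<psi> n" using i by simp
  show "1 \<le> anc \<psi> n i" by (rule anc(1)[OF \<psi> n order_refl i(1) i'])
  show "anc \<psi> n i < n" by (rule anc_less[OF \<psi> n order_refl i(2)])
  show "\<sigma> (anc \<psi> n i) = \<sigma> n"
    using star_heap_anc[OF n order_refl i'] i(3) by (simp add: star_heap_eq[OF n order_refl])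
  show "s (anc \<psi> n i) = s n"
    using star_map_anc[OF n order_refl i(1) i'] i(4) by (simp add: star_map_eq[OF n order_refl])
qed

text \<open>The value of the multiplication is the class of the translated judgement; the cases differ in the
  term that the translation produces. A constant that names an inner projection is unfolded to a
  variable.\<close>

lemma mult_term:
  assumes R: "R = wp_rules" and t: "((\<psi>, g), t) \<in> Tm (heapP (heapP X)) n (\<psi>, g)"
  shows "(star n (\<psi>, g), star_term n \<psi> t) \<in> Tm (heapP X) n (star n (\<psi>, g)) \<and>
    mult R X (ident2_tm R X n ((\<psi>, g), t)) = ident_tm R X n (star n (\<psi>, g), star_term n \<psi> t)"
proof -
  have R': "R = w_rules \<or> R = wp_rules" using R by simp
  note Y = is_presheaf_forget[OF X R']
  note nn = n order_refl
  have sibling: "heap_type (\<sigma>, s) j = (heap_type (\<sigma>, s) n :: (nat \<times> 'a + nat \<times> 'b) expr)" if "1 \<le> j" "j < n" "\<sigma> j = \<sigma> n" "s j = s n" for j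
    using that by (intro heap_type_sibling[OF star_heap_Hp _ _ nn]) simp_all
  from t show ?thesis
  proof (cases rule: term_cases)
    case (proj i)
    note star = star_outer_proj[OF proj(2-5)]
    have "(heap_ctx (\<psi>, entries R) n \<turnstile> Term (Var i) (heap_type (\<psi>, entries R) i))
        \<in> derived R (free (forget R (free X)))"
      by (rule heap_proj_derived[OF Y R \<psi> entries[OF R'] proj(2,3)])
    from mult_heap[OF R' this] have "mult R X (ident2_tm R X n ((\<psi>, g), t)) =
        ident_tm R X n (star n (\<psi>, g), star_term n \<psi> t)"
      using translate_expr_heap_type[OF R', of i] proj
      by (simp add: ident2_tm_def ident_entries_eq monad_def star_def)
    then show ?thesis using star_term_proj[OF proj(2,3) star] proj(1) by simp
  next
    case (old u)
    have gn: "g n \<in> tyel (heapP X) (dp \<psi> n)" by (rule heap_maps_in[OF g nn])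
    note d = dp_ge_1[OF \<psi> nn]
    obtain e where e: "ident_tm R X (dp \<psi> n) (g n, u) =
        jclass R (free X) (heap_ctx (g n) (dp \<psi> n) \<turnstile> Term e (heap_type (g n) (dp \<psi> n)))"
      "(heap_ctx (g n) (dp \<psi> n) \<turnstile> Term e (heap_type (g n) (dp \<psi> n))) \<in> derived R (free X)"
      "e = (case u of Old a \<Rightarrow> App (Inr (dp (\<phi> n) (dp \<psi> n), a)) (heap_args (\<phi> n) (dp \<psi> n)) | Proj i \<Rightarrow> Var i)"
      using ident_tm_derived[OF R d gn old(2)] by metis
    define c where "c = ident_tm R X (dp \<psi> n) (g n, u)"
    have "c \<in> tmel (forget R (free X)) (dp \<psi> n)"
      unfolding tmel_forget c_def e(1) using e(2) d
      by (intro exI[of _ "heap_ctx (g n) (dp \<psi> n)"] exI[of _ e] exI[of _ "heap_type (g n) (dp \<psi> n)"]) simp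
    moreover have "bdtm (forget R (free X)) (dp \<psi> n) c = entries R n"
      unfolding c_def e(1) bd_forget class_boundary_term[OF X R' e(2)]
      using n by (simp add: entries_def ident_ty_def)
    ultimately have "c \<in> Tm (forget R (free X)) (dp \<psi> n) (entries R n)" by (simp add: Tm_def)
    from heap_const_derived[OF Y R' \<psi> entries[OF R'] n this]
    have J: "(heap_ctx (\<psi>, entries R) n \<turnstile> Term (App (Inr (dp \<psi> n, c)) (heap_args \<psi> n)) (heap_type (\<psi>, entries R) n))
        \<in> derived R (free (forget R (free X)))" .
    have translate_expr: "translate_expr (App (Inr (dp \<psi> n, c)) (heap_args \<psi> n)) = permute_expr (anc \<psi> n) e"
      using translate_expr_const_args[OF R' nn e(2), of "Inr (dp \<psi> n, c)"] by (simp add: c_def e(1) del: translate_expr.simps)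
    have mult: "mult R X (ident2_tm R X n ((\<psi>, g), t)) =
        jclass R (free X) (heap_ctx (\<sigma>, s) n \<turnstile> Term (permute_expr (anc \<psi> n) e) (heap_type (\<sigma>, s) n))"
      using mult_heap[OF R' J] translate_expr translate_expr_heap_type[OF R' nn] old(1)
      by (simp add: ident2_tm_def ident_entries_eq monad_def c_def del: translate_expr.simps)
    show ?thesis
    proof (cases u)
      case (Old a)
      have a: "a \<in> Tm X (dp (\<phi> n) (dp \<psi> n)) (h n (dp \<psi> n))"
        using old(2) Old by (auto simp: Tm_def heapP_def)
      have "permute_expr (anc \<psi> n) e = App (Inr (dp \<sigma> n, a)) (heap_args \<sigma> n)"
        by (simp add: e(3) Old heap_args_star[OF nn] dp_star[OF nn])
      then show ?thesis
        using mult star_term_old[OF a] old(1) Old by (simp add: star_def)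
    next
      case (Proj i)
      have i: "1 \<le> i" "i < dp \<psi> n" "\<phi> n i = \<phi> n (dp \<psi> n)" "h n i = h n (dp \<psi> n)"
        using old(2) Proj by (auto simp: Tm_def heapP_def)
      note j = star_inner_proj[OF i]
      have "star_term n \<psi> t = Proj (anc \<psi> n i)" using old(1) Proj by (simp add: anc_def)
      then show ?thesis
        using mult star_term_proj[OF j] sibling[OF j] e(3) Proj by (simp add: star_def)
    qed
  qed
qed

end

theorem proposition27:
  fixes X :: "('a, 'b) presheaf" and n :: nat
    and \<psi> :: "nat \<Rightarrow> nat" and g :: "nat \<Rightarrow> 'a ptype"
  assumes "is_presheaf X" and "n \<ge> 1"
    and "(\<psi>, g) \<in> tyel (heapP (heapP X)) n"
  shows
    "star n (\<psi>, g) \<in> tyel (heapP X) n \<and>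
     mult wp_rules X (ident2_ty wp_rules X n (\<psi>, g)) = ident_ty wp_rules X n (star n (\<psi>, g)) \<and>
     mult w_rules X (ident2_ty w_rules X n (\<psi>, g)) = ident_ty w_rules X n (star n (\<psi>, g)) \<and>
     (\<forall>t. ((\<psi>, g), t) \<in> Tm (heapP (heapP X)) n (\<psi>, g) \<longrightarrow>
        (star n (\<psi>, g), star_term n \<psi> t) \<in> Tm (heapP X) n (star n (\<psi>, g)) \<and>
        mult wp_rules X (ident2_tm wp_rules X n ((\<psi>, g), t)) =
          ident_tm wp_rules X n (star n (\<psi>, g), star_term n \<psi> t))"
proof -
  interpret iterated_heap X n \<psi> g using assms by unfold_locales
  show ?thesis
    using star_type mult_type[of wp_rules] mult_type[of w_rules] mult_term[of wp_rules]
    by (intro conjI allI impI) simp_all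
qed

end
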